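(* Let $k$ be a field of characteristic $0$, $P=k((x_1))((x_2))((\partial_1^{-1}))((\partial_2^{-1}))$ (the case of $n=2$ variables), and $P'=\{(L_1,L_2)\in P^2:[L_1,L_2]=0\}$. For a positive integer $m$ put $$H_m=\frac1m\sum_{a+b=m;\ a,b\ge0}\binom ma H_{a,b},\qquad H_{a,b}(L_1,L_2)=\mathrm{res}_P(L_1^aL_2^b).$$ Then the Hamiltonian system $$\frac{\partial F}{\partial t_m}=\{F,H_m\}_R,\qquad F\in\mathcal F(P^2),$$ has the following properties: i) The variety $P'$ is invariant, and on $P'$ the system has the form $$\frac{\partial L_1}{\partial t_m}=[((L_1+L_2)^{m-1})_+,L_1],\qquad \frac{\partial L_2}{\partial t_m}=[((L_1+L_2)^{m-1})_+,L_2].$$ ii) The functionals $H_{m'}$ ($m'\ge1$) are integrals of motion and $\{H_m,H_{m'}\}_R=0$ on $P'$.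
   Context: For an associative ring $A$ with a derivation $d$, $A((\partial^{-1}))$ is the left $A$-module of formal expressions $\sum_{i\le N}a_i\partial^i$ ($a_i\in A$, $N\in\mathbf{Z}$) with multiplication $(\sum_i a_i\partial^i)(\sum_j b_j\partial^j)=\sum_{i,j;\,l\ge0}\binom{i}{l}a_id^l(b_j)\partial^{i+j-l}$. $P$ is obtained by iterating this construction twice starting from $k((x_1))((x_2))$; at the $i$-th step $\partial_i^{-1}$ is adjoined using the derivation $\partial/\partial x_i$ acting on coefficients. For $L=\sum_{i\le N}a_i\partial_2^i\in P$, $a_i\in k((x_1))((x_2))((\partial_1^{-1}))$, put $L_+=\sum_{i\ge0}a_i\partial_2^i$, $L_-=\sum_{i<0}a_i\partial_2^i$; on $P^2$ these operations are componentwise. $\mathrm{res}_P(L)\in k$ is the coefficient at $x_1^{-1}x_2^{-1}\partial_1^{-1}\partial_2^{-1}$. $P^2$ is a Lie algebra with componentwise bracket $[A,B]=AB-BA$, and carries the nondegenerate bilinear form $\langle L,M\rangle=\sum_{i=1}^2\mathrm{res}_P(L_iM_i)$. $\mathcal F(P^2)$ is the space of polynomial functions in (any number of) coefficients (at the monomials $x_1^{i_1}x_2^{i_2}\partial_1^{j_1}\partial_2^{j_2}$) of the operators $L_1,L_2$; the gradient $\nabla_F(L)\in P^2$ of $F\in\mathcal F(P^2)$ at $L$ is defined by $\langle M,\nabla_F(L)\rangle=\frac{d}{d\epsilon}F(L+\epsilon M)|_{\epsilon=0}$ for all $M\in P^2$. With $RX=X_+-X_-$ and $[X,Y]_R=\frac12[RX,Y]+\frac12[X,RY]=[X_+,Y_+]-[X_-,Y_-]$,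 the Poisson bracket is $\{F,G\}_R(L)=\langle L,[\nabla_F(L),\nabla_G(L)]_R\rangle$. "The system has the form $\partial L_i/\partial t=X_i(L)$" at a point $L$ means that $\frac{d}{d\epsilon}F(L+\epsilon X(L))|_{\epsilon=0}=\{F,H_m\}_R(L)$ for all $F\in\mathcal F(P^2)$, $X=(X_1,X_2)$. $P'$ is invariant if this vector field is tangent to $P'$ at every $L\in P'$, i.e. $[L_1+\epsilon X_1,L_2+\epsilon X_2]=0$ modulo $\epsilon^2$. An integral of motion on $P'$ is a functional whose derivative along this vector field vanishes at all points of $P'$. *)

theory Defs
  imports
    Complex_Main
    "HOL-Computational_Algebra.Computational_Algebra"
    "HOL-Library.Product_Plus"
begin

text \<open>
  An element of \<open>A((\<partial>\<^sup>-\<^sup>1))\<close>, i.e. a formal expression \<open>\<Sum>i\<le>N. a\<^sub>i \<partial>\<^sup>i\<close> is represented by its coefficient function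
  \<open>int \<Rightarrow> 'a\<close> (coefficients on the left), which vanishes above some bound. For such
  functions the sum below is finite.
\<close>

definition int_choose :: "int \<Rightarrow> nat \<Rightarrow> int" where
  \<comment> \<open>\<^const>\<open>gbinomial\<close> at type \<^typ>\<open>int\<close>, which its sort constraint \<^class>\<open>field_char_0\<close> does not admit\<close>
  "int_choose i l = (\<Prod>j = 0..<l. i - int j) div fact l"

lemma of_int_int_choose: "of_int (int_choose i l) = (of_int i gchoose l :: 'a::field_char_0)"
  unfolding int_choose_def using of_int_gbinomial[of i l] by (simp add: gbinomial_prod_rev)

lemma int_choose_0_left: "int_choose 0 l = (if l = 0 then 1 else 0)"
proof (cases l)
  case (Suc n)
  have "(\<Prod>j = 0..<l. 0 - int j) = 0"
    using Suc by (intro prod_zero) auto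
  thus ?thesis using Suc by (simp only: int_choose_def) simp
qed (simp add: int_choose_def)

lemma int_choose_0_right [simp]: "int_choose i 0 = 1"
  by (simp add: int_choose_def)

definition psd_times :: "('a::ring_1 \<Rightarrow> 'a) \<Rightarrow> (int \<Rightarrow> 'a) \<Rightarrow> (int \<Rightarrow> 'a) \<Rightarrow> int \<Rightarrow> 'a" where
  "psd_times d f g n =
    (\<Sum>(i, j, l)\<in>{(i, j, l). f i \<noteq> 0 \<and> g j \<noteq> 0 \<and> i + j - int l = n}.
       of_int (int_choose i l) * f i * (d ^^ l) (g j))"

definition derivation :: "('a::ring_1 \<Rightarrow> 'a) \<Rightarrow> bool" where
  "derivation d \<longleftrightarrow> (\<forall>a b. d (a + b) = d a + d b) \<and> (\<forall>a b. d (a * b) = d a * b + a * d b)"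

lemma derivation_add: "derivation d \<Longrightarrow> (d ^^ l) (a + b) = (d ^^ l) a + (d ^^ l) b"
  by (induction l) (auto simp: derivation_def)

lemma derivation_zero: "derivation d \<Longrightarrow> (d ^^ l) 0 = 0"
  using derivation_add[of d l 0 0] by simp

lemma derivation_sum: "derivation d \<Longrightarrow> (d ^^ l) (sum h S) = (\<Sum>x\<in>S. (d ^^ l) (h x))"
  by (induction S rule: infinite_finite_induct) (auto simp: derivation_zero derivation_add)

lemma derivation_minus: "derivation d \<Longrightarrow> (d ^^ l) (- a) = - (d ^^ l) a"
  using derivation_add[of d l a "- a"] by (simp add: derivation_zero eq_neg_iff_add_eq_0 add.commute)

lemma derivation_one: "derivation d \<Longrightarrow> d 1 = 0"
proof -
  assume "derivation d"
  hence "d (1 * 1) = d 1 * 1 + 1 * d 1" unfolding derivation_def by blast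
  thus ?thesis by simp
qed

lemma derivation_of_int: "derivation d \<Longrightarrow> d (of_int z) = 0"
proof -
  assume d: "derivation d"
  have n: "d (of_nat n) = 0" for n
    using d by (induction n) (use d derivation_zero[of d 1] derivation_one[of d] in \<open>auto simp: derivation_def\<close>)
  show ?thesis
    by (cases z rule: int_cases2) (use n d derivation_minus[of d 1] in auto)
qed

lemma derivation_of_int_mult: "derivation d \<Longrightarrow> (d ^^ l) (of_int z * a) = of_int z * (d ^^ l) a"
proof (induction l)
  case (Suc l)
  have "d (of_int z * (d ^^ l) a) = d (of_int z) * (d ^^ l) a + of_int z * d ((d ^^ l) a)"
    using Suc.prems unfolding derivation_def by blast
  thus ?case using Suc by (simp add: derivation_of_int)
qed simp

lemma derivation_Leibniz:
  assumes "derivation d"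
  shows "(d ^^ u) (a * b) = (\<Sum>w\<le>u. of_int (int (u choose w)) * (d ^^ w) a * (d ^^ (u - w)) b)"
proof (induction u)
  case (Suc u)
  let ?D = "\<lambda>w. (d ^^ w) a" and ?E = "\<lambda>w. (d ^^ w) b"
  have dm: "d (x * y) = d x * y + x * d y" and da: "d (x + y) = d x + d y" for x y
    using assms unfolding derivation_def by blast+
  have ds: "d (sum h S) = (\<Sum>x\<in>S. d (h x))" for h :: "nat \<Rightarrow> _" and S
    using derivation_sum[OF assms, of 1 h S] by simp
  have "(d ^^ Suc u) (a * b) = d (\<Sum>w\<le>u. of_int (int (u choose w)) * (?D w * ?E (u - w)))"
    using Suc by (simp add: mult.assoc)
  also have "\<dots> = (\<Sum>w\<le>u. of_int (int (u choose w)) * (?D (Suc w) * ?E (u - w)))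
                 + (\<Sum>w\<le>u. of_int (int (u choose w)) * (?D w * ?E (Suc u - w)))"
    by (simp add: ds dm derivation_of_int[OF assms] distrib_left sum.distrib Suc_diff_le
        del: of_int_of_nat_eq)
  also have "(\<Sum>w\<le>u. of_int (int (u choose w)) * (?D w * ?E (Suc u - w)))
           = (\<Sum>w\<le>Suc u. of_int (int (u choose w)) * (?D w * ?E (Suc u - w)))"
    by (simp add: binomial_eq_0)
  also have "\<dots> = ?D 0 * ?E (Suc u)
           + (\<Sum>w\<le>u. of_int (int (u choose Suc w)) * (?D (Suc w) * ?E (u - w)))"
    by (subst sum.atMost_Suc_shift) simp
  also have "(\<Sum>w\<le>u. of_int (int (u choose w)) * (?D (Suc w) * ?E (u - w))) + \<dots> =
      ?D 0 * ?E (Suc u) + (\<Sum>w\<le>u. of_int (int (Suc u choose Suc w)) * (?D (Suc w) * ?E (u - w)))"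
    by (simp add: sum.distrib [symmetric] distrib_right algebra_simps)
  also have "\<dots> = (\<Sum>w\<le>Suc u. of_int (int (Suc u choose w)) * (?D w * ?E (Suc u - w)))"
    by (subst sum.atMost_Suc_shift) simp
  finally show ?case by (simp add: mult.assoc)
qed simp

lemma psd_times_box:
  fixes f g :: "int \<Rightarrow> 'a::ring_1"
  assumes d: "derivation d" and f: "\<forall>i>N. f i = 0" and g: "\<forall>j>N. g j = 0"
    and I: "finite I" "{n - N..N} \<subseteq> I" and T: "finite T" "{..nat (2 * N - n)} \<subseteq> T"
  shows "psd_times d f g n =
    (\<Sum>i\<in>I. \<Sum>l\<in>T. of_int (int_choose i l) * f i * (d ^^ l) (g (n - i + int l)))"
proof -
  have "psd_times d f g n =
      (\<Sum>(i, l)\<in>I \<times> T. of_int (int_choose i l) * f i * (d ^^ l) (g (n - i + int l)))"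
    unfolding psd_times_def
  proof (rule sum.reindex_bij_witness_not_neutral
      [where i = "\<lambda>(i, l). (i, n - i + int l, l)" and j = "\<lambda>(i, j, l). (i, l)"
        and S' = "{}" and T' = "{(i, l) \<in> I \<times> T. f i = 0 \<or> g (n - i + int l) = 0}"], goal_cases)
    case (4 a)
    then obtain i j l where a: "a = (i, j, l)" "f i \<noteq> 0" "g j \<noteq> 0" "i + j - int l = n" by auto
    hence "i \<le> N" "j \<le> N" using f g by force+
    hence "i \<in> {n - N..N}" "l \<in> {..nat (2 * N - n)}" using a by auto
    moreover have "n - i + int l = j" using a by simp
    ultimately show ?case using a I T by auto
  next
    case 2
    show ?case by (rule finite_subset[of _ "I \<times> T"]) (use I T in auto)
  qed (use I T derivation_zero[OF d] in auto)
  thus ?thesis by (simp add: sum.cartesian_product)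
qed

lemma psd_times_bound:
  fixes f g :: "int \<Rightarrow> 'a::ring_1"
  assumes "\<forall>i>M. f i = 0" "\<forall>j>N. g j = 0"
  shows "\<forall>n>M + N. psd_times d f g n = 0"
proof (intro allI impI)
  fix n assume n: "n > M + N"
  have "{(i, j, l::nat). f i \<noteq> 0 \<and> g j \<noteq> 0 \<and> i + j - int l = n} = {}"
  proof -
    have False if "f i \<noteq> 0" "g j \<noteq> 0" "i + j - int l = n" for i j and l :: nat
    proof -
      have "i \<le> M" "j \<le> N" using that assms by force+
      thus False using that n by linarith
    qed
    thus ?thesis by auto
  qed
  thus "psd_times d f g n = 0" unfolding psd_times_def by (simp only: sum.empty)
qed

lemma common_bound:
  assumes "\<exists>N. \<forall>i>N. f i = (0::'a::zero)" "\<exists>N. \<forall>i>N. g i = (0::'a)" "\<exists>N. \<forall>i>N. h i = (0::'a)"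
  obtains N :: int where "N \<ge> 0" "\<forall>i>N. f i = 0" "\<forall>i>N. g i = 0" "\<forall>i>N. h i = 0"
proof -
  obtain A B C where "\<forall>i>A. f i = 0" "\<forall>i>B. g i = 0" "\<forall>i>C. h i = 0" using assms by blast
  thus ?thesis by (intro that[of "max 0 (max A (max B C))"]) auto
qed

lemma psd_times_add_left:
  assumes d: "derivation d" and "\<exists>N. \<forall>i>N. f i = 0" "\<exists>N. \<forall>i>N. g i = 0" "\<exists>N. \<forall>i>N. h i = 0"
  shows "psd_times d (\<lambda>i. f i + g i) h n = psd_times d f h n + psd_times d g h n"
proof -
  obtain N where N: "\<forall>i>N. f i = 0" "\<forall>i>N. g i = 0" "\<forall>i>N. h i = 0"
    using common_bound[OF assms(2-4)] .
  have fg: "\<forall>i>N. f i + g i = 0" using N by simp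
  note box = psd_times_box[OF d _ N(3), of _ "{n - N..N}" n "{..nat (2 * N - n)}"]
  show ?thesis
    by (subst (1 2 3) box) (use N fg in \<open>auto simp: sum.distrib distrib_left distrib_right\<close>)
qed

lemma psd_times_add_right:
  assumes d: "derivation d" and "\<exists>N. \<forall>i>N. f i = 0" "\<exists>N. \<forall>i>N. g i = 0" "\<exists>N. \<forall>i>N. h i = 0"
  shows "psd_times d h (\<lambda>i. f i + g i) n = psd_times d h f n + psd_times d h g n"
proof -
  obtain N where N: "\<forall>i>N. f i = 0" "\<forall>i>N. g i = 0" "\<forall>i>N. h i = 0"
    using common_bound[OF assms(2-4)] .
  have fg: "\<forall>i>N. f i + g i = 0" using N by simp
  note box = psd_times_box[OF d N(3), of _ "{n - N..N}" n "{..nat (2 * N - n)}"]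
  show ?thesis
    by (subst (1 2 3) box) (use N fg in \<open>auto simp: sum.distrib distrib_left derivation_add[OF d]\<close>)
qed

lemma int_choose_trinomial:
  "int_choose i (w + t) * int ((w + t) choose w) = int_choose i w * int_choose (i - int w) t"
proof -
  have "(of_int i gchoose (w + t)) * (of_nat (w + t) gchoose w) =
        (of_int i gchoose w) * ((of_int i - of_nat w) gchoose (w + t - w) :: rat)"
    by (rule gbinomial_trinomial_revision) simp
  hence "(of_int (int_choose i (w + t) * int ((w + t) choose w)) :: rat) =
         of_int (int_choose i w * int_choose (i - int w) t)"
    by (simp add: of_int_int_choose binomial_gbinomial)
  thus ?thesis by (simp only: of_int_eq_iff)
qed

lemma int_choose_Vandermonde:
  "(\<Sum>t\<le>s. int_choose a t * int_choose b (s - t)) = int_choose (a + b) s"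
proof -
  have "(of_int (\<Sum>t\<le>s. int_choose a t * int_choose b (s - t)) :: rat) = of_int (int_choose (a + b) s)"
    using gbinomial_Vandermonde[of "of_int a :: rat" "of_int b" s]
    by (simp add: of_int_int_choose atLeast0AtMost)
  thus ?thesis by (simp only: of_int_eq_iff)
qed

lemma int_choose_convolution:
  "(\<Sum>t\<le>s. int_choose i (w + t) * int ((w + t) choose w) * int_choose j (s - t)) =
   int_choose (i + j - int w) s * int_choose i w"
proof -
  have "(\<Sum>t\<le>s. int_choose i (w + t) * int ((w + t) choose w) * int_choose j (s - t)) =
        (\<Sum>t\<le>s. int_choose i w * (int_choose (i - int w) t * int_choose j (s - t)))"
    by (intro sum.cong refl) (simp only: int_choose_trinomial mult.assoc)
  also have "\<dots> = int_choose i w * int_choose (i - int w + j) s"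
    by (simp only: sum_distrib_left[symmetric] int_choose_Vandermonde)
  finally show ?thesis by (simp add: algebra_simps)
qed

lemma sum_swap4:
  "(\<Sum>p\<in>A. \<Sum>s\<in>B. \<Sum>i\<in>C. \<Sum>w\<in>D. F p s i w) = (\<Sum>i\<in>C. \<Sum>w\<in>D. \<Sum>s\<in>B. \<Sum>p\<in>A. F p s i w)"
proof -
  have "(\<Sum>p\<in>A. \<Sum>s\<in>B. \<Sum>i\<in>C. \<Sum>w\<in>D. F p s i w) = (\<Sum>p\<in>A. \<Sum>i\<in>C. \<Sum>s\<in>B. \<Sum>w\<in>D. F p s i w)"
    by (rule sum.cong[OF refl], rule sum.swap)
  also have "\<dots> = (\<Sum>i\<in>C. \<Sum>p\<in>A. \<Sum>s\<in>B. \<Sum>w\<in>D. F p s i w)"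
    by (rule sum.swap)
  also have "\<dots> = (\<Sum>i\<in>C. \<Sum>p\<in>A. \<Sum>w\<in>D. \<Sum>s\<in>B. F p s i w)"
    by (rule sum.cong[OF refl], rule sum.cong[OF refl], rule sum.swap)
  also have "\<dots> = (\<Sum>i\<in>C. \<Sum>w\<in>D. \<Sum>p\<in>A. \<Sum>s\<in>B. F p s i w)"
    by (rule sum.cong[OF refl], rule sum.swap)
  also have "\<dots> = (\<Sum>i\<in>C. \<Sum>w\<in>D. \<Sum>s\<in>B. \<Sum>p\<in>A. F p s i w)"
    by (rule sum.cong[OF refl], rule sum.cong[OF refl], rule sum.swap)
  finally show ?thesis .
qed

lemma sum_swap4':
  "(\<Sum>i\<in>A. \<Sum>w\<in>B. \<Sum>s\<in>C. \<Sum>j\<in>D. F i w s j) = (\<Sum>i\<in>A. \<Sum>j\<in>D. \<Sum>w\<in>B. \<Sum>s\<in>C. F i w s j)"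
proof -
  have "(\<Sum>i\<in>A. \<Sum>w\<in>B. \<Sum>s\<in>C. \<Sum>j\<in>D. F i w s j) = (\<Sum>i\<in>A. \<Sum>w\<in>B. \<Sum>j\<in>D. \<Sum>s\<in>C. F i w s j)"
    by (rule sum.cong[OF refl], rule sum.cong[OF refl], rule sum.swap)
  also have "\<dots> = (\<Sum>i\<in>A. \<Sum>j\<in>D. \<Sum>w\<in>B. \<Sum>s\<in>C. F i w s j)"
    by (rule sum.cong[OF refl], rule sum.swap)
  finally show ?thesis .
qed

lemma sum_triple:
  assumes "finite A" "\<And>x. finite (B x)" "\<And>x y. finite (D x y)"
  shows "(\<Sum>x\<in>A. \<Sum>y\<in>B x. \<Sum>z\<in>D x y. F x y z) =
    (\<Sum>(x, y, z)\<in>(SIGMA x:A. SIGMA y:B x. D x y). F x y z)"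
  using assms by (simp add: sum.Sigma)

lemma psd_times_assoc:
  assumes d: "derivation d" and "\<exists>N. \<forall>i>N. f i = 0" "\<exists>N. \<forall>i>N. g i = 0" "\<exists>N. \<forall>i>N. h i = 0"
  shows "psd_times d (psd_times d f g) h n = psd_times d f (psd_times d g h) n"
proof -
  obtain N where N: "N \<ge> 0" "\<forall>i>N. f i = 0" "\<forall>i>N. g i = 0" "\<forall>i>N. h i = 0"
    using common_bound[OF assms(2-4)] .
  define K where "K = nat (4 * N - n)"
  define J where "J = {n - 3 * N..N}"
  define Q where "Q = {n - 2 * N..2 * N}"
  have N2: "\<forall>i>2*N. f i = 0" "\<forall>i>2*N. h i = 0" using N by auto
  have fg2: "\<forall>i>2*N. psd_times d f g i = 0" and gh2: "\<forall>i>2*N. psd_times d g h i = 0"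
    using psd_times_bound[OF N(2) N(3), of d] psd_times_bound[OF N(3) N(4), of d] by (simp_all only: mult_2)
  have fin: "finite J" "finite Q" "finite {..K}" by (auto simp: J_def Q_def)
  have D0: "(d ^^ l) 0 = 0" for l by (rule derivation_zero[OF d])
  define C where "C = (\<lambda>(i::int) (l::nat). of_int (int_choose i l) :: 'a)"
  define R where "R = (\<lambda>i j w s. f i * ((d ^^ w) (g j) * (d ^^ s) (h (n - i - j + int w + int s))))"
  have cen: "x * of_int z = of_int z * x" for x :: 'a and z
    by (rule mult_of_int_commute[symmetric])
  have Ccen: "x * (C i l * y) = C i l * (x * y)" for x y i l
    unfolding C_def by (metis cen mult.assoc)

  have inner: "psd_times d f g p = (\<Sum>i\<in>J. \<Sum>w\<le>K. C i w * f i * (d ^^ w) (g (p - i + int w)))"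
    if "p \<ge> n - 2 * N" for p
    unfolding C_def
    by (rule psd_times_box[OF d N(2,3)]) (use N that in \<open>auto simp: J_def K_def\<close>)
  have inner': "psd_times d g h p = (\<Sum>j\<in>J. \<Sum>v\<le>K. C j v * g j * (d ^^ v) (h (p - j + int v)))"
    if "p \<ge> n - 2 * N" for p
    unfolding C_def
    by (rule psd_times_box[OF d N(3,4)]) (use N that in \<open>auto simp: J_def K_def\<close>)

  have "psd_times d (psd_times d f g) h n =
      (\<Sum>p\<in>Q. \<Sum>s\<le>K. C p s * psd_times d f g p * (d ^^ s) (h (n - p + int s)))"
    unfolding C_def
    by (rule psd_times_box[OF d fg2 N2(2)]) (auto simp: Q_def K_def)
  also have "\<dots> = (\<Sum>p\<in>Q. \<Sum>s\<le>K. \<Sum>i\<in>J. \<Sum>w\<le>K.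
      C p s * (C i w * f i * (d ^^ w) (g (p - i + int w))) * (d ^^ s) (h (n - p + int s)))"
    by (intro sum.cong refl) (auto simp: inner Q_def sum_distrib_left sum_distrib_right)
  also have "\<dots> = (\<Sum>i\<in>J. \<Sum>w\<le>K. \<Sum>s\<le>K. \<Sum>p\<in>Q.
      C p s * (C i w * f i * (d ^^ w) (g (p - i + int w))) * (d ^^ s) (h (n - p + int s)))"
    by (rule sum_swap4)
  also have "\<dots> = (\<Sum>i\<in>J. \<Sum>w\<le>K. \<Sum>s\<le>K. \<Sum>j\<in>J. C (i + j - int w) s * (C i w * R i j w s))"
  proof (rule sum.cong[OF refl], rule sum.cong[OF refl], rule sum.cong[OF refl], goal_cases)
    case (1 i w s)
    have iN: "i \<le> N" using 1 by (simp add: J_def)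
    show ?case
    proof (rule sum.reindex_bij_witness_not_neutral
        [where i = "\<lambda>j. i + j - int w" and j = "\<lambda>p. p - i + int w"
          and S' = "{p \<in> Q. g (p - i + int w) = 0 \<or> h (n - p + int s) = 0}"
          and T' = "{j \<in> J. g j = 0 \<or> h (n - i - j + int w + int s) = 0}"], goal_cases)
      case (4 p)
      hence *: "g (p - i + int w) \<noteq> 0" "h (n - p + int s) \<noteq> 0" by auto
      hence "p - i + int w \<le> N" "n - p + int s \<le> N" using N by (meson not_le)+
      hence "p - i + int w \<in> J" using iN N(1) by (auto simp: J_def)
      moreover have "n - i - (p - i + int w) + int w + int s = n - p + int s" by simp
      ultimately show ?case using * by (auto simp del: of_nat_add)
    next
      case (6 j)
      hence *: "g j \<noteq> 0" "h (n - i - j + int w + int s) \<noteq> 0" by auto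
      hence "j \<le> N" "n - i - j + int w + int s \<le> N" using N by (meson not_le)+
      hence "i + j - int w \<in> Q" using iN N(1) by (auto simp: Q_def)
      moreover have "h (n - (i + j - int w) + int s) = h (n - i - j + int w + int s)"
        by (rule arg_cong[of _ _ h]) simp
      ultimately show ?case using * by auto
    qed (auto simp: fin R_def D0 mult.assoc algebra_simps)
  qed
  also have "\<dots> = (\<Sum>i\<in>J. \<Sum>j\<in>J. \<Sum>w\<le>K. \<Sum>s\<le>K. C (i + j - int w) s * (C i w * R i j w s))"
    by (rule sum_swap4')
  finally have L: "psd_times d (psd_times d f g) h n =
    (\<Sum>i\<in>J. \<Sum>j\<in>J. \<Sum>w\<le>K. \<Sum>s\<le>K. C (i + j - int w) s * (C i w * R i j w s))" .

  have fJ: "psd_times d f (psd_times d g h) n =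
      (\<Sum>i\<in>J. \<Sum>u\<le>K. C i u * f i * (d ^^ u) (psd_times d g h (n - i + int u)))"
  proof -
    have "psd_times d f (psd_times d g h) n =
      (\<Sum>i\<in>{n - 2*N..2*N}. \<Sum>u\<le>K. C i u * f i * (d ^^ u) (psd_times d g h (n - i + int u)))"
      unfolding C_def
      by (rule psd_times_box[OF d N2(1) gh2]) (auto simp: K_def)
    also have "\<dots> = (\<Sum>i\<in>J. \<Sum>u\<le>K. C i u * f i * (d ^^ u) (psd_times d g h (n - i + int u)))"
    proof (rule sum.mono_neutral_cong, goal_cases)
      case (3 i)
      hence "n - i > 2 * N" using N(1) by (auto simp: J_def)
      hence "psd_times d g h (n - i + int u) = 0" for u using gh2 by auto
      thus ?case by (simp add: D0)
    next
      case (4 i)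
      thus ?case using N by (auto simp: J_def)
    qed (auto simp: J_def)
    finally show ?thesis .
  qed
  have Dh: "(d ^^ u) (C j v * x) = C j v * (d ^^ u) x" for u j v x
    unfolding C_def by (rule derivation_of_int_mult[OF d])
  have "psd_times d f (psd_times d g h) n =
      (\<Sum>i\<in>J. \<Sum>u\<le>K. \<Sum>j\<in>J. \<Sum>v\<le>K. \<Sum>w\<le>u.
          C i u * of_int (int (u choose w)) * C j v * R i j w (u - w + v))"
    unfolding fJ
  proof (intro sum.cong refl, goal_cases)
    case (1 i u)
    have ge: "n - i + int u \<ge> n - 2 * N" using 1 N(1) by (auto simp: J_def)
    have CL: "(d ^^ u) (C j v * g j * x) =
      C j v * (\<Sum>w\<le>u. of_int (int (u choose w)) * (d ^^ w) (g j) * (d ^^ (u - w)) x)" for j v x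
      by (simp only: mult.assoc[of "C j v" "g j" x] Dh) (simp only: derivation_Leibniz[OF d])
    have "(d ^^ u) (psd_times d g h (n - i + int u)) =
      (\<Sum>j\<in>J. \<Sum>v\<le>K. C j v * (\<Sum>w\<le>u. of_int (int (u choose w)) * (d ^^ w) (g j) *
         (d ^^ (u - w)) ((d ^^ v) (h (n - i + int u - j + int v)))))"
      by (simp only: inner'[OF ge] derivation_sum[OF d] CL)
    also have "\<dots> = (\<Sum>j\<in>J. \<Sum>v\<le>K. \<Sum>w\<le>u. C j v * (of_int (int (u choose w)) * ((d ^^ w) (g j) *
         (d ^^ (u - w + v)) (h (n - i - j + int w + int (u - w + v))))))"
      unfolding sum_distrib_left
    proof (intro sum.cong refl, goal_cases)
      case (1 j v w)
      have "n - i + int u - j + int v = n - i - j + int w + int (u - w + v)"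
        using 1 by (simp add: of_nat_diff)
      thus ?case by (simp only: funpow_add o_apply mult.assoc)
    qed
    finally have E: "(d ^^ u) (psd_times d g h (n - i + int u)) = \<dots>" .
    have mv: "C i u * f i * (C j v * (of_int z * y)) = C i u * of_int z * C j v * (f i * y)"
      for j v z y
    proof -
      have "C i u * f i * (C j v * (of_int z * y)) = C i u * (C j v * (f i * (of_int z * y)))"
        by (metis Ccen mult.assoc)
      also have "f i * (of_int z * y) = of_int z * (f i * y)" by (metis cen mult.assoc)
      also have "C i u * (C j v * (of_int z * (f i * y))) = C i u * of_int z * C j v * (f i * y)"
        unfolding C_def by (metis cen mult.assoc)
      finally show ?thesis .
    qed
    show ?case unfolding E sum_distrib_left mv R_def ..
  qed
  also have "\<dots> = (\<Sum>i\<in>J. \<Sum>j\<in>J. \<Sum>u\<le>K. \<Sum>v\<le>K. \<Sum>w\<le>u.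
          C i u * of_int (int (u choose w)) * C j v * R i j w (u - w + v))"
    by (intro sum.cong refl sum.swap)
  also have "\<dots> = (\<Sum>i\<in>J. \<Sum>j\<in>J. \<Sum>w\<le>K. \<Sum>s\<le>K. C (i + j - int w) s * (C i w * R i j w s))"
  proof (rule sum.cong[OF refl], rule sum.cong[OF refl], goal_cases)
    case (1 i j)
    hence ij: "i \<le> N" "j \<le> N" by (auto simp: J_def)
    let ?c = "\<lambda>w s t. C i (w + t) * of_int (int ((w + t) choose w)) * C j (s - t)"
    have R0: "R i j w s = 0" if "w + s > K" for w s
    proof -
      have "n - i - j + int w + int s > N" using that ij N(1) by (auto simp: K_def)
      hence "h (n - i - j + int w + int s) = 0" using N by blast
      thus ?thesis by (simp add: R_def D0)
    qed
    have "(\<Sum>u\<le>K. \<Sum>v\<le>K. \<Sum>w\<le>u. C i u * of_int (int (u choose w)) * C j v * R i j w (u - w + v)) =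
      (\<Sum>(u, v, w)\<in>(SIGMA u:{..K}. SIGMA v:{..K}. {..u}).
          C i u * of_int (int (u choose w)) * C j v * R i j w (u - w + v))"
      by (rule sum_triple) auto
    also have "\<dots> = (\<Sum>(w, s, t)\<in>(SIGMA w:{..K}. SIGMA s:{..K}. {..s}). ?c w s t * R i j w s)"
    proof (rule sum.reindex_bij_witness_not_neutral
        [where j = "\<lambda>(u, v, w). (w, u - w + v, u - w)" and i = "\<lambda>(w, s, t). (w + t, s - t, w)"
          and S' = "{(u, v, w) \<in> (SIGMA u:{..K}. SIGMA v:{..K}. {..u}). u + v > K}"
          and T' = "{(w, s, t) \<in> (SIGMA w:{..K}. SIGMA s:{..K}. {..s}). w + s > K}"], goal_cases)
      case 1 show ?case by (rule finite_subset[of _ "SIGMA u:{..K}. SIGMA v:{..K}. {..u}"]) auto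
    next
      case 2 show ?case by (rule finite_subset[of _ "SIGMA w:{..K}. SIGMA s:{..K}. {..s}"]) auto
    qed (auto simp: R0)
    also have "\<dots> = (\<Sum>w\<le>K. \<Sum>s\<le>K. (\<Sum>t\<le>s. ?c w s t) * R i j w s)"
      unfolding sum_distrib_right by (rule sum_triple[symmetric]) auto
    also have "\<dots> = (\<Sum>w\<le>K. \<Sum>s\<le>K. C (i + j - int w) s * (C i w * R i j w s))"
    proof (intro sum.cong refl, goal_cases)
      case (1 w s)
      have "(\<Sum>t\<le>s. ?c w s t) = of_int (int_choose (i + j - int w) s * int_choose i w)"
        unfolding int_choose_convolution[symmetric] C_def by simp
      thus ?case by (simp add: C_def mult.assoc)
    qed
    finally show ?case .
  qed
  finally show ?thesis using L by simp
qed

lemma psd_times_one_left: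
  assumes d: "derivation d" and "\<exists>N. \<forall>i>N. f i = 0"
  shows "psd_times d (\<lambda>i. if i = 0 then 1 else 0) f n = f n"
proof -
  obtain N where N: "N \<ge> 0" "\<forall>i>N. f i = 0" using common_bound[OF assms(2) assms(2) assms(2)] .
  let ?I = "insert 0 {n - N..N}"
  have "psd_times d (\<lambda>i. if i = 0 then 1 else 0) f n =
    (\<Sum>i\<in>?I. \<Sum>l\<in>{..nat (2*N-n)}. of_int (int_choose i l) * (if i = 0 then 1 else 0) * (d ^^ l) (f (n - i + int l)))"
    by (rule psd_times_box[OF d _ N(2)]) (use N in auto)
  also have "\<dots> = (\<Sum>i\<in>?I. if i = 0 then f n else 0)"
  proof (intro sum.cong refl, goal_cases)
    case (1 i)
    show ?case
    proof (cases "i = 0")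
      case True
      have "(\<Sum>l\<in>{..nat (2*N-n)}. of_int (int_choose 0 l) * 1 * (d ^^ l) (f (n - 0 + int l))) =
        (\<Sum>l\<in>{..nat (2*N-n)}. if l = 0 then f n else 0)"
        by (intro sum.cong refl) (auto simp: int_choose_0_left)
      thus ?thesis using True by simp
    qed simp
  qed
  also have "\<dots> = f n" by (subst sum.delta) auto
  finally show ?thesis .
qed

lemma psd_times_one_right:
  assumes d: "derivation d" and "\<exists>N. \<forall>i>N. f i = 0"
  shows "psd_times d f (\<lambda>i. if i = 0 then 1 else 0) n = f n"
proof -
  obtain N where N: "N \<ge> 0" "\<forall>i>N. f i = 0" using common_bound[OF assms(2) assms(2) assms(2)] .
  let ?I = "insert n {n - N..N}"
  have d1: "(d ^^ l) 1 = (if l = 0 then 1 else 0)" for l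
    by (cases l) (auto simp: funpow_swap1 derivation_one[OF d] derivation_zero[OF d]
        funpow_Suc_right simp del: funpow.simps)
  have D: "(d ^^ l) (if m = 0 then 1 else 0) = (if l = 0 \<and> m = 0 then 1 else 0)" for l and m :: int
    by (simp add: d1 derivation_zero[OF d])
  have "psd_times d f (\<lambda>i. if i = 0 then 1 else 0) n =
    (\<Sum>i\<in>?I. \<Sum>l\<in>{..nat (2*N-n)}. of_int (int_choose i l) * f i * (d ^^ l) (if n - i + int l = 0 then 1 else 0))"
    by (rule psd_times_box[OF d N(2)]) (use N in auto)
  also have "\<dots> = (\<Sum>i\<in>?I. \<Sum>l\<in>{..nat (2*N-n)}. if l = 0 then (if i = n then f n else 0) else 0)"
    by (intro sum.cong refl) (auto simp: D)
  also have "\<dots> = f n" by (simp add: sum.delta)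
  finally show ?thesis .
qed

text \<open>
  In \<open>'k fls fls\<close> the outer series variable is \<open>x\<^sub>2\<close> and the inner one is \<open>x\<^sub>1\<close>. Hence
  \<open>\<partial>/\<partial>x\<^sub>2\<close> is \<^const>\<open>fls_deriv\<close>, and \<open>\<partial>/\<partial>x\<^sub>1\<close> is \<^const>\<open>fls_deriv\<close> applied to each coefficient.
\<close>

lift_definition deriv_x1 :: "'k::field fls fls \<Rightarrow> 'k fls fls" is "\<lambda>f n. fls_deriv (f n)"
  by (auto elim: MOST_mono)

abbreviation deriv_x2 :: "'k::field fls fls \<Rightarrow> 'k fls fls" where
  "deriv_x2 \<equiv> fls_deriv"

lemma deriv_x1_nth [simp]: "fls_nth (deriv_x1 f) n = fls_deriv (fls_nth f n)"
  by transfer simp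

lemma derivation_deriv_x2: "derivation (deriv_x2 :: 'k::field fls fls \<Rightarrow> _)"
  by (auto simp: derivation_def)

lemma fls_deriv_sum: "fls_deriv (sum f S) = (\<Sum>x\<in>S. fls_deriv (f x))"
  by (induction S rule: infinite_finite_induct) auto

lemma fls_nth_mult_box:
  fixes f g :: "'a::comm_ring_1 fls"
  assumes "\<forall>i<a. fls_nth f i = 0" "\<forall>i<b. fls_nth g i = 0"
  shows "fls_nth (f * g) n = (\<Sum>i=a..n-b. fls_nth f i * fls_nth g (n - i))"
proof (cases "f = 0 \<or> g = 0")
  case False
  have "a \<le> fls_subdegree f" "b \<le> fls_subdegree g"
    using assms False by (auto intro!: fls_subdegree_geI)
  moreover have "fls_nth f i * fls_nth g (n - i) = 0"
    if "i < fls_subdegree f \<or> n - i < fls_subdegree g" for i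
    using that by auto
  ultimately show ?thesis
    unfolding fls_times_nth(2)
    by (intro sum.mono_neutral_left) auto
qed auto

lemma derivation_deriv_x1: "derivation (deriv_x1 :: 'k::field fls fls \<Rightarrow> _)"
  unfolding derivation_def
proof (intro conjI allI)
  fix a b :: "'k fls fls"
  show "deriv_x1 (a + b) = deriv_x1 a + deriv_x1 b" by (intro fls_eqI) simp
  show "deriv_x1 (a * b) = deriv_x1 a * b + a * deriv_x1 b"
  proof (rule fls_eqI)
    fix n
    let ?p = "fls_subdegree a" and ?q = "fls_subdegree b"
    have 1: "fls_nth (a * b) n = (\<Sum>i=?p..n-?q. fls_nth a i * fls_nth b (n - i))"
      by (rule fls_nth_mult_box) auto
    have 2: "fls_nth (deriv_x1 a * b) n = (\<Sum>i=?p..n-?q. fls_nth (deriv_x1 a) i * fls_nth b (n - i))"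
      by (rule fls_nth_mult_box) auto
    have 3: "fls_nth (a * deriv_x1 b) n = (\<Sum>i=?p..n-?q. fls_nth a i * fls_nth (deriv_x1 b) (n - i))"
      by (rule fls_nth_mult_box) auto
    show "fls_nth (deriv_x1 (a * b)) n = fls_nth (deriv_x1 a * b + a * deriv_x1 b) n"
      by (simp only: deriv_x1_nth fls_plus_nth 1 2 3 fls_deriv_sum fls_deriv_mult sum.distrib add.commute)
  qed
qed

lemma deriv_x1_x2_commute: "deriv_x1 (deriv_x2 f) = deriv_x2 (deriv_x1 f)"
  by (intro fls_eqI) simp

text \<open>The ring \<open>k((x\<^sub>1))((x\<^sub>2))((\<partial>\<^sub>1\<^sup>-\<^sup>1))\<close>:\<close>

typedef (overloaded) 'k psd1 = "{f :: int \<Rightarrow> 'k::field fls fls. \<exists>N. \<forall>i>N. f i = 0}"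
  morphisms psd1_nth Abs_psd1
  by (rule exI[of _ "\<lambda>_. 0"]) simp

setup_lifting type_definition_psd1

instantiation psd1 :: (field) ring_1
begin

lift_definition zero_psd1 :: "'a psd1" is "\<lambda>_. 0" by simp

lift_definition one_psd1 :: "'a psd1" is "\<lambda>i. if i = 0 then 1 else 0"
  by (rule exI[of _ 0]) simp

lift_definition plus_psd1 :: "'a psd1 \<Rightarrow> 'a psd1 \<Rightarrow> 'a psd1" is "\<lambda>f g i. f i + g i"
  by (metis (no_types, lifting) add.right_neutral max_less_iff_conj)

lift_definition minus_psd1 :: "'a psd1 \<Rightarrow> 'a psd1 \<Rightarrow> 'a psd1" is "\<lambda>f g i. f i - g i"
  by (metis (no_types, lifting) diff_0_right max_less_iff_conj)

lift_definition uminus_psd1 :: "'a psd1 \<Rightarrow> 'a psd1" is "\<lambda>f i. - f i" by simp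

lift_definition times_psd1 :: "'a psd1 \<Rightarrow> 'a psd1 \<Rightarrow> 'a psd1" is "psd_times deriv_x1"
  using psd_times_bound by blast

instance
proof
  fix a b c :: "'a psd1"
  note d = derivation_deriv_x1
  show "a * b * c = a * (b * c)" by transfer (rule ext, rule psd_times_assoc[OF d])
  show "1 * a = a" by transfer (rule ext, rule psd_times_one_left[OF d])
  show "a * 1 = a" by transfer (rule ext, rule psd_times_one_right[OF d])
  show "(a + b) * c = a * c + b * c" by transfer (rule ext, rule psd_times_add_left[OF d])
  show "a * (b + c) = a * b + a * c" by transfer (rule ext, rule psd_times_add_right[OF d])
  show "(0::'a psd1) \<noteq> 1" by transfer (metis zero_neq_one)
qed (transfer; force)+

end

lift_definition deriv_x2_psd1 :: "'k::field psd1 \<Rightarrow> 'k psd1" is "\<lambda>f i. deriv_x2 (f i)"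
  by (metis fls_deriv_zero)

lemma funpow_deriv_x1_x2: "(deriv_x1 ^^ l) (deriv_x2 f) = deriv_x2 ((deriv_x1 ^^ l) f)"
  by (induction l) (simp_all add: deriv_x1_x2_commute)

lemma derivation_deriv_x2_psd1: "derivation deriv_x2_psd1"
  unfolding derivation_def
proof (intro conjI allI)
  fix a b :: "'a psd1"
  show "deriv_x2_psd1 (a + b) = deriv_x2_psd1 a + deriv_x2_psd1 b" by transfer simp
  show "deriv_x2_psd1 (a * b) = deriv_x2_psd1 a * b + a * deriv_x2_psd1 b"
  proof (transfer, rule ext)
    fix f g :: "int \<Rightarrow> 'a fls fls" and n
    assume "\<exists>N. \<forall>i>N. f i = 0" "\<exists>N. \<forall>i>N. g i = 0"
    from common_bound[OF this(1,2,2)] obtain N where N: "\<forall>i>N. f i = 0" "\<forall>i>N. g i = 0" .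
    have N': "\<forall>i>N. deriv_x2 (f i) = 0" "\<forall>i>N. deriv_x2 (g i) = 0" using N by auto
    note box = psd_times_box[OF derivation_deriv_x1, of N _ _ "{n - N..N}" n "{..nat (2 * N - n)}"]
    have z: "deriv_x2 (of_int z * y) = of_int z * deriv_x2 y" for z and y :: "'a fls fls"
      by simp
    show "deriv_x2 (psd_times deriv_x1 f g n) =
      psd_times deriv_x1 (\<lambda>i. deriv_x2 (f i)) g n + psd_times deriv_x1 f (\<lambda>i. deriv_x2 (g i)) n"
      by (subst (1 2 3) box)
        (use N N' in \<open>auto simp: fls_deriv_sum funpow_deriv_x1_x2 sum.distrib algebra_simps\<close>)
  qed
qed

text \<open>The ring \<open>P = k((x\<^sub>1))((x\<^sub>2))((\<partial>\<^sub>1\<^sup>-\<^sup>1))((\<partial>\<^sub>2\<^sup>-\<^sup>1))\<close>:\<close>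

typedef (overloaded) 'k psd2 = "{f :: int \<Rightarrow> 'k::field psd1. \<exists>N. \<forall>i>N. f i = 0}"
  morphisms psd2_nth Abs_psd2
  by (rule exI[of _ "\<lambda>_. 0"]) simp

setup_lifting type_definition_psd2

instantiation psd2 :: (field) ring_1
begin

lift_definition zero_psd2 :: "'a psd2" is "\<lambda>_. 0" by simp

lift_definition one_psd2 :: "'a psd2" is "\<lambda>i. if i = 0 then 1 else 0"
  by (rule exI[of _ 0]) simp

lift_definition plus_psd2 :: "'a psd2 \<Rightarrow> 'a psd2 \<Rightarrow> 'a psd2" is "\<lambda>f g i. f i + g i"
  by (metis (no_types, lifting) add.right_neutral max_less_iff_conj)

lift_definition minus_psd2 :: "'a psd2 \<Rightarrow> 'a psd2 \<Rightarrow> 'a psd2" is "\<lambda>f g i. f i - g i"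
  by (metis (no_types, lifting) diff_0_right max_less_iff_conj)

lift_definition uminus_psd2 :: "'a psd2 \<Rightarrow> 'a psd2" is "\<lambda>f i. - f i" by simp

lift_definition times_psd2 :: "'a psd2 \<Rightarrow> 'a psd2 \<Rightarrow> 'a psd2" is "psd_times deriv_x2_psd1"
  using psd_times_bound by blast

instance
proof
  fix a b c :: "'a psd2"
  note d = derivation_deriv_x2_psd1
  show "a * b * c = a * (b * c)" by transfer (rule ext, rule psd_times_assoc[OF d])
  show "1 * a = a" by transfer (rule ext, rule psd_times_one_left[OF d])
  show "a * 1 = a" by transfer (rule ext, rule psd_times_one_right[OF d])
  show "(a + b) * c = a * c + b * c" by transfer (rule ext, rule psd_times_add_left[OF d])
  show "a * (b + c) = a * b + a * c" by transfer (rule ext, rule psd_times_add_right[OF d])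
  show "(0::'a psd2) \<noteq> 1" by transfer (metis zero_neq_one)
qed (transfer; force)+

end

definition psd_coeff :: "'k::field psd2 \<Rightarrow> int \<times> int \<times> int \<times> int \<Rightarrow> 'k" where
  \<comment> \<open>the coefficient at \<open>x\<^sub>1\<^bsup>i\<^sub>1\<^esup> x\<^sub>2\<^bsup>i\<^sub>2\<^esup> \<partial>\<^sub>1\<^bsup>j\<^sub>1\<^esup> \<partial>\<^sub>2\<^bsup>j\<^sub>2\<^esup>\<close>\<close>
  "psd_coeff L = (\<lambda>(i1, i2, j1, j2). fls_nth (fls_nth (psd1_nth (psd2_nth L j2) j1) i2) i1)"

lift_definition scale_psd1 :: "'k::field \<Rightarrow> 'k psd1 \<Rightarrow> 'k psd1" is
  "\<lambda>c f i. fls_const (fls_const c) * f i"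
  by (metis mult_zero_right)

lift_definition scale_psd2 :: "'k::field \<Rightarrow> 'k psd2 \<Rightarrow> 'k psd2" is
  "\<lambda>c f i. scale_psd1 c (f i)"
proof -
  have "scale_psd1 c 0 = 0" for c :: 'k by transfer simp
  thus "\<exists>N. \<forall>i>N. f i = 0 \<Longrightarrow> \<exists>N. \<forall>i>N. scale_psd1 c (f i) = 0"
    for c and f :: "int \<Rightarrow> 'k psd1" by metis
qed

lift_definition plus_part :: "'k::field psd2 \<Rightarrow> 'k psd2" is "\<lambda>f i. if i \<ge> 0 then f i else 0"
  by metis

lift_definition minus_part :: "'k::field psd2 \<Rightarrow> 'k psd2" is "\<lambda>f i. if i < 0 then f i else 0"
  by metis

definition res :: "'k::field psd2 \<Rightarrow> 'k" where
  "res L = psd_coeff L (-1, -1, -1, -1)"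

definition commutator :: "'a::ring \<Rightarrow> 'a \<Rightarrow> 'a" where
  "commutator a b = a * b - b * a"

type_synonym 'k psd_pair = "'k psd2 \<times> 'k psd2"

definition pair_scale :: "'k::field \<Rightarrow> 'k psd_pair \<Rightarrow> 'k psd_pair" where
  "pair_scale c L = (scale_psd2 c (fst L), scale_psd2 c (snd L))"

definition pair_bracket :: "'k::field psd_pair \<Rightarrow> 'k psd_pair \<Rightarrow> 'k psd_pair" where
  "pair_bracket X Y = (commutator (fst X) (fst Y), commutator (snd X) (snd Y))"

definition pairing :: "'k::field psd_pair \<Rightarrow> 'k psd_pair \<Rightarrow> 'k" where
  "pairing L M = res (fst L * fst M) + res (snd L * snd M)"

definition R_op :: "'k::field psd_pair \<Rightarrow> 'k psd_pair" where
  "R_op X = (plus_part (fst X) - minus_part (fst X), plus_part (snd X) - minus_part (snd X))"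

definition R_bracket :: "'k::field psd_pair \<Rightarrow> 'k psd_pair \<Rightarrow> 'k psd_pair" where
  "R_bracket X Y =
    pair_scale (1 / 2) (pair_bracket (R_op X) Y) + pair_scale (1 / 2) (pair_bracket X (R_op Y))"

text \<open>
  A coordinate function on \<open>P\<^sup>2\<close> is a coefficient of \<open>L\<^sub>1\<close> (tag \<^const>\<open>False\<close>) or of \<open>L\<^sub>2\<close>
  (tag \<^const>\<open>True\<close>); a monomial is a multiset of coordinates.
\<close>

type_synonym coord = "bool \<times> int \<times> int \<times> int \<times> int"

definition coord_val :: "'k::field psd_pair \<Rightarrow> coord \<Rightarrow> 'k" where
  "coord_val L = (\<lambda>(b, e). psd_coeff (if b then snd L else fst L) e)"

definition monom_val :: "'k::field psd_pair \<Rightarrow> coord multiset \<Rightarrow> 'k" where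
  "monom_val L \<mu> = (\<Prod>e\<in>#\<mu>. coord_val L e)"

text \<open>
  Polynomial functions may involve infinitely many coefficients, as already the functional
  \<open>res (L\<^sub>1 * L\<^sub>2)\<close> does: they are formal polynomials of bounded degree in the coordinates, with
  possibly infinitely many monomials, of which only finitely many are nonzero at each point.
\<close>

definition polynomial_functions :: "('k::field psd_pair \<Rightarrow> 'k) set" where
  "polynomial_functions =
    {F. \<exists>c :: coord multiset \<Rightarrow> 'k.
          (\<exists>D. \<forall>\<mu>. c \<mu> \<noteq> 0 \<longrightarrow> size \<mu> \<le> D) \<and>
          (\<forall>L. finite {\<mu>. c \<mu> * monom_val L \<mu> \<noteq> 0}) \<and>
          (\<forall>L. F L = (\<Sum>\<mu> | c \<mu> * monom_val L \<mu> \<noteq> 0. c \<mu> * monom_val L \<mu>))}"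

text \<open>
  \<open>has_dir_deriv F L M D\<close>: \<open>\<epsilon> \<mapsto> F (L + \<epsilon>M)\<close> is a polynomial function of \<open>\<epsilon> \<in> k\<close> whose
  derivative at \<open>\<epsilon> = 0\<close> is \<open>D\<close>. In characteristic 0 the polynomial, hence \<open>D\<close>, is unique.
\<close>

definition has_dir_deriv ::
  "('k::field_char_0 psd_pair \<Rightarrow> 'k) \<Rightarrow> 'k psd_pair \<Rightarrow> 'k psd_pair \<Rightarrow> 'k \<Rightarrow> bool" where
  "has_dir_deriv F L M D \<longleftrightarrow>
    (\<exists>p. (\<forall>\<epsilon>. F (L + pair_scale \<epsilon> M) = poly p \<epsilon>) \<and> D = poly (pderiv p) 0)"

definition is_gradient ::
  "('k::field_char_0 psd_pair \<Rightarrow> 'k) \<Rightarrow> 'k psd_pair \<Rightarrow> 'k psd_pair \<Rightarrow> bool" where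
  "is_gradient F L G \<longleftrightarrow> (\<forall>M. has_dir_deriv F L M (pairing M G))"

text \<open>
  The pairing is nondegenerate and identifies the pointwise finite linear functionals on \<open>P\<^sup>2\<close>
  with \<open>P\<^sup>2\<close>, so a polynomial function has exactly one gradient at each point.
\<close>

definition gradient :: "('k::field_char_0 psd_pair \<Rightarrow> 'k) \<Rightarrow> 'k psd_pair \<Rightarrow> 'k psd_pair" where
  "gradient F L = (THE G. is_gradient F L G)"

definition poisson_R ::
  "('k::field_char_0 psd_pair \<Rightarrow> 'k) \<Rightarrow> ('k psd_pair \<Rightarrow> 'k) \<Rightarrow> 'k psd_pair \<Rightarrow> 'k" where
  "poisson_R F G L = pairing L (R_bracket (gradient F L) (gradient G L))"

text \<open>The system \<open>\<partial>F/\<partial>t = {F, H}\<^sub>R\<close> has the form \<open>\<partial>L/\<partial>t = X\<close> at the point \<open>L\<close>:\<close>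

definition system_has_form ::
  "('k::field_char_0 psd_pair \<Rightarrow> 'k) \<Rightarrow> 'k psd_pair \<Rightarrow> 'k psd_pair \<Rightarrow> bool" where
  "system_has_form H L X \<longleftrightarrow>
    (\<forall>F\<in>polynomial_functions. has_dir_deriv F L X (poisson_R F H L))"

definition commuting_pairs :: "'k::field psd_pair set" where
  "commuting_pairs = {L. commutator (fst L) (snd L) = 0}"

text \<open>
  \<open>X\<close> is tangent to \<^const>\<open>commuting_pairs\<close> at \<open>L\<close>: \<open>[L\<^sub>1 + \<epsilon>X\<^sub>1, L\<^sub>2 + \<epsilon>X\<^sub>2] = 0\<close> modulo \<open>\<epsilon>\<^sup>2\<close>,
  computed in \<open>P[[\<epsilon>]]\<close> with \<open>\<epsilon>\<close> central.
\<close>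

definition tangent_to_commuting :: "'k::field psd_pair \<Rightarrow> 'k psd_pair \<Rightarrow> bool" where
  "tangent_to_commuting L X \<longleftrightarrow>
    (\<forall>n<2. fps_nth (commutator (fps_const (fst L) + fps_X * fps_const (fst X))
                               (fps_const (snd L) + fps_X * fps_const (snd X))) n = 0)"

definition hamiltonian_ab :: "nat \<Rightarrow> nat \<Rightarrow> 'k::field psd_pair \<Rightarrow> 'k" where
  "hamiltonian_ab a b L = res (fst L ^ a * snd L ^ b)"

definition hamiltonian :: "nat \<Rightarrow> 'k::field psd_pair \<Rightarrow> 'k" where
  "hamiltonian m L = (1 / of_nat m) * (\<Sum>(a, b)\<in>{(a, b). a + b = m}. of_nat (m choose a) * hamiltonian_ab a b L)"

definition lax_field :: "nat \<Rightarrow> 'k::field psd_pair \<Rightarrow> 'k psd_pair" where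
  "lax_field m L =
    (commutator (plus_part ((fst L + snd L) ^ (m - 1))) (fst L),
     commutator (plus_part ((fst L + snd L) ^ (m - 1))) (snd L))"

end

theory Submission
  imports Defs
begin

text \<open>
  The algebra behind the statement is short. The residue is a trace, so
  \<open>res (A [B, C]) = res (B [C, A])\<close>. At a commuting pair \<open>L = (L\<^sub>1, L\<^sub>2)\<close> the derivative of
  \<open>res (L\<^sub>1\<^sup>a L\<^sub>2\<^sup>b)\<close> can therefore be brought into the form
  \<open>res (M\<^sub>1 a L\<^sub>1\<^bsup>a-1\<^esup> L\<^sub>2\<^sup>b) + res (M\<^sub>2 b L\<^sub>1\<^sup>a L\<^sub>2\<^bsup>b-1\<^esup>)\<close>, and the binomial weights add these up to the gradient
  \<open>(Q, Q)\<close> of \<open>H\<^sub>m\<close>, where \<open>Q = (L\<^sub>1 + L\<^sub>2)\<^bsup>m-1\<^esup>\<close>. Since \<open>Q\<close> commutes with both \<open>L\<^sub>i\<close> and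
  \<open>Q\<^sub>+ - Q\<^sub>- = 2 Q\<^sub>+ - Q\<close>, invariance of the form turns \<open>{F, H\<^sub>m}\<^sub>R\<close> into the pairing of
  \<open>([Q\<^sub>+, L\<^sub>1], [Q\<^sub>+, L\<^sub>2])\<close> with the gradient of \<open>F\<close>, which is the asserted form of the system. Tangency is
  the Jacobi identity. The derivative of \<open>H\<^sub>m'\<close> along the flow is a sum of terms
  \<open>res ([Q\<^sub>+, L\<^sub>i] Q') = res (Q\<^sub>+ [L\<^sub>i, Q'])\<close>, and these vanish because \<open>Q'\<close> is a power of
  \<open>L\<^sub>1 + L\<^sub>2\<close>.

  What needs care is that every polynomial function \<open>F\<close> has a gradient, although it may depend on infinitely many
  coefficients, and that \<open>H\<^sub>m\<close> is such a function. Elements of \<open>P\<close> are the same as functions on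
  \<open>\<int>\<^sup>4\<close> with \<^emph>\<open>admissible\<close> support: four nested one-sided bounds, one for each variable. Admissible
  sets behave like the well-ordered supports of Hahn series: sums of two of them are admissible, with finite fibres.

  For gradients (\<open>polynomial_function_has_gradient\<close>): evaluating \<open>F\<close> at the indicator of an admissible set
  \<open>T\<close> shows that only finitely many monomials of \<open>F\<close> live on \<open>T\<close>. So on elements supported in \<open>T\<close> the
  function \<open>F\<close> is an ordinary polynomial, its derivative exists, and the derivative is a linear functional
  that sees finitely many coefficients of an element supported in \<open>T\<close>. Such a functional is
  \<open>M \<mapsto> res (M G)\<close> for some \<open>G\<close> (\<open>linear_functional_representable\<close>): a set that meets every
  admissible set in a finite set is the reflection of an admissible set, so the values on monomials are
  coefficients of an element of \<open>P\<close>; and if \<open>G\<close> is written with its coefficients on the right of the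
  powers of \<open>\<partial>\<^sub>1, \<partial>\<^sub>2\<close>, then \<open>res (M G)\<close> is the plain sum of products of complementary coefficients.

  For \<open>H\<^sub>m\<close> (\<open>word_coeff_polynomial\<close>): the support of a product lies in the sum of the supports, moved by
  the exponents that differentiation produces, which again form an admissible set. By finiteness of fibres each
  coefficient of a product is a finite sum over lists of exponents, one from each factor.
\<close>

section \<open>Admissible supports\<close>

text \<open>
  The closure properties of supports that are bounded on one side. The last one is a converse to finiteness of
  intersections: since sums have finite fibres, a set and the reflection of another one meet in a finite set, and
  \<open>dual\<close> says that nothing but reflections has this property. It is what makes the pairing perfect.
\<close>

locale summable_supports =
  fixes Q :: "'x::ab_group_add set \<Rightarrow> bool"
  assumes subset: "Q S \<Longrightarrow> S' \<subseteq> S \<Longrightarrow> Q S'"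
    and union: "Q S \<Longrightarrow> Q S' \<Longrightarrow> Q (S \<union> S')"
    and singleton: "Q {x}"
    and finite_sums: "Q S \<Longrightarrow> Q S' \<Longrightarrow> finite {(a, b). a \<in> S \<and> b \<in> S' \<and> a + b = z}"
    and sums: "Q S \<Longrightarrow> Q S' \<Longrightarrow> Q {a + b |a b. a \<in> S \<and> b \<in> S'}"
    and dual: "(\<And>S. Q S \<Longrightarrow> finite (W \<inter> S)) \<Longrightarrow> Q {x. - x \<in> W}"
begin

lemma Q_empty: "Q {}"
  using singleton subset by blast

lemma Q_UN: "finite I \<Longrightarrow> (\<And>i. i \<in> I \<Longrightarrow> Q (S i)) \<Longrightarrow> Q (\<Union>i\<in>I. S i)"
  by (induction I rule: finite_induct) (auto simp: Q_empty intro: union)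

end

text \<open>
  One step from \<open>A\<close> to \<open>A((y))\<close> on the level of supports: the exponents of the new variable are bounded below,
  and the support of each coefficient satisfies \<open>Q\<close>, without any uniformity in \<open>n\<close>.
\<close>

definition lex_ext :: "('x set \<Rightarrow> bool) \<Rightarrow> (int \<times> 'x) set \<Rightarrow> bool" where
  "lex_ext Q S \<longleftrightarrow> bdd_below (fst ` S) \<and> (\<forall>n. Q {x. (n, x) \<in> S})"

lemma bdd_below_int_dual:
  fixes W :: "int set"
  assumes "\<And>S. bdd_below S \<Longrightarrow> finite (W \<inter> S)"
  shows "bdd_below {x. - x \<in> W}"
proof -
  have "finite (W \<inter> {0..})" by (rule assms) (auto simp: bdd_below_def)
  then obtain N where N: "\<forall>w\<in>W \<inter> {0..}. w \<le> N"
    by (meson bdd_above_finite bdd_above.E)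
  show ?thesis unfolding bdd_below_def
  proof (intro exI[of _ "- (max N 0)"] ballI)
    fix n assume "n \<in> {x. - x \<in> W}"
    thus "- (max N 0) \<le> n" using N by (cases "- n \<ge> 0") force+
  qed
qed

lemma summable_supports_bdd_below: "summable_supports (bdd_below :: int set \<Rightarrow> bool)"
proof
  fix S S' :: "int set" and z :: int
  assume S: "bdd_below S" "bdd_below S'"
  then obtain N N' where N: "\<forall>n\<in>S. N \<le> n" "\<forall>n\<in>S'. N' \<le> n" unfolding bdd_below_def by blast
  have "{(a, b). a \<in> S \<and> b \<in> S' \<and> a + b = z} \<subseteq> {N..z - N'} \<times> {N'..z - N}"
    using N by force
  thus "finite {(a, b). a \<in> S \<and> b \<in> S' \<and> a + b = z}"
    by (rule finite_subset) simp
  show "bdd_below {a + b |a b. a \<in> S \<and> b \<in> S'}"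
    unfolding bdd_below_def by (rule exI[of _ "N + N'"]) (use N in \<open>force intro: add_mono\<close>)
  show "bdd_below (S \<union> S')"
    unfolding bdd_below_def by (rule exI[of _ "min N N'"]) (use N in force)
next
  show "bdd_below {x. - x \<in> W}" if "\<And>S. bdd_below S \<Longrightarrow> finite (W \<inter> S)" for W :: "int set"
    using that by (rule bdd_below_int_dual)
qed (auto simp: bdd_below_def)

text \<open>
  A given first component is a sum of first components in finitely many ways, so sums reduce to finite unions of sums
  at the level of \<open>Q\<close>. For \<open>dual\<close>, choosing one point over each first component gives an
  \<open>S\<close> that satisfies \<open>lex_ext Q\<close> however its points are distributed, so the set of first components of
  \<open>W\<close> inherits the property; the slices of \<open>W\<close> are tested with \<open>S\<close> inside a single slice.
\<close>

lemma summable_supports_lex_ext: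
  assumes "summable_supports Q"
  shows "summable_supports (lex_ext Q)"
proof -
  interpret Q: summable_supports Q by fact
  interpret Z: summable_supports "bdd_below :: int set \<Rightarrow> bool" by (rule summable_supports_bdd_below)
  show ?thesis
  proof
    fix S S' :: "(int \<times> 'a) set"
    assume S: "lex_ext Q S" "S' \<subseteq> S"
    show "lex_ext Q S'" unfolding lex_ext_def
    proof
      have "bdd_below (fst ` S)" "fst ` S' \<subseteq> fst ` S" using S by (simp_all add: lex_ext_def image_mono)
      thus "bdd_below (fst ` S')" by (rule Z.subset)
      show "\<forall>n. Q {x. (n, x) \<in> S'}"
      proof
        fix n
        have "Q {x. (n, x) \<in> S}" "{x. (n, x) \<in> S'} \<subseteq> {x. (n, x) \<in> S}"
          using S unfolding lex_ext_def by blast+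
        thus "Q {x. (n, x) \<in> S'}" by (rule Q.subset)
      qed
    qed
  next
    fix S S' :: "(int \<times> 'a) set"
    assume S: "lex_ext Q S" "lex_ext Q S'"
    have "{x. (n, x) \<in> S \<union> S'} = {x. (n, x) \<in> S} \<union> {x. (n, x) \<in> S'}" for n by auto
    thus "lex_ext Q (S \<union> S')" using S Q.union Z.union unfolding lex_ext_def by (simp add: image_Un)
  next
    fix p :: "int \<times> 'a"
    have "{x. (n, x) \<in> {p}} = (if n = fst p then {snd p} else {})" for n by (cases p) auto
    thus "lex_ext Q {p}" unfolding lex_ext_def by (auto simp: Q.singleton Q.Q_empty Z.singleton)
  next
    fix S S' :: "(int \<times> 'a) set" and z
    assume S: "lex_ext Q S" "lex_ext Q S'"
    let ?S = "\<lambda>n. {x. (n, x) \<in> S}" and ?S' = "\<lambda>n. {x. (n, x) \<in> S'}"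
    have QS: "Q (?S n)" "Q (?S' n)" and bS: "bdd_below (fst ` S)" "bdd_below (fst ` S')" for n
      using S by (simp_all add: lex_ext_def)
    have I: "finite {(i, j). i \<in> fst ` S \<and> j \<in> fst ` S' \<and> i + j = n}" for n
      by (rule Z.finite_sums[OF bS])
    have "{(a, b). a \<in> S \<and> b \<in> S' \<and> a + b = z} \<subseteq>
      (\<Union>(i, j)\<in>{(i, j). i \<in> fst ` S \<and> j \<in> fst ` S' \<and> i + j = fst z}.
        (\<lambda>(x, y). ((i, x), (j, y))) ` {(x, y). x \<in> ?S i \<and> y \<in> ?S' j \<and> x + y = snd z})"
    proof
      fix p assume "p \<in> {(a, b). a \<in> S \<and> b \<in> S' \<and> a + b = z}"
      moreover obtain i x j y where p: "p = ((i, x), (j, y))" by (metis surj_pair)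
      ultimately have "(i, x) \<in> S" "(j, y) \<in> S'" and z: "z = (i + j, x + y)" by auto
      thus "p \<in> (\<Union>(i, j)\<in>{(i, j). i \<in> fst ` S \<and> j \<in> fst ` S' \<and> i + j = fst z}.
        (\<lambda>(x, y). ((i, x), (j, y))) ` {(x, y). x \<in> ?S i \<and> y \<in> ?S' j \<and> x + y = snd z})"
        unfolding p z by (intro UN_I[of "(i, j)"]) (auto simp: rev_image_eqI)
    qed
    moreover have "finite \<dots>"
      using Q.finite_sums[OF QS] by (intro finite_UN_I I) (auto split: prod.splits)
    ultimately show "finite {(a, b). a \<in> S \<and> b \<in> S' \<and> a + b = z}" by (rule finite_subset)
    let ?P = "{a + b |a b. a \<in> S \<and> b \<in> S'}"
    show "lex_ext Q ?P" unfolding lex_ext_def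
    proof (intro conjI allI)
      have "fst ` ?P \<subseteq> {a + b |a b. a \<in> fst ` S \<and> b \<in> fst ` S'}"
      proof
        fix n assume "n \<in> fst ` ?P"
        then obtain a b where "n = fst a + fst b" "a \<in> S" "b \<in> S'" by auto
        thus "n \<in> {a + b |a b. a \<in> fst ` S \<and> b \<in> fst ` S'}" by blast
      qed
      thus "bdd_below (fst ` ?P)" by (rule Z.subset[OF Z.sums[OF bS]])
      fix n
      have "{x. (n, x) \<in> ?P} \<subseteq> (\<Union>(i, j)\<in>{(i, j). i \<in> fst ` S \<and> j \<in> fst ` S' \<and> i + j = n}.
          {x + y |x y. x \<in> ?S i \<and> y \<in> ?S' j})"
      proof
        fix x assume "x \<in> {x. (n, x) \<in> ?P}"
        then obtain i y j y' where "(n, x) = (i, y) + (j, y')" "(i, y) \<in> S" "(j, y') \<in> S'" by auto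
        thus "x \<in> (\<Union>(i, j)\<in>{(i, j). i \<in> fst ` S \<and> j \<in> fst ` S' \<and> i + j = n}.
          {x + y |x y. x \<in> ?S i \<and> y \<in> ?S' j})"
          by (intro UN_I[of "(i, j)"]) (auto simp: rev_image_eqI)
      qed
      moreover have "Q \<dots>"
        using Q.sums[OF QS] by (intro Q.Q_UN I) (auto split: prod.splits)
      ultimately show "Q {x. (n, x) \<in> ?P}" by (rule Q.subset[rotated])
    qed
  next
    fix W :: "(int \<times> 'a) set"
    assume W: "\<And>S. lex_ext Q S \<Longrightarrow> finite (W \<inter> S)"
    show "lex_ext Q {x. - x \<in> W}" unfolding lex_ext_def
    proof (intro conjI allI)
      have "finite (fst ` W \<inter> I)" if I: "bdd_below I" for I
      proof -
        define S where "S = {(n, x). n \<in> I \<and> n \<in> fst ` W \<and> x = (SOME x. (n, x) \<in> W)}"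
        have "{x. (n, x) \<in> S} \<subseteq> {SOME x. (n, x) \<in> W}" for n by (auto simp: S_def)
        hence "Q {x. (n, x) \<in> S}" for n by (rule Q.subset[OF Q.singleton])
        moreover have "fst ` S \<subseteq> I" by (auto simp: S_def)
        hence "bdd_below (fst ` S)" by (rule Z.subset[OF I])
        ultimately have "lex_ext Q S" by (simp add: lex_ext_def)
        hence "finite (fst ` (W \<inter> S))" using W by blast
        moreover have "fst ` W \<inter> I \<subseteq> fst ` (W \<inter> S)"
        proof
          fix n assume n: "n \<in> fst ` W \<inter> I"
          then obtain x where "(n, x) \<in> W" by auto
          hence "(n, SOME x. (n, x) \<in> W) \<in> W" by (rule someI)
          thus "n \<in> fst ` (W \<inter> S)" using n by (force simp: S_def)
        qed
        ultimately show ?thesis by (rule rev_finite_subset)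
      qed
      from Z.dual[OF this] have "bdd_below {n. - n \<in> fst ` W}" .
      moreover have "fst ` {x. - x \<in> W} \<subseteq> {n. - n \<in> fst ` W}" by force
      ultimately show "bdd_below (fst ` {x. - x \<in> W})" by (rule Z.subset)
      fix n
      have "finite ({x. (- n, x) \<in> W} \<inter> S)" if S: "Q S" for S
      proof -
        have "{x. (i, x) \<in> {- n} \<times> S} = (if i = - n then S else {})" for i by auto
        moreover have "fst ` ({- n} \<times> S) \<subseteq> {- n}" by auto
        hence "bdd_below (fst ` ({- n} \<times> S))" by (rule Z.subset[OF Z.singleton])
        ultimately have "lex_ext Q ({- n} \<times> S)"
          using S Q.Q_empty by (simp add: lex_ext_def)
        hence "finite (snd ` (W \<inter> ({- n} \<times> S)))" using W by blast
        thus ?thesis by (rule rev_finite_subset) force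
      qed
      from Q.dual[OF this] show "Q {x. (n, x) \<in> {x. - x \<in> W}}" by simp
    qed
  qed
qed

type_synonym exponent = "int \<times> int \<times> int \<times> int"

text \<open>
  The outermost variable \<open>\<partial>\<^sub>2\<close> comes first, and the signs turn the upper bounds for the exponents of
  \<open>\<partial>\<^sub>1, \<partial>\<^sub>2\<close> into lower ones.
\<close>

definition admissible :: "exponent set \<Rightarrow> bool" where
  "admissible S \<longleftrightarrow> lex_ext (lex_ext (lex_ext bdd_below)) {(a, b, c, d). (d, c, - b, - a) \<in> S}"

lemma summable_supports_admissible: "summable_supports admissible"
proof -
  let ?Q = "lex_ext (lex_ext (lex_ext bdd_below)) :: exponent set \<Rightarrow> bool"
  interpret Q: summable_supports ?Q
    by (intro summable_supports_lex_ext summable_supports_bdd_below)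
  define r :: "exponent \<Rightarrow> exponent" where "r = (\<lambda>(a, b, c, d). (d, c, - b, - a))"
  define r' :: "exponent \<Rightarrow> exponent" where "r' = (\<lambda>(i1, i2, j1, j2). (- j2, - j1, i2, i1))"
  have adm: "admissible S \<longleftrightarrow> ?Q {p. r p \<in> S}" for S
    unfolding admissible_def by (simp add: r_def case_prod_unfold)
  have r: "r (r' x) = x" "r' (r x) = x" "r (x + y) = r x + r y" "r' (x + y) = r' x + r' y" "r (- x) = - r x" for x y
    by (auto simp: r_def r'_def split: prod.splits)
  have bij: "bij r" "bij r'" using r by (metis bij_betw_byWitness subset_UNIV)+
  show ?thesis
  proof
    fix S S' assume S: "admissible S" "S' \<subseteq> S"
    show "admissible S'" unfolding adm
      by (rule Q.subset[OF S(1)[unfolded adm]]) (use S(2) in auto)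
  next
    fix S S' assume S: "admissible S" "admissible S'"
    show "admissible (S \<union> S')"
      unfolding adm by (rule Q.subset[OF Q.union[OF S[unfolded adm]]]) auto
    fix z
    have "{(a, b). a \<in> S \<and> b \<in> S' \<and> a + b = z} \<subseteq>
       map_prod r r ` {(a, b). a \<in> {p. r p \<in> S} \<and> b \<in> {p. r p \<in> S'} \<and> a + b = r' z}"
    proof clarify
      fix a b :: exponent assume "a \<in> S" "b \<in> S'" "z = a + b"
      hence "(r' a, r' b) \<in> {(x, y). x \<in> {p. r p \<in> S} \<and> y \<in> {p. r p \<in> S'} \<and> x + y = r' (a + b)}"
        by (simp add: r)
      moreover have "(a, b) = map_prod r r (r' a, r' b)" by (simp add: r)
      ultimately show "(a, b) \<in> map_prod r r ` {(aa, ba). aa \<in> {p. r p \<in> S} \<and> ba \<in> {p. r p \<in> S'} \<and> aa + ba = r' (a + b)}"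
        by blast
    qed
    thus "finite {(a, b). a \<in> S \<and> b \<in> S' \<and> a + b = z}"
      by (rule finite_subset) (intro finite_imageI Q.finite_sums S[unfolded adm])
    have "{p. r p \<in> {a + b |a b. a \<in> S \<and> b \<in> S'}} \<subseteq>
        {a + b |a b. a \<in> {p. r p \<in> S} \<and> b \<in> {p. r p \<in> S'}}"
    proof clarify
      fix p a b assume "r p = a + b" "a \<in> S" "b \<in> S'"
      hence "p = r' a + r' b" "r (r' a) \<in> S" "r (r' b) \<in> S'" using r by metis+
      thus "\<exists>a b. p = a + b \<and> a \<in> {p. r p \<in> S} \<and> b \<in> {p. r p \<in> S'}" by blast
    qed
    thus "admissible {a + b |a b. a \<in> S \<and> b \<in> S'}"
      unfolding adm by (rule Q.subset[OF Q.sums[OF S[unfolded adm]]])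
  next
    fix x
    have "{p. r p \<in> {x}} \<subseteq> {r' x}" using r by auto
    thus "admissible {x}" unfolding adm by (rule Q.subset[OF Q.singleton])
  next
    fix W assume W: "\<And>S. admissible S \<Longrightarrow> finite (W \<inter> S)"
    have "finite ({p. r p \<in> W} \<inter> S)" if "?Q S" for S
    proof -
      have "{p. r p \<in> {q. r' q \<in> S}} = S" by (simp add: r)
      hence "finite (r' ` (W \<inter> {q. r' q \<in> S}))" using that W unfolding adm by simp
      moreover have "{p. r p \<in> W} \<inter> S \<subseteq> r' ` (W \<inter> {q. r' q \<in> S})"
      proof
        fix p assume "p \<in> {p. r p \<in> W} \<inter> S"
        hence "r p \<in> W \<inter> {q. r' q \<in> S}" "p = r' (r p)" by (auto simp: r)
        thus "p \<in> r' ` (W \<inter> {q. r' q \<in> S})" by blast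
      qed
      ultimately show ?thesis by (rule rev_finite_subset)
    qed
    from Q.dual[OF this] show "admissible {x. - x \<in> W}" unfolding adm by (simp add: r)
  qed
qed

interpretation adm: summable_supports admissible
  by (rule summable_supports_admissible)

text \<open>
  The nested bounds in the order in which they appear in the construction of \<open>P\<close>.
\<close>

lemma admissible_iff:
  "admissible S \<longleftrightarrow>
    (\<exists>N. \<forall>(i1, i2, j1, j2)\<in>S. j2 \<le> N) \<and>
    (\<forall>j2. \<exists>N. \<forall>i1 i2 j1. (i1, i2, j1, j2) \<in> S \<longrightarrow> j1 \<le> N) \<and>
    (\<forall>j2 j1. \<exists>N. \<forall>i1 i2. (i1, i2, j1, j2) \<in> S \<longrightarrow> N \<le> i2) \<and>
    (\<forall>j2 j1 i2. \<exists>N. \<forall>i1. (i1, i2, j1, j2) \<in> S \<longrightarrow> N \<le> i1)"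
proof -
  have 1: "bdd_below (fst ` {(a, b, c, d). (d, c, - b, - a) \<in> S}) \<longleftrightarrow> (\<exists>N. \<forall>(i1, i2, j1, j2)\<in>S. j2 \<le> N)"
    (is "_ = ?R")
  proof -
    have "bdd_below (fst ` {(a, b, c, d). (d, c, - b, - a) \<in> S}) \<longleftrightarrow>
       (\<exists>N. \<forall>a b c d. (d, c, - b, - a) \<in> S \<longrightarrow> N \<le> a)"
      unfolding bdd_below_def by force
    also have "\<dots> \<longleftrightarrow> ?R"
    proof safe
      fix N assume "\<forall>a b c d. (d, c, - b, - a) \<in> S \<longrightarrow> N \<le> a"
      hence "j2 \<le> - N" if "(i1, i2, j1, j2) \<in> S" for i1 i2 j1 j2
        using that by (metis minus_minus neg_le_iff_le)
      thus ?R by blast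
    next
      fix N assume "\<forall>(i1, i2, j1, j2)\<in>S. j2 \<le> N"
      hence "\<forall>a b c d. (d, c, - b, - a) \<in> S \<longrightarrow> - N \<le> a" by force
      thus "\<exists>N. \<forall>a b c d. (d, c, - b, - a) \<in> S \<longrightarrow> N \<le> a" by blast
    qed
    finally show ?thesis .
  qed
  have 2: "(\<forall>a. bdd_below (fst ` {(b, c, d). (d, c, - b, - a) \<in> S})) \<longleftrightarrow>
    (\<forall>j2. \<exists>N. \<forall>i1 i2 j1. (i1, i2, j1, j2) \<in> S \<longrightarrow> j1 \<le> N)"
  proof -
    have "bdd_below (fst ` {(b, c, d). (d, c, - b, - a) \<in> S}) \<longleftrightarrow>
       (\<exists>N. \<forall>i1 i2 j1. (i1, i2, j1, - a) \<in> S \<longrightarrow> j1 \<le> N)" (is "?L \<longleftrightarrow> ?R") for a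
    proof -
      have "?L \<longleftrightarrow> (\<exists>N. \<forall>b c d. (d, c, - b, - a) \<in> S \<longrightarrow> N \<le> b)"
        unfolding bdd_below_def by force
      also have "\<dots> \<longleftrightarrow> ?R"
      proof safe
        fix N assume *: "\<forall>b c d. (d, c, - b, - a) \<in> S \<longrightarrow> N \<le> b"
        have "j1 \<le> - N" if "(i1, i2, j1, - a) \<in> S" for i1 i2 j1
          using that *[rule_format, of i1 i2 "- j1"] by simp
        thus ?R by blast
      next
        fix N assume "\<forall>i1 i2 j1. (i1, i2, j1, - a) \<in> S \<longrightarrow> j1 \<le> N"
        hence "\<forall>b c d. (d, c, - b, - a) \<in> S \<longrightarrow> - N \<le> b" by force
        thus "\<exists>N. \<forall>b c d. (d, c, - b, - a) \<in> S \<longrightarrow> N \<le> b" by blast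
      qed
      finally show ?thesis .
    qed
    hence "(\<forall>a. bdd_below (fst ` {(b, c, d). (d, c, - b, - a) \<in> S})) \<longleftrightarrow>
      (\<forall>a. \<exists>N. \<forall>i1 i2 j1. (i1, i2, j1, - a) \<in> S \<longrightarrow> j1 \<le> N)" by simp
    also have "\<dots> \<longleftrightarrow> (\<forall>j2. \<exists>N. \<forall>i1 i2 j1. (i1, i2, j1, j2) \<in> S \<longrightarrow> j1 \<le> N)"
      by (metis minus_minus)
    finally show ?thesis .
  qed
  have 3: "(\<forall>a b. bdd_below (fst ` {(c, d). (d, c, - b, - a) \<in> S})) \<longleftrightarrow>
    (\<forall>j2 j1. \<exists>N. \<forall>i1 i2. (i1, i2, j1, j2) \<in> S \<longrightarrow> N \<le> i2)"
  proof -
    have "bdd_below (fst ` {(c, d). (d, c, - b, - a) \<in> S}) \<longleftrightarrow>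
       (\<exists>N. \<forall>i1 i2. (i1, i2, - b, - a) \<in> S \<longrightarrow> N \<le> i2)" for a b
      unfolding bdd_below_def by force
    thus ?thesis by (metis minus_minus)
  qed
  have 4: "(\<forall>a b c. bdd_below {d. (d, c, - b, - a) \<in> S}) \<longleftrightarrow>
    (\<forall>j2 j1 i2. \<exists>N. \<forall>i1. (i1, i2, j1, j2) \<in> S \<longrightarrow> N \<le> i1)"
    unfolding bdd_below_def mem_Collect_eq Ball_def by (metis minus_minus)
  show ?thesis
    unfolding admissible_def 1[symmetric] 2[symmetric] 3[symmetric] 4[symmetric]
    by (auto simp: lex_ext_def)
qed

section \<open>Elements as families of coefficients\<close>

lemma psd_coeff_eqI: "(\<And>e. psd_coeff A e = psd_coeff B e) \<Longrightarrow> A = B"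
  unfolding psd_coeff_def
  by (auto intro!: fls_eqI simp: psd1_nth_inject[symmetric] psd2_nth_inject[symmetric] fun_eq_iff split: prod.splits)

lemma psd_coeff_zero [simp]: "psd_coeff 0 e = 0"
  by (auto simp: psd_coeff_def zero_psd1.rep_eq zero_psd2.rep_eq split: prod.splits)

lemma psd_coeff_add [simp]: "psd_coeff (A + B) e = psd_coeff A e + psd_coeff B e"
  by (auto simp: psd_coeff_def plus_psd1.rep_eq plus_psd2.rep_eq split: prod.splits)

lemma psd_coeff_diff [simp]: "psd_coeff (A - B) e = psd_coeff A e - psd_coeff B e"
  by (auto simp: psd_coeff_def minus_psd1.rep_eq minus_psd2.rep_eq split: prod.splits)

lemma psd_coeff_sum [simp]: "psd_coeff (sum f I) e = (\<Sum>i\<in>I. psd_coeff (f i) e)"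
  by (induction I rule: infinite_finite_induct) auto

lemma psd_coeff_scale [simp]: "psd_coeff (scale_psd2 c A) e = c * psd_coeff A e"
  by (auto simp: psd_coeff_def scale_psd1.rep_eq scale_psd2.rep_eq split: prod.splits)

lemma admissible_support: "admissible {e. psd_coeff A e \<noteq> 0}"
proof -
  have b2: "\<exists>N. \<forall>i>N. psd2_nth A i = 0" using psd2_nth[of A] by simp
  have b1: "\<exists>N. \<forall>i>N. psd1_nth a i = 0" for a :: "'a psd1" using psd1_nth[of a] by simp
  have bf: "\<exists>N. \<forall>i<N. fls_nth f i = 0" for f :: "'b::zero fls"
    by (rule exI[of _ "fls_subdegree f"]) simp
  show ?thesis
    unfolding admissible_iff
  proof (intro conjI allI)
    obtain N where "\<forall>i>N. psd2_nth A i = 0" using b2 by blast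
    thus "\<exists>N. \<forall>(i1, i2, j1, j2)\<in>{e. psd_coeff A e \<noteq> 0}. j2 \<le> N"
      by (intro exI[of _ N]) (auto simp: psd_coeff_def zero_psd1.rep_eq intro: leI)
  next
    fix j2
    obtain N where "\<forall>i>N. psd1_nth (psd2_nth A j2) i = 0" using b1 by blast
    thus "\<exists>N. \<forall>i1 i2 j1. (i1, i2, j1, j2) \<in> {e. psd_coeff A e \<noteq> 0} \<longrightarrow> j1 \<le> N"
      by (intro exI[of _ N]) (auto simp: psd_coeff_def intro: leI)
  next
    fix j2 j1
    obtain N where "\<forall>i<N. fls_nth (psd1_nth (psd2_nth A j2) j1) i = 0" using bf by blast
    thus "\<exists>N. \<forall>i1 i2. (i1, i2, j1, j2) \<in> {e. psd_coeff A e \<noteq> 0} \<longrightarrow> N \<le> i2"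
      by (intro exI[of _ N]) (auto simp: psd_coeff_def intro: leI)
  next
    fix j2 j1 i2
    obtain N where "\<forall>i<N. fls_nth (fls_nth (psd1_nth (psd2_nth A j2) j1) i2) i = 0" using bf by blast
    thus "\<exists>N. \<forall>i1. (i1, i2, j1, j2) \<in> {e. psd_coeff A e \<noteq> 0} \<longrightarrow> N \<le> i1"
      by (intro exI[of _ N]) (auto simp: psd_coeff_def intro: leI)
  qed
qed

text \<open>
  Meaningful if the support of \<open>f\<close> is admissible; then \<open>psd_of\<close> inverts \<^const>\<open>psd_coeff\<close>.
\<close>

definition psd_of :: "(exponent \<Rightarrow> 'k::field) \<Rightarrow> 'k psd2" where
  "psd_of f = Abs_psd2 (\<lambda>j2. Abs_psd1 (\<lambda>j1. Abs_fls (\<lambda>i2. Abs_fls (\<lambda>i1. f (i1, i2, j1, j2)))))"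

lemma psd_coeff_psd_of:
  assumes "admissible {e. f e \<noteq> 0}"
  shows "psd_coeff (psd_of f) e = f e"
proof -
  let ?f1 = "\<lambda>i2 j1 j2. Abs_fls (\<lambda>i1. f (i1, i2, j1, j2))"
  let ?f2 = "\<lambda>j1 j2. Abs_fls (\<lambda>i2. ?f1 i2 j1 j2)"
  let ?f3 = "\<lambda>j2. Abs_psd1 (\<lambda>j1. ?f2 j1 j2)"
  obtain N where "\<forall>(i1, i2, j1, j2)\<in>{e. f e \<noteq> 0}. j2 \<le> N"
    using assms[unfolded admissible_iff, THEN conjunct1] by blast
  hence N: "f (i1, i2, j1, j2) = 0" if "j2 > N" for i1 i2 j1 j2
    using that by force
  have 2: "\<exists>N. \<forall>i1 i2 j1. j1 > N \<longrightarrow> f (i1, i2, j1, j2) = 0" for j2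
    using assms unfolding admissible_iff mem_Collect_eq by (meson not_less)
  have 3: "\<exists>N. \<forall>i1 i2. i2 < N \<longrightarrow> f (i1, i2, j1, j2) = 0" for j1 j2
    using assms unfolding admissible_iff mem_Collect_eq by (meson not_less)
  have 4: "\<exists>N. \<forall>i1. i1 < N \<longrightarrow> f (i1, i2, j1, j2) = 0" for j1 j2 i2
    using assms unfolding admissible_iff mem_Collect_eq by (meson not_less)
  have z: "Abs_fls (\<lambda>_. 0) = (0 :: 'b::zero fls)" by (simp add: zero_fls_def)
  have n1: "fls_nth (?f1 i2 j1 j2) i1 = f (i1, i2, j1, j2)" for i1 i2 j1 j2
    using 4[of i2 j1 j2] nth_Abs_fls_lower_bound[of _ "\<lambda>i1. f (i1, i2, j1, j2)" i1] by blast
  have n2: "fls_nth (?f2 j1 j2) i2 = ?f1 i2 j1 j2" for i2 j1 j2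
  proof -
    obtain M where M: "\<forall>i1 i2. i2 < M \<longrightarrow> f (i1, i2, j1, j2) = 0" using 3 by blast
    show ?thesis by (rule nth_Abs_fls_lower_bound[of M]) (use M z in auto)
  qed
  have n3: "psd1_nth (?f3 j2) j1 = ?f2 j1 j2" for j1 j2
  proof -
    obtain M where M: "\<forall>i1 i2 j1. j1 > M \<longrightarrow> f (i1, i2, j1, j2) = 0" using 2 by blast
    have "\<forall>j1>M. ?f2 j1 j2 = 0" using M by (simp add: z)
    thus ?thesis by (subst Abs_psd1_inverse) auto
  qed
  have n4: "psd2_nth (psd_of f) j2 = ?f3 j2" for j2
  proof -
    have "\<forall>j2>N. ?f3 j2 = 0" using N by (simp add: z zero_psd1_def)
    thus ?thesis unfolding psd_of_def by (subst Abs_psd2_inverse) auto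
  qed
  show ?thesis unfolding psd_coeff_def by (cases e) (simp add: n1 n2 n3 n4)
qed

text \<open>
  Multiplication by a constant of \<open>k\<close> enters as a map \<open>s\<close>, so that the same lemma serves both steps of the
  iteration, where scaling is a product in the first and a coefficientwise operation in the second.
\<close>

lemma psd_times_scale_left:
  assumes d: "derivation d" and "\<exists>N. \<forall>i>N. f i = 0" "\<exists>N. \<forall>i>N. g i = 0"
    and s: "\<And>x y. s (x + y) = s x + s y" "\<And>x y. s (x * y) = s x * y" "\<And>x y. s (x * y) = x * s y"
  shows "psd_times d (\<lambda>i. s (f i)) g n = s (psd_times d f g n)"
proof -
  obtain N where N: "\<forall>i>N. f i = 0" "\<forall>i>N. g i = 0" using common_bound[OF assms(2,3,3)] .
  have s0: "s 0 = 0" using s(1)[of 0 0] by simp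
  have ss: "s (sum h I) = (\<Sum>i\<in>I. s (h i))" for h :: "'b \<Rightarrow> _" and I
    by (induction I rule: infinite_finite_induct) (auto simp: s0 s(1))
  have sf: "\<forall>i>N. s (f i) = 0" using N s0 by simp
  note box = psd_times_box[OF d _ N(2), of _ "{n - N..N}" n "{..nat (2 * N - n)}"]
  have *: "of_int z * s x * y = s (of_int z * x * y)" for x y z
    by (simp add: s(2,3) mult.assoc) (metis s(2) s(3))
  show ?thesis
    by (subst (1 2) box) (use N(1) sf in \<open>auto simp: ss *\<close>)
qed

lemma psd_times_scale_right:
  assumes d: "derivation d" and "\<exists>N. \<forall>i>N. f i = 0" "\<exists>N. \<forall>i>N. g i = 0"
    and s: "\<And>x y. s (x + y) = s x + s y" "\<And>x y. s (x * y) = x * s y" "\<And>x. s (d x) = d (s x)"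
  shows "psd_times d f (\<lambda>i. s (g i)) n = s (psd_times d f g n)"
proof -
  obtain N where N: "\<forall>i>N. f i = 0" "\<forall>i>N. g i = 0" using common_bound[OF assms(2,3,3)] .
  have s0: "s 0 = 0" using s(1)[of 0 0] by simp
  have ss: "s (sum h I) = (\<Sum>i\<in>I. s (h i))" for h :: "'b \<Rightarrow> _" and I
    by (induction I rule: infinite_finite_induct) (auto simp: s0 s(1))
  have sg: "\<forall>i>N. s (g i) = 0" using N s0 by simp
  have sd: "(d ^^ l) (s x) = s ((d ^^ l) x)" for l x by (induction l) (auto simp: s(3))
  note box = psd_times_box[OF d N(1), of _ "{n - N..N}" n "{..nat (2 * N - n)}"]
  show ?thesis
    by (subst (1 2) box) (use N(2) sg in \<open>auto simp: ss sd s(2)\<close>)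
qed

lemma psd1_bounded: "\<exists>N. \<forall>i>N. psd1_nth a i = 0"
  using psd1_nth[of a] by simp

lemma psd2_bounded: "\<exists>N. \<forall>i>N. psd2_nth a i = 0"
  using psd2_nth[of a] by simp

lemma scale_psd1_add: "scale_psd1 c (a + b) = scale_psd1 c a + scale_psd1 c b"
  by transfer (simp add: distrib_left)

lemma scale_psd1_mult_left: "scale_psd1 c (a * b) = scale_psd1 c a * b"
  by transfer (rule ext, rule psd_times_scale_left[OF derivation_deriv_x1, symmetric],
      auto simp: distrib_left mult.assoc mult.left_commute)

lemma deriv_x1_const_mult: "deriv_x1 (fls_const (fls_const c) * x) = fls_const (fls_const c) * deriv_x1 x"
  by (intro fls_eqI) simp

lemma scale_psd1_mult_right: "scale_psd1 c (a * b) = a * scale_psd1 c b"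
  by transfer (rule ext, rule psd_times_scale_right[OF derivation_deriv_x1, symmetric],
      auto simp: distrib_left mult.assoc mult.left_commute deriv_x1_const_mult)

lemma scale_psd1_deriv: "scale_psd1 c (deriv_x2_psd1 a) = deriv_x2_psd1 (scale_psd1 c a)"
  by transfer (simp add: fun_eq_iff)

lemma scale_mult_left: "scale_psd2 c a * b = scale_psd2 c (a * b)"
  by transfer (rule ext, rule psd_times_scale_left[OF derivation_deriv_x2_psd1],
      auto intro: scale_psd1_add scale_psd1_mult_left scale_psd1_mult_right)

lemma scale_mult_right: "a * scale_psd2 c b = scale_psd2 c (a * b)"
  by transfer (rule ext, rule psd_times_scale_right[OF derivation_deriv_x2_psd1],
      auto intro: scale_psd1_add scale_psd1_mult_right scale_psd1_deriv)

lemma scale_add: "scale_psd2 c (A + B) = scale_psd2 c A + scale_psd2 c B"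
  and scale_scale: "scale_psd2 c (scale_psd2 c' A) = scale_psd2 (c * c') A"
  and scale_one: "scale_psd2 1 A = A"
  and scale_zero_right: "scale_psd2 c 0 = 0"
  and scale_of_nat: "scale_psd2 (of_nat n) A = of_nat n * A"
proof -
  show "scale_psd2 (of_nat n) A = of_nat n * A"
  proof (induction n)
    case 0
    show ?case by (rule psd_coeff_eqI) simp
  next
    case (Suc n)
    have "scale_psd2 (of_nat (Suc n)) A = A + scale_psd2 (of_nat n) A"
      by (rule psd_coeff_eqI) (simp add: algebra_simps)
    thus ?case using Suc by (simp add: distrib_right)
  qed
qed (rule psd_coeff_eqI; simp add: algebra_simps)+

section \<open>Supports of products\<close>

text \<open>
  Moving \<open>\<partial>\<^sub>i\<close> past a coefficient \<open>l\<close> times lowers the exponents of \<open>x\<^sub>i\<close> and of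
  \<open>\<partial>\<^sub>i\<close> by \<open>l\<close>.
\<close>

definition derivative_shifts :: "exponent set" where
  "derivative_shifts = {(- int l1, - int l2, - int l1, - int l2) |l1 l2. True}"

lemma derivative_shifts_zero: "0 \<in> derivative_shifts"
  unfolding derivative_shifts_def by (auto simp: zero_prod_def intro!: exI[of _ "0::nat"])

lemma derivative_shifts_add:
  "a \<in> derivative_shifts \<Longrightarrow> b \<in> derivative_shifts \<Longrightarrow> a + b \<in> derivative_shifts"
  unfolding derivative_shifts_def
proof clarify
  fix l1 l2 m1 m2 :: nat
  show "\<exists>n1 n2. (- int l1, - int l2, - int l1, - int l2) + (- int m1, - int m2, - int m1, - int m2)
    = (- int n1, - int n2, - int n1, - int n2) \<and> True"
    by (intro exI[of _ "l1 + m1"] exI[of _ "l2 + m2"]) simp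
qed

lemma admissible_derivative_shifts: "admissible derivative_shifts"
  unfolding admissible_iff
proof (intro conjI allI)
  fix j2 j1 i2
  show "\<exists>N. \<forall>(i1, i2, j1, j2)\<in>derivative_shifts. j2 \<le> N"
    "\<exists>N. \<forall>i1 i2 j1. (i1, i2, j1, j2) \<in> derivative_shifts \<longrightarrow> j1 \<le> N"
    by (rule exI[of _ 0], auto simp: derivative_shifts_def)+
  show "\<exists>N. \<forall>i1 i2. (i1, i2, j1, j2) \<in> derivative_shifts \<longrightarrow> N \<le> i2"
    by (rule exI[of _ j2]) (auto simp: derivative_shifts_def)
  show "\<exists>N. \<forall>i1. (i1, i2, j1, j2) \<in> derivative_shifts \<longrightarrow> N \<le> i1"
    by (rule exI[of _ j1]) (auto simp: derivative_shifts_def)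
qed

lemma additive_of_int_mult:
  fixes \<tau> :: "'a::ring_1 \<Rightarrow> 'b::ring_1"
  assumes "additive \<tau>"
  shows "\<tau> (of_int z * x) = of_int z * \<tau> x"
proof -
  interpret additive \<tau> by fact
  have n: "\<tau> (of_nat n * x) = of_nat n * \<tau> x" for n
    by (induction n) (auto simp: zero add distrib_right)
  show ?thesis by (cases z rule: int_cases2) (auto simp: n minus)
qed

text \<open>
  The functional \<open>\<tau>\<close> reads off a coefficient of the inner ring. A nonzero coefficient of a product must come from
  one of the terms of the defining sum.
\<close>

lemma psd_times_nonzero:
  fixes \<tau> :: "'a::ring_1 \<Rightarrow> 'b::ring_1"
  assumes "additive \<tau>" and "\<tau> (psd_times d f g n) \<noteq> 0"
  obtains (nz) i j l where "i + j - int l = n" "\<tau> (f i * (d ^^ l) (g j)) \<noteq> 0"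
proof -
  interpret additive \<tau> by fact
  from assms(2) obtain i j l where "i + j - int l = n"
    and *: "\<tau> (of_int (int_choose i l) * f i * (d ^^ l) (g j)) \<noteq> 0"
    unfolding psd_times_def sum by (auto elim!: sum.not_neutral_contains_not_neutral)
  moreover have "\<tau> (f i * (d ^^ l) (g j)) \<noteq> 0"
    using * by (auto simp: mult.assoc additive_of_int_mult[OF assms(1)])
  ultimately show ?thesis using nz by blast
qed

lemma funpow_fls_deriv_nth:
  "\<exists>z. fls_nth ((fls_deriv ^^ l) f) n = of_int z * fls_nth (f :: 'a::ring_1 fls) (n + int l)"
proof (induction l arbitrary: n)
  case 0
  show ?case by (rule exI[of _ 1]) simp
next
  case (Suc l)
  obtain z where z: "fls_nth ((fls_deriv ^^ l) f) (n + 1) = of_int z * fls_nth f (n + 1 + int l)"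
    using Suc by blast
  have "fls_nth ((fls_deriv ^^ Suc l) f) n = of_int ((n + 1) * z) * fls_nth f (n + 1 + int l)"
    by (simp add: z mult.assoc)
  moreover have "n + 1 + int l = n + int (Suc l)" by simp
  ultimately show ?case by metis
qed

lemma funpow_deriv_x1_nth: "fls_nth ((deriv_x1 ^^ l) f) n = (fls_deriv ^^ l) (fls_nth f n)"
  by (induction l) auto

lemma funpow_deriv_x2_psd1_nth: "psd1_nth ((deriv_x2_psd1 ^^ l) a) n = (deriv_x2 ^^ l) (psd1_nth a n)"
  by (induction l) (auto simp: deriv_x2_psd1.rep_eq)

text \<open>
  The only information about supports of products that is used later. It is found by unwinding the four levels of
  multiplication, from \<open>\<partial>\<^sub>2\<close> down to \<open>x\<^sub>1\<close>.
\<close>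

lemma psd_coeff_mult_nonzero:
  assumes "psd_coeff (A * B) e \<noteq> 0"
  shows "\<exists>a b. psd_coeff A a \<noteq> 0 \<and> psd_coeff B b \<noteq> 0 \<and> e - (a + b) \<in> derivative_shifts"
proof -
  obtain i1 i2 j1 j2 where e: "e = (i1, i2, j1, j2)" by (cases e)
  have "additive (\<lambda>a. fls_nth (fls_nth (psd1_nth a j1) i2) i1 :: 'a)"
    by (rule additive.intro) (simp add: plus_psd1.rep_eq)
  then obtain p p' l2 where 1: "p + p' - int l2 = j2"
    "fls_nth (fls_nth (psd1_nth (psd2_nth A p * (deriv_x2_psd1 ^^ l2) (psd2_nth B p')) j1) i2) i1 \<noteq> 0"
    using assms unfolding psd_coeff_def e times_psd2.rep_eq prod.case by (elim psd_times_nonzero)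
  have "additive (\<lambda>x. fls_nth (fls_nth x i2) i1 :: 'a)"
    by (rule additive.intro) simp
  then obtain q q' l1 where 2: "q + q' - int l1 = j1"
    "fls_nth (fls_nth (psd1_nth (psd2_nth A p) q *
       (deriv_x1 ^^ l1) ((deriv_x2 ^^ l2) (psd1_nth (psd2_nth B p') q'))) i2) i1 \<noteq> 0"
    using 1(2) unfolding times_psd1.rep_eq funpow_deriv_x2_psd1_nth[symmetric] by (elim psd_times_nonzero)
  let ?F = "psd1_nth (psd2_nth A p) q" and ?G = "psd1_nth (psd2_nth B p') q'"
  let ?G' = "(deriv_x1 ^^ l1) ((deriv_x2 ^^ l2) ?G)"
  obtain u where 3: "fls_nth (fls_nth ?F u * fls_nth ?G' (i2 - u)) i1 \<noteq> 0"
    using 2(2) unfolding fls_times_nth(2)[of ?F] additive.sum[of "\<lambda>x. fls_nth x i1", OF additive.intro, OF fls_plus_nth]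
    by (auto elim: sum.not_neutral_contains_not_neutral)
  then obtain s where "fls_nth (fls_nth ?F u) s * fls_nth (fls_nth ?G' (i2 - u)) (i1 - s) \<noteq> 0"
    unfolding fls_times_nth(2)[of "fls_nth ?F u"] by (rule sum.not_neutral_contains_not_neutral)
  hence 4: "fls_nth (fls_nth ?F u) s \<noteq> 0" "fls_nth (fls_nth ?G' (i2 - u)) (i1 - s) \<noteq> 0" by auto
  obtain z where z: "fls_nth (fls_nth ?G' (i2 - u)) (i1 - s) =
      of_int z * fls_nth (fls_nth ((deriv_x2 ^^ l2) ?G) (i2 - u)) (i1 - s + int l1)"
    using funpow_fls_deriv_nth unfolding funpow_deriv_x1_nth by blast
  obtain z' where z': "fls_nth ((deriv_x2 ^^ l2) ?G) (i2 - u) = of_int z' * fls_nth ?G (i2 - u + int l2)"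
    using funpow_fls_deriv_nth by blast
  have "fls_nth (of_int z' * fls_nth ?G (i2 - u + int l2)) (i1 - s + int l1) =
      of_int z' * fls_nth (fls_nth ?G (i2 - u + int l2)) (i1 - s + int l1)"
    by (rule additive_of_int_mult, rule additive.intro) simp
  hence 5: "fls_nth (fls_nth ?G (i2 - u + int l2)) (i1 - s + int l1) \<noteq> 0"
    using 4(2) unfolding z z' by auto
  have "e - ((s, u, q, p) + (i1 - s + int l1, i2 - u + int l2, q', p')) = (- int l1, - int l2, - int l1, - int l2)"
    using 1(1) 2(1) unfolding e by auto
  hence "e - ((s, u, q, p) + (i1 - s + int l1, i2 - u + int l2, q', p')) \<in> derivative_shifts"
    unfolding derivative_shifts_def by blast
  thus ?thesis using 4(1) 5
    by (intro exI[of _ "(s, u, q, p)"] exI[of _ "(i1 - s + int l1, i2 - u + int l2, q', p')"])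
      (simp add: psd_coeff_def)
qed

section \<open>The residue is a trace\<close>

lemma int_choose_negate: "int_choose i l * (- 1) ^ l = int_choose (int l - 1 - i) l"
proof -
  have "(of_int (int_choose i l * (- 1) ^ l) :: rat) = of_int (int_choose (int l - 1 - i) l)"
    using gbinomial_negated_upper[of "of_int (int l - 1 - i) :: rat" l]
    by (simp add: of_int_int_choose mult.commute)
  thus ?thesis by (simp only: of_int_eq_iff)
qed

text \<open>
  Integration by parts: modulo derivatives, which \<open>\<tau>\<close> kills, \<open>a d\<^sup>l(b)\<close> equals
  \<open>(-1)\<^sup>l d\<^sup>l(a) b\<close>. At total degree \<open>-1\<close>, where \<open>j = l - 1 - i\<close>, the sign turns
  \<open>i choose l\<close> into \<open>j choose l\<close>, and the sum for \<open>f g\<close> becomes term by term the sum for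
  \<open>g f\<close>. As \<open>\<tau>\<close> need only be a trace, the lemma can be iterated.
\<close>

lemma psd_times_trace:
  fixes \<tau> :: "'a::ring_1 \<Rightarrow> 'b::comm_ring_1"
  assumes d: "derivation d" and "additive \<tau>" and \<tau>d: "\<And>x. \<tau> (d x) = 0" and tr: "\<And>x y. \<tau> (x * y) = \<tau> (y * x)"
  shows "\<tau> (psd_times d f g (-1)) = \<tau> (psd_times d g f (-1))"
proof -
  interpret additive \<tau> by fact
  have parts: "\<tau> (x * (d ^^ l) y) = (- 1) ^ l * \<tau> ((d ^^ l) x * y)" for x y l
  proof (induction l arbitrary: x)
    case (Suc l)
    have "d (x * (d ^^ l) y) = d x * (d ^^ l) y + x * d ((d ^^ l) y)"
      using d unfolding derivation_def by blast
    hence "\<tau> (x * d ((d ^^ l) y)) = - \<tau> (d x * (d ^^ l) y)"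
      using \<tau>d[of "x * (d ^^ l) y"] by (simp add: add eq_neg_iff_add_eq_0 add.commute)
    thus ?case using Suc[of "d x"] by (simp add: funpow_swap1)
  qed simp
  have t: "\<tau> (of_int (int_choose i l) * f i * (d ^^ l) (g j)) = \<tau> (of_int (int_choose j l) * g j * (d ^^ l) (f i))"
    if "i + j - int l = -1" for i j l
  proof -
    have "int l - 1 - i = j" using that by simp
    hence "int_choose i l * (- 1) ^ l = int_choose j l"
      using int_choose_negate[of i l] by simp
    hence "(of_int (int_choose i l) :: 'b) * (- 1) ^ l = of_int (int_choose j l)"
      by (metis of_int_mult of_int_power of_int_minus of_int_1)
    moreover have "\<tau> (g j * (d ^^ l) (f i)) = \<tau> ((d ^^ l) (f i) * g j)" by (rule tr)
    ultimately show ?thesis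
      by (simp only: mult.assoc additive_of_int_mult[OF assms(2)] parts[of "f i"]) (simp only: mult.assoc[symmetric])
  qed
  show ?thesis
    unfolding psd_times_def sum
    by (rule sum.reindex_bij_witness[where i = "\<lambda>(j, i, l). (i, j, l)" and j = "\<lambda>(i, j, l). (j, i, l)"])
      (auto simp: t)
qed

definition fls_res :: "'k::field fls fls \<Rightarrow> 'k" where
  "fls_res x = fls_nth (fls_nth x (-1)) (-1)"

definition psd1_res :: "'k::field psd1 \<Rightarrow> 'k" where
  "psd1_res a = fls_res (psd1_nth a (-1))"

lemma res_eq: "res A = psd1_res (psd2_nth A (-1))"
  by (simp add: res_def psd_coeff_def psd1_res_def fls_res_def)

lemma additive_fls_res: "additive fls_res"
  by (rule additive.intro) (simp add: fls_res_def)

lemma additive_psd1_res: "additive psd1_res"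
  by (rule additive.intro) (simp add: psd1_res_def fls_res_def plus_psd1.rep_eq)

lemma psd1_res_trace: "psd1_res (a * b) = psd1_res (b * a)"
  unfolding psd1_res_def times_psd1.rep_eq
  by (rule psd_times_trace[OF derivation_deriv_x1 additive_fls_res]) (simp_all add: fls_res_def mult.commute)

lemma res_trace: "res (A * B) = res (B * A)"
  unfolding res_eq times_psd2.rep_eq
  by (rule psd_times_trace[OF derivation_deriv_x2_psd1 additive_psd1_res _ psd1_res_trace])
    (simp add: psd1_res_def fls_res_def deriv_x2_psd1.rep_eq)

lemma res_add [simp]: "res (A + B) = res A + res B"
  and res_diff [simp]: "res (A - B) = res A - res B"
  and res_scale [simp]: "res (scale_psd2 c A) = c * res A"
  and res_zero [simp]: "res 0 = 0"
  and res_sum: "res (sum F I) = (\<Sum>i\<in>I. res (F i))"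
  by (simp_all add: res_def)

lemma res_commutator: "res (A * commutator B C) = res (B * commutator C A)"
proof -
  have "res (A * (B * C)) = res (B * (C * A))" using res_trace[of A "B * C"] by (simp add: mult.assoc)
  moreover have "res (A * (C * B)) = res (B * (A * C))"
    using res_trace[of "A * C" B] by (simp add: mult.assoc)
  ultimately show ?thesis by (simp add: commutator_def right_diff_distrib)
qed

section \<open>Duality\<close>

text \<open>
  The coefficients of \<open>\<Sum>\<^sub>j \<partial>\<^sup>j g\<^sub>j\<close> after the \<open>g\<^sub>j\<close> have been moved to the left of the powers
  of \<open>\<partial>\<close>.
\<close>

definition psd_right :: "('a::ring_1 \<Rightarrow> 'a) \<Rightarrow> (int \<Rightarrow> 'a) \<Rightarrow> int \<Rightarrow> 'a" where
  "psd_right d g n = (\<Sum>l | g (n + int l) \<noteq> 0. of_int (int_choose (n + int l) l) * (d ^^ l) (g (n + int l)))"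

lemma psd_right_box:
  assumes d: "derivation d" and g: "\<forall>j>N. g j = 0" and K: "nat (N - n) \<le> K"
  shows "psd_right d g n = (\<Sum>l\<le>K. of_int (int_choose (n + int l) l) * (d ^^ l) (g (n + int l)))"
  unfolding psd_right_def
proof (rule sum.mono_neutral_left)
  show "{l. g (n + int l) \<noteq> 0} \<subseteq> {..K}"
  proof
    fix l assume "l \<in> {l. g (n + int l) \<noteq> 0}"
    hence "n + int l \<le> N" using g by (auto intro: leI)
    thus "l \<in> {..K}" using K by simp
  qed
qed (auto simp: derivation_zero[OF d])

lemma psd_right_bound: "\<forall>j>N. g j = 0 \<Longrightarrow> \<forall>n>N. psd_right d g n = 0"
  unfolding psd_right_def by (auto intro!: sum.neutral)

lemma int_choose_pred_self: "int_choose (int t - 1) t = (if t = 0 then 1 else 0)"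
proof (cases t)
  case (Suc n)
  have "(\<Prod>j = 0..<t. int t - 1 - int j) = 0"
    by (rule prod_zero) (use Suc in auto)
  thus ?thesis using Suc by (simp only: int_choose_def) simp
qed simp

text \<open>
  In \<open>f\<^sub>i \<partial>\<^sup>i \<partial>\<^sup>j g\<^sub>j\<close> the coefficient of \<open>\<partial>\<^bsup>-1\<^esup>\<close> is
  \<open>((i + j) choose (i + j + 1)) f\<^sub>i d\<^bsup>i+j+1\<^esup>(g\<^sub>j)\<close>, and this binomial coefficient vanishes unless
  \<open>i + j = -1\<close>. In terms of left coefficients this is the Vandermonde convolution
  \<open>\<Sum>\<^sub>l (i choose l) ((t - 1 - i) choose (t - l)) = (t - 1) choose t\<close>.
\<close>

lemma psd_times_psd_right:
  fixes f g :: "int \<Rightarrow> 'a::ring_1"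
  assumes d: "derivation d" and "\<exists>N. \<forall>i>N. f i = 0" "\<exists>N. \<forall>i>N. g i = 0"
    and I: "finite I" "{i. f i \<noteq> 0} \<subseteq> I"
  shows "psd_times d f (psd_right d g) (-1) = (\<Sum>i\<in>I. f i * g (- 1 - i))"
proof -
  obtain N where N: "N \<ge> 0" "\<forall>i>N. f i = 0" "\<forall>i>N. g i = 0" using common_bound[OF assms(2,3,3)] .
  \<comment> \<open>Outside \<open>J\<close> one of \<open>f i\<close> and \<open>g (- 1 - i)\<close> vanishes, and for \<open>i\<close> in \<open>J\<close> more than \<open>K\<close> derivatives only meet vanishing coefficients of \<open>g\<close>.\<close>
  define J where "J = {- 1 - N..N}"
  define K where "K = nat (2 * N + 1)"
  have *: "(\<Sum>l\<le>K. of_int (int_choose i l) * f i * (d ^^ l) (psd_right d g (- 1 - i + int l))) = f i * g (- 1 - i)"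
    if i: "i \<in> J" for i
  proof -
    let ?G = "\<lambda>t. (d ^^ t) (g (- 1 - i + int t))"
    have "(\<Sum>l\<le>K. of_int (int_choose i l) * f i * (d ^^ l) (psd_right d g (- 1 - i + int l))) =
      (\<Sum>l\<le>K. \<Sum>s\<le>K. of_int (int_choose i l * int_choose (- 1 - i + int (l + s)) s) * (f i * ?G (l + s)))"
    proof (rule sum.cong[OF refl])
      fix l assume "l \<in> {..K}"
      have "psd_right d g (- 1 - i + int l) =
        (\<Sum>s\<le>K. of_int (int_choose (- 1 - i + int l + int s) s) * (d ^^ s) (g (- 1 - i + int l + int s)))"
      proof (rule psd_right_box[OF d N(3)])
        have "N - (- 1 - i + int l) \<le> 2 * N + 1" using i by (simp add: J_def)
        thus "nat (N - (- 1 - i + int l)) \<le> K" unfolding K_def by (rule nat_mono)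
      qed
      hence "(d ^^ l) (psd_right d g (- 1 - i + int l)) =
        (\<Sum>s\<le>K. of_int (int_choose (- 1 - i + int (l + s)) s) * ?G (l + s))"
        by (simp add: derivation_sum[OF d] derivation_of_int_mult[OF d] funpow_add add.assoc)
      moreover have "of_int a * x * (of_int b * y) = of_int (a * b) * (x * y)" for a b and x y :: 'a
        using mult_of_int_commute[of b x] by (simp add: mult.assoc) (simp only: mult.assoc[symmetric])
      ultimately show "of_int (int_choose i l) * f i * (d ^^ l) (psd_right d g (- 1 - i + int l)) =
        (\<Sum>s\<le>K. of_int (int_choose i l * int_choose (- 1 - i + int (l + s)) s) * (f i * ?G (l + s)))"
        by (simp only: sum_distrib_left)
    qed
    also have "\<dots> = (\<Sum>(l, s)\<in>{..K} \<times> {..K}. of_int (int_choose i l * int_choose (- 1 - i + int (l + s)) s) * (f i * ?G (l + s)))"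
      by (simp only: sum.cartesian_product)
    also have "\<dots> = (\<Sum>(l, s)\<in>{(l, s). l + s \<le> K}. of_int (int_choose i l * int_choose (- 1 - i + int (l + s)) s) * (f i * ?G (l + s)))"
    proof (rule sum.mono_neutral_right)
      show "\<forall>p\<in>{..K} \<times> {..K} - {(l, s). l + s \<le> K}.
        (case p of (l, s) \<Rightarrow> of_int (int_choose i l * int_choose (- 1 - i + int (l + s)) s) * (f i * ?G (l + s))) = 0"
      proof
        fix p assume "p \<in> {..K} \<times> {..K} - {(l, s). l + s \<le> K}"
        then obtain l s where p: "p = (l, s)" and "\<not> l + s \<le> K" by auto
        hence "- 1 - i + int (l + s) > N" using i N(1) by (auto simp: J_def K_def)
        hence "g (- 1 - i + int (l + s)) = 0" using N by blast
        hence "?G (l + s) = 0" by (simp only: derivation_zero[OF d])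
        thus "(case p of (l, s) \<Rightarrow> of_int (int_choose i l * int_choose (- 1 - i + int (l + s)) s) * (f i * ?G (l + s))) = 0"
          by (simp only: p prod.case mult_zero_right)
      qed
    qed auto
    also have "\<dots> = (\<Sum>t\<le>K. \<Sum>l\<le>t. of_int (int_choose i l * int_choose (- 1 - i + int (l + (t - l))) (t - l)) * (f i * ?G (l + (t - l))))"
      by (rule sum.triangle_reindex_eq)
    also have "\<dots> = (\<Sum>t\<le>K. of_int (\<Sum>l\<le>t. int_choose i l * int_choose (- 1 - i + int t) (t - l)) * (f i * ?G t))"
      by (intro sum.cong refl) (simp add: sum_distrib_right)
    also have "\<dots> = (\<Sum>t\<le>K. if t = 0 then f i * g (- 1 - i) else 0)"
      by (intro sum.cong refl) (simp add: int_choose_Vandermonde int_choose_pred_self)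
    finally show ?thesis by simp
  qed
  have "psd_times d f (psd_right d g) (-1) =
    (\<Sum>i\<in>J. \<Sum>l\<le>K. of_int (int_choose i l) * f i * (d ^^ l) (psd_right d g (- 1 - i + int l)))"
    by (rule psd_times_box[OF d N(2) psd_right_bound[OF N(3)]]) (auto simp: J_def K_def)
  also have "\<dots> = (\<Sum>i\<in>J. f i * g (- 1 - i))"
    by (rule sum.cong[OF refl *])
  also have "\<dots> = (\<Sum>i\<in>I. f i * g (- 1 - i))"
  proof (rule sum.mono_neutral_cong)
    fix i assume "i \<in> I - J"
    hence "i > N \<or> - 1 - i > N" by (auto simp: J_def)
    thus "f i * g (- 1 - i) = 0" using N by auto
  next
    fix i assume "i \<in> J - I"
    hence "f i = 0" using I by blast
    thus "f i * g (- 1 - i) = 0" by simp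
  qed (use I in \<open>auto simp: J_def\<close>)
  finally show ?thesis .
qed

lemma psd_right_bounded: "\<exists>N. \<forall>j>N. g j = 0 \<Longrightarrow> \<exists>N. \<forall>n>N. psd_right d g n = 0"
  by (elim exE, drule psd_right_bound[of _ _ d], rule exI)

lift_definition right1 :: "'k::field psd1 \<Rightarrow> 'k psd1" is "psd_right deriv_x1"
  by (rule psd_right_bounded)

lemma right1_zero: "right1 0 = 0"
  by transfer (simp add: psd_right_def fun_eq_iff)

lift_definition right2 :: "'k::field psd2 \<Rightarrow> 'k psd2" is "\<lambda>g. psd_right deriv_x2_psd1 (\<lambda>j. right1 (g j))"
  by (rule psd_right_bounded) (metis right1_zero)

definition psd_monomial :: "exponent \<Rightarrow> 'k::field psd2" where
  "psd_monomial e = psd_of (\<lambda>x. if x = e then 1 else 0)"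

lemma psd_coeff_monomial [simp]: "psd_coeff (psd_monomial e) x = (if x = e then 1 else 0)"
  unfolding psd_monomial_def by (rule psd_coeff_psd_of) (simp add: adm.singleton)

lemma psd2_nth_eq_0:
  assumes "\<And>i1 i2 j1. psd_coeff A (i1, i2, j1, j2) = 0"
  shows "psd2_nth A j2 = 0"
proof -
  have "psd1_nth (psd2_nth A j2) j1 = 0" for j1
    using assms by (intro fls_eqI) (simp add: psd_coeff_def)
  thus ?thesis by (simp add: psd1_nth_inject[symmetric] zero_psd1.rep_eq fun_eq_iff)
qed

lemma psd1_nth_eq_0:
  assumes "\<And>i1 i2. psd_coeff A (i1, i2, j1, j2) = 0"
  shows "psd1_nth (psd2_nth A j2) j1 = 0"
  using assms by (intro fls_eqI) (simp add: psd_coeff_def)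

lemma fls_nth_mult_single:
  fixes F G :: "'a::comm_ring_1 fls"
  assumes "\<And>q. q \<noteq> p \<Longrightarrow> fls_nth F q = 0"
  shows "fls_nth (F * G) n = fls_nth F p * fls_nth G (n - p)"
proof -
  have "fls_nth (F * G) n = (\<Sum>i=p..n - fls_subdegree G. fls_nth F i * fls_nth G (n - i))"
    by (rule fls_nth_mult_box) (use assms in auto)
  also have "\<dots> = (\<Sum>i\<in>{p}. fls_nth F i * fls_nth G (n - i))"
    by (rule sum.mono_neutral_cong) (use assms in auto)
  finally show ?thesis by simp
qed

text \<open>
  In right normal form the residue pairing is diagonal in the monomials.
\<close>

lemma res_monomial_mult_right2:
  "res (psd_monomial e * right2 G) = psd_coeff G ((-1, -1, -1, -1) - e)"
proof -
  obtain i1 i2 j1 j2 where e: "e = (i1, i2, j1, j2)" by (cases e)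
  let ?M = "psd_monomial e :: 'a psd2"
  let ?m = "psd2_nth ?M j2" and ?g = "psd2_nth G (- 1 - j2)"
  have M: "fls_nth (fls_nth (psd1_nth (psd2_nth ?M j) p) q) s = (if (s, q, p, j) = e then 1 else 0)" for j p q s
    using psd_coeff_monomial[of e "(s, q, p, j)", where 'a = 'a] by (simp add: psd_coeff_def e)
  have m2: "{j. psd2_nth ?M j \<noteq> 0} \<subseteq> {j2}"
  proof (clarify, rule ccontr)
    fix j assume "j \<noteq> j2"
    hence "psd2_nth ?M j = 0" by (intro psd2_nth_eq_0) (simp add: e)
    thus "psd2_nth ?M j \<noteq> 0 \<Longrightarrow> False" by simp
  qed
  have m1: "{j. psd1_nth ?m j \<noteq> 0} \<subseteq> {j1}"
  proof (clarify, rule ccontr)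
    fix j assume "j \<noteq> j1"
    hence "psd1_nth ?m j = 0" by (intro psd1_nth_eq_0) (simp add: e)
    thus "psd1_nth ?m j \<noteq> 0 \<Longrightarrow> False" by simp
  qed
  have b: "\<exists>N. \<forall>j>N. right1 (psd2_nth G j) = 0"
    using psd2_bounded[of G] right1_zero by metis
  have "res (?M * right2 G) = psd1_res (?m * right1 ?g)"
    unfolding res_eq times_psd2.rep_eq right2.rep_eq
    by (subst psd_times_psd_right[OF derivation_deriv_x2_psd1 psd2_bounded b _ m2]) auto
  also have "\<dots> = fls_res (psd1_nth ?m j1 * psd1_nth ?g (- 1 - j1))"
    unfolding psd1_res_def times_psd1.rep_eq right1.rep_eq
    by (subst psd_times_psd_right[OF derivation_deriv_x1 psd1_bounded psd1_bounded _ m1]) auto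
  also have "\<dots> = fls_nth (fls_nth (psd1_nth ?m j1) i2 * fls_nth (psd1_nth ?g (- 1 - j1)) (- 1 - i2)) (- 1)"
    unfolding fls_res_def
    by (subst fls_nth_mult_single[of i2]) (auto intro!: fls_eqI simp: M[unfolded e] e)
  also have "\<dots> = fls_nth (fls_nth (psd1_nth ?m j1) i2) i1 * fls_nth (fls_nth (psd1_nth ?g (- 1 - j1)) (- 1 - i2)) (- 1 - i1)"
    by (rule fls_nth_mult_single) (auto simp: M[unfolded e] e)
  also have "fls_nth (fls_nth (psd1_nth ?m j1) i2) i1 = 1"
    by (simp add: M[unfolded e] e)
  finally show ?thesis by (simp add: psd_coeff_def e)
qed

text \<open>
  For linear \<open>\<phi>\<close>: continuity for the topology in which \<open>P\<close> is the union, over all admissible \<open>S\<close>, of the products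
  \<open>k\<^sup>S\<close> with \<open>k\<close> discrete.
\<close>

definition locally_finite :: "('k::field psd2 \<Rightarrow> 'k) \<Rightarrow> bool" where
  "locally_finite \<phi> \<longleftrightarrow>
    (\<forall>S. admissible S \<longrightarrow> (\<exists>E. finite E \<and> (\<forall>M. {e. psd_coeff M e \<noteq> 0} \<subseteq> S - E \<longrightarrow> \<phi> M = 0)))"

lemma linear_functional_expand:
  assumes "additive \<phi>" and scale: "\<And>c A. \<phi> (scale_psd2 c A) = c * \<phi> A"
    and E: "finite E" "\<And>M'. {e. psd_coeff M' e \<noteq> 0} \<subseteq> {e. psd_coeff M e \<noteq> 0} - E \<Longrightarrow> \<phi> M' = 0"
  shows "\<phi> M = (\<Sum>e\<in>E. psd_coeff M e * \<phi> (psd_monomial e))"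
proof -
  interpret additive \<phi> by fact
  define M' where "M' = M - (\<Sum>e\<in>E. scale_psd2 (psd_coeff M e) (psd_monomial e))"
  have "psd_coeff M' x = (if x \<in> E then 0 else psd_coeff M x)" for x
    using E(1) by (simp add: M'_def if_distrib sum.delta' cong: if_cong)
  hence "\<phi> M' = 0" by (intro E(2)) auto
  thus ?thesis by (simp add: M'_def diff sum scale)
qed

lemma locally_finite_res_mult: "locally_finite (\<lambda>M. res (M * G))"
  unfolding locally_finite_def
proof (intro allI impI)
  fix S assume S: "admissible S"
  let ?one = "(-1, -1, -1, -1) :: exponent"
  let ?T = "{b + d |b d. b \<in> {e. psd_coeff G e \<noteq> 0} \<and> d \<in> derivative_shifts}"
  have T: "admissible ?T" by (intro adm.sums admissible_support admissible_derivative_shifts)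
  define E where "E = fst ` {(a, t). a \<in> S \<and> t \<in> ?T \<and> a + t = ?one}"
  have "res (M * G) = 0" if M: "{e. psd_coeff M e \<noteq> 0} \<subseteq> S - E" for M
  proof (rule ccontr)
    assume "res (M * G) \<noteq> 0"
    then obtain a b where ab: "psd_coeff M a \<noteq> 0" "psd_coeff G b \<noteq> 0" "?one - (a + b) \<in> derivative_shifts"
      unfolding res_def using psd_coeff_mult_nonzero by blast
    have "b + (?one - (a + b)) \<in> ?T" using ab by blast
    moreover have "a + (b + (?one - (a + b))) = ?one" by (simp add: algebra_simps)
    moreover have "a \<in> S" using ab M by blast
    ultimately have "(a, b + (?one - (a + b))) \<in> {(a, t). a \<in> S \<and> t \<in> ?T \<and> a + t = ?one}" by blast
    hence "a \<in> E" unfolding E_def by force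
    thus False using ab M by blast
  qed
  moreover have "finite E" unfolding E_def by (intro finite_imageI adm.finite_sums S T)
  ultimately show "\<exists>E. finite E \<and> (\<forall>M. {e. psd_coeff M e \<noteq> 0} \<subseteq> S - E \<longrightarrow> res (M * G) = 0)" by blast
qed

text \<open>
  The exponents of the monomials on which \<open>\<phi>\<close> does not vanish meet every admissible set in a finite set, hence
  by duality they form a reflected admissible set. So there is an element of \<open>P\<close> with the right coefficients, and its
  right normal form represents \<open>\<phi>\<close> on monomials. Both sides being locally finite, this suffices.
\<close>

lemma linear_functional_representable:
  assumes \<phi>: "additive \<phi>" "\<And>c A. \<phi> (scale_psd2 c A) = c * \<phi> A" "locally_finite \<phi>"
  obtains G where "\<And>M. \<phi> M = res (M * G)"
proof -
  let ?one = "(-1, -1, -1, -1) :: exponent"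
  define W where "W = {e. \<phi> (psd_monomial e) \<noteq> 0}"
  have "finite (W \<inter> S)" if S: "admissible S" for S
  proof -
    obtain E where E: "finite E" "\<And>M. {e. psd_coeff M e \<noteq> 0} \<subseteq> S - E \<Longrightarrow> \<phi> M = 0"
      using \<phi>(3) S unfolding locally_finite_def by blast
    have "W \<inter> S \<subseteq> E"
    proof
      fix e assume e: "e \<in> W \<inter> S"
      show "e \<in> E"
      proof (rule ccontr)
        assume "e \<notin> E"
        hence "\<phi> (psd_monomial e) = 0" using e by (intro E(2)) auto
        thus False using e by (simp add: W_def)
      qed
    qed
    thus ?thesis using E(1) by (rule finite_subset)
  qed
  from adm.dual[OF this] have "admissible {x. - x \<in> W}" .
  from adm.sums[OF this adm.singleton[of ?one]] have
    "admissible {a + b |a b. a \<in> {x. - x \<in> W} \<and> b \<in> {?one}}" .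
  moreover have "{x. \<phi> (psd_monomial (?one - x)) \<noteq> 0} \<subseteq> {a + b |a b. a \<in> {x. - x \<in> W} \<and> b \<in> {?one}}"
  proof
    fix x assume x: "x \<in> {x. \<phi> (psd_monomial (?one - x)) \<noteq> 0}"
    have "x = (x - ?one) + ?one" by (simp only: diff_add_cancel)
    moreover have "x - ?one \<in> {x. - x \<in> W}" using x unfolding W_def mem_Collect_eq minus_diff_eq .
    ultimately show "x \<in> {a + b |a b. a \<in> {x. - x \<in> W} \<and> b \<in> {?one}}"
      using singletonI[of ?one] by - (rule CollectI, rule exI[of _ "x - ?one"], rule exI[of _ ?one], intro conjI)
  qed
  ultimately have w: "admissible {x. \<phi> (psd_monomial (?one - x)) \<noteq> 0}" by (rule adm.subset)
  define G where "G = right2 (psd_of (\<lambda>x. \<phi> (psd_monomial (?one - x))))"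
  have G: "res (psd_monomial e * G) = \<phi> (psd_monomial e)" for e
    unfolding G_def res_monomial_mult_right2 psd_coeff_psd_of[OF w] by (simp add: algebra_simps)
  have "\<phi> M = res (M * G)" for M
  proof -
    let ?S = "{e. psd_coeff M e \<noteq> 0}"
    obtain E where E: "finite E" "\<And>M'. {e. psd_coeff M' e \<noteq> 0} \<subseteq> ?S - E \<Longrightarrow> \<phi> M' = 0"
      using \<phi>(3)[unfolded locally_finite_def, rule_format, OF admissible_support[of M]] by blast
    obtain E' where E': "finite E'" "\<And>M'. {e. psd_coeff M' e \<noteq> 0} \<subseteq> ?S - E' \<Longrightarrow> res (M' * G) = 0"
      using locally_finite_res_mult[of G, unfolded locally_finite_def, rule_format, OF admissible_support[of M]] by blast
    have fin: "finite (E \<union> E')" using E E' by simp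
    have "\<phi> M = (\<Sum>e\<in>E \<union> E'. psd_coeff M e * \<phi> (psd_monomial e))"
      by (rule linear_functional_expand[OF \<phi>(1,2) fin]) (rule E(2), blast)
    moreover have "res (M * G) = (\<Sum>e\<in>E \<union> E'. psd_coeff M e * res (psd_monomial e * G))"
    proof (rule linear_functional_expand[where \<phi> = "\<lambda>M. res (M * G)", OF _ _ fin])
      show "additive (\<lambda>M. res (M * G))" by (rule additive.intro) (simp add: distrib_right)
      show "res (M' * G) = 0" if "{e. psd_coeff M' e \<noteq> 0} \<subseteq> ?S - (E \<union> E')" for M'
        by (rule E'(2)) (use that in blast)
    qed (simp add: scale_mult_left)
    ultimately show ?thesis by (simp add: G)
  qed
  thus ?thesis by (rule that)
qed

text \<open>
  Each coefficient functional is itself of the form \<open>A \<mapsto> res (A M)\<close>.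
\<close>

lemma res_nondegenerate:
  fixes G :: "'k::field psd2"
  assumes "\<And>M. res (M * G) = 0"
  shows "G = 0"
proof (rule psd_coeff_eqI)
  fix e
  have "locally_finite (\<lambda>M :: 'k psd2. psd_coeff M e)"
    unfolding locally_finite_def
    by (intro allI impI exI[of _ "{e}"]) auto
  then obtain M where "\<And>A :: 'k psd2. psd_coeff A e = res (A * M)"
    using linear_functional_representable[of "\<lambda>M :: 'k psd2. psd_coeff M e"] by (auto simp: additive_def)
  thus "psd_coeff G e = psd_coeff 0 e" using assms[of M] by (simp add: res_trace[of G])
qed

section \<open>Gradients of polynomial functions\<close>

lemma coord_val_add [simp]: "coord_val (L + M) q = coord_val L q + coord_val M q"
  by (auto simp: coord_val_def split: prod.splits)

lemma coord_val_scale [simp]: "coord_val (pair_scale c L) q = c * coord_val L q"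
  by (auto simp: coord_val_def pair_scale_def split: prod.splits)

definition coord_support :: "'k::field psd_pair \<Rightarrow> coord set" where
  "coord_support L = {q. coord_val L q \<noteq> 0}"

definition coord_admissible :: "coord set \<Rightarrow> bool" where
  "coord_admissible T \<longleftrightarrow> (\<forall>b. admissible {e. (b, e) \<in> T})"

lemma coord_admissible_support: "coord_admissible (coord_support L)"
  using admissible_support unfolding coord_admissible_def coord_support_def coord_val_def by auto

lemma coord_admissible_union:
  "coord_admissible S \<Longrightarrow> coord_admissible T \<Longrightarrow> coord_admissible (S \<union> T)"
  unfolding coord_admissible_def using adm.union by (simp add: Collect_disj_eq)

lemma coord_admissible_indicator:
  assumes "coord_admissible T"
  shows "\<exists>N :: 'k::field psd_pair. \<forall>q. coord_val N q = (if q \<in> T then 1 else 0)"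
proof -
  let ?N = "\<lambda>b. psd_of (\<lambda>e. if (b, e) \<in> T then 1 else 0) :: 'k psd2"
  have "psd_coeff (?N b) e = (if (b, e) \<in> T then 1 else 0)" for b e
    by (rule psd_coeff_psd_of) (use assms in \<open>simp add: coord_admissible_def\<close>)
  thus ?thesis by (intro exI[of _ "(?N False, ?N True)"]) (auto simp: coord_val_def split: prod.splits)
qed

lemma monom_val_empty [simp]: "monom_val L {#} = 1"
  and monom_val_add_mset [simp]: "monom_val L (add_mset q \<mu>) = coord_val L q * monom_val L \<mu>"
  by (simp_all add: monom_val_def)

lemma monom_val_nonzero_iff: "monom_val L \<mu> \<noteq> 0 \<longleftrightarrow> set_mset \<mu> \<subseteq> coord_support L"
  by (induction \<mu>) (auto simp: coord_support_def)

text \<open>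
  At the indicator function of \<open>T\<close> the monomials supported in \<open>T\<close> are exactly those that do not vanish, so the
  finiteness condition at this single point bounds the monomials that matter for all elements supported in \<open>T\<close>.
\<close>

lemma polynomial_function_restrict:
  fixes F :: "'k::field psd_pair \<Rightarrow> 'k"
  assumes "F \<in> polynomial_functions"
  obtains c where
    "\<And>T. coord_admissible T \<Longrightarrow> finite {\<mu>. c \<mu> \<noteq> 0 \<and> set_mset \<mu> \<subseteq> T}"
    "\<And>T L. coord_admissible T \<Longrightarrow> coord_support L \<subseteq> T \<Longrightarrow>
      F L = (\<Sum>\<mu> | c \<mu> \<noteq> 0 \<and> set_mset \<mu> \<subseteq> T. c \<mu> * monom_val L \<mu>)"
proof -
  obtain c :: "coord multiset \<Rightarrow> 'k" where c: "\<And>L. finite {\<mu>. c \<mu> * monom_val L \<mu> \<noteq> 0}"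
    "\<And>L. F L = (\<Sum>\<mu> | c \<mu> * monom_val L \<mu> \<noteq> 0. c \<mu> * monom_val L \<mu>)"
    using assms unfolding polynomial_functions_def by blast
  have fin: "finite {\<mu>. c \<mu> \<noteq> 0 \<and> set_mset \<mu> \<subseteq> T}" if T: "coord_admissible T" for T
  proof -
    obtain N :: "'k psd_pair" where N: "\<And>q. coord_val N q = (if q \<in> T then 1 else 0)"
      using coord_admissible_indicator[OF T, where 'k = 'k] by (elim exE) blast
    have "coord_support N = T" by (auto simp: coord_support_def N)
    hence "{\<mu>. c \<mu> * monom_val N \<mu> \<noteq> 0} = {\<mu>. c \<mu> \<noteq> 0 \<and> set_mset \<mu> \<subseteq> T}"
      using monom_val_nonzero_iff[of N] by auto
    thus ?thesis using c(1)[of N] by simp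
  qed
  moreover have "F L = (\<Sum>\<mu> | c \<mu> \<noteq> 0 \<and> set_mset \<mu> \<subseteq> T. c \<mu> * monom_val L \<mu>)"
    if T: "coord_admissible T" "coord_support L \<subseteq> T" for T L
    unfolding c(2)
  proof (rule sum.mono_neutral_left)
    show "{\<mu>. c \<mu> * monom_val L \<mu> \<noteq> 0} \<subseteq> {\<mu>. c \<mu> \<noteq> 0 \<and> set_mset \<mu> \<subseteq> T}"
      using T(2) monom_val_nonzero_iff[of L] by auto
  qed (use fin[OF T(1)] in auto)
  ultimately show ?thesis by (rule that)
qed

definition monom_deriv :: "'k::field psd_pair \<Rightarrow> 'k psd_pair \<Rightarrow> coord multiset \<Rightarrow> 'k" where
  "monom_deriv L M \<mu> = poly (pderiv (\<Prod>q\<in>#\<mu>. [:coord_val L q, coord_val M q:])) 0"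

lemma poly_monom_curve:
  "poly (\<Prod>q\<in>#\<mu>. [:coord_val L q, coord_val M q:]) \<epsilon> = monom_val (L + pair_scale \<epsilon> M) \<mu>"
  by (induction \<mu>) (auto simp: algebra_simps)

lemma monom_deriv_empty [simp]: "monom_deriv L M {#} = 0"
  by (simp add: monom_deriv_def)

lemma monom_deriv_add_mset [simp]:
  "monom_deriv L M (add_mset q \<mu>) = coord_val M q * monom_val L \<mu> + coord_val L q * monom_deriv L M \<mu>"
proof -
  have "poly (\<Prod>q\<in>#\<mu>. [:coord_val L q, coord_val M q:]) 0 = monom_val L \<mu>"
    by (induction \<mu>) auto
  thus ?thesis by (simp add: monom_deriv_def pderiv_mult pderiv_pCons del: mult_pCons_left)
qed

lemma monom_deriv_add: "monom_deriv L (M + M') \<mu> = monom_deriv L M \<mu> + monom_deriv L M' \<mu>"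
  by (induction \<mu>) (auto simp: algebra_simps)

lemma monom_deriv_scale: "monom_deriv L (pair_scale c M) \<mu> = c * monom_deriv L M \<mu>"
  by (induction \<mu>) (auto simp: algebra_simps)

lemma monom_deriv_eq_0: "(\<And>q. q \<in># \<mu> \<Longrightarrow> coord_val M q = 0) \<Longrightarrow> monom_deriv L M \<mu> = 0"
  by (induction \<mu>) auto

lemma has_dir_deriv_unique:
  assumes "has_dir_deriv F L M D" "has_dir_deriv F L M D'"
  shows "D = D'"
proof -
  obtain p p' where "\<And>\<epsilon>. F (L + pair_scale \<epsilon> M) = poly p \<epsilon>" "D = poly (pderiv p) 0"
    "\<And>\<epsilon>. F (L + pair_scale \<epsilon> M) = poly p' \<epsilon>" "D' = poly (pderiv p') 0"
    using assms unfolding has_dir_deriv_def by blast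
  moreover from this have "poly p = poly p'" by (metis ext)
  ultimately show ?thesis by (simp add: poly_eq_poly_eq_iff)
qed

text \<open>
  Uniqueness of gradients is nondegeneracy of the pairing, tested on each component separately.
\<close>

lemma is_gradient_unique:
  assumes "is_gradient F L G" "is_gradient F L G'"
  shows "G = G'"
proof -
  have p: "pairing M G = pairing M G'" for M
    using assms has_dir_deriv_unique unfolding is_gradient_def by blast
  have "fst G - fst G' = 0"
    by (rule res_nondegenerate) (use p[of "(_, 0)"] in \<open>simp add: pairing_def right_diff_distrib\<close>)
  moreover have "snd G - snd G' = 0"
    by (rule res_nondegenerate) (use p[of "(0, _)"] in \<open>simp add: pairing_def right_diff_distrib\<close>)
  ultimately show ?thesis by (simp add: prod_eq_iff)
qed

lemma gradient_eqI: "is_gradient F L G \<Longrightarrow> gradient F L = G"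
  unfolding gradient_def by (rule the_equality) (auto intro: is_gradient_unique)

lemma pderiv_sum_smult: "pderiv (\<Sum>i\<in>I. smult (c i) (p i)) = (\<Sum>i\<in>I. smult (c i) (pderiv (p i)))"
  by (induction I rule: infinite_finite_induct) (auto simp: pderiv_add pderiv_smult)

text \<open>
  With \<open>T\<close> containing the supports of \<open>L\<close> and \<open>M\<close>, the curve \<open>\<epsilon> \<mapsto> F (L + \<epsilon>M)\<close> only
  meets the finitely many monomials on \<open>T\<close>. This gives its derivative \<open>\<phi> M\<close>, and since \<open>T\<close> may be
  enlarged freely, linearity and local finiteness of \<open>\<phi>\<close> as well. The two components of the gradient represent the
  restrictions of \<open>\<phi>\<close> to the two summands of \<open>P\<^sup>2\<close>.
\<close>

lemma polynomial_function_has_gradient: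
  fixes F :: "'k::field_char_0 psd_pair \<Rightarrow> 'k"
  assumes "F \<in> polynomial_functions"
  shows "\<exists>G. is_gradient F L G"
proof -
  obtain c where fin: "\<And>T. coord_admissible T \<Longrightarrow> finite {\<mu>. c \<mu> \<noteq> 0 \<and> set_mset \<mu> \<subseteq> T}"
    and F: "\<And>T L. coord_admissible T \<Longrightarrow> coord_support L \<subseteq> T \<Longrightarrow>
      F L = (\<Sum>\<mu> | c \<mu> \<noteq> 0 \<and> set_mset \<mu> \<subseteq> T. c \<mu> * monom_val L \<mu>)"
    using polynomial_function_restrict[OF assms] by blast
  let ?S = "\<lambda>T. {\<mu>. c \<mu> \<noteq> 0 \<and> set_mset \<mu> \<subseteq> T}"
  have D: "has_dir_deriv F L M (\<Sum>\<mu>\<in>?S T. c \<mu> * monom_deriv L M \<mu>)"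
    if T: "coord_admissible T" "coord_support L \<subseteq> T" "coord_support M \<subseteq> T" for T M
    unfolding has_dir_deriv_def
  proof (intro exI conjI allI)
    let ?p = "\<Sum>\<mu>\<in>?S T. smult (c \<mu>) (\<Prod>q\<in>#\<mu>. [:coord_val L q, coord_val M q:])"
    fix \<epsilon>
    have "coord_support (L + pair_scale \<epsilon> M) \<subseteq> T"
    proof
      fix q assume "q \<in> coord_support (L + pair_scale \<epsilon> M)"
      hence "coord_val L q \<noteq> 0 \<or> coord_val M q \<noteq> 0" by (auto simp: coord_support_def)
      thus "q \<in> T" using T(2,3) unfolding coord_support_def by blast
    qed
    from F[OF T(1) this] show "F (L + pair_scale \<epsilon> M) = poly ?p \<epsilon>"
      by (simp add: poly_sum poly_monom_curve)
    show "(\<Sum>\<mu>\<in>?S T. c \<mu> * monom_deriv L M \<mu>) = poly (pderiv ?p) 0"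
      by (simp add: pderiv_sum_smult poly_sum monom_deriv_def)
  qed
  \<comment> \<open>Defined without reference to \<open>T\<close>, so that \<open>T\<close> can be chosen to suit each property of \<open>\<phi>\<close>.\<close>
  define \<phi> where "\<phi> M = (THE D. has_dir_deriv F L M D)" for M
  have \<phi>: "\<phi> M = (\<Sum>\<mu>\<in>?S T. c \<mu> * monom_deriv L M \<mu>)"
    if T: "coord_admissible T" "coord_support L \<subseteq> T" "coord_support M \<subseteq> T" for T M
    unfolding \<phi>_def using D[OF T] by (rule the_equality) (rule has_dir_deriv_unique[OF _ D[OF T]])
  have hd: "has_dir_deriv F L M (\<phi> M)" for M
  proof -
    have "coord_admissible (coord_support L \<union> coord_support M)"
      by (intro coord_admissible_union coord_admissible_support)
    from D[OF this, of M] \<phi>[OF this, of M] show ?thesis by auto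
  qed
  have add: "\<phi> (M + M') = \<phi> M + \<phi> M'" for M M'
  proof -
    let ?T = "coord_support L \<union> (coord_support M \<union> coord_support M')"
    have T: "coord_admissible ?T"
      by (intro coord_admissible_union coord_admissible_support)
    have "coord_support (M + M') \<subseteq> ?T" by (auto simp: coord_support_def)
    thus ?thesis
      by (subst (1 2 3) \<phi>[OF T]) (auto simp: monom_deriv_add distrib_left sum.distrib)
  qed
  have scale: "\<phi> (pair_scale s M) = s * \<phi> M" for s M
  proof -
    let ?T = "coord_support L \<union> coord_support M"
    have T: "coord_admissible ?T"
      by (intro coord_admissible_union coord_admissible_support)
    have "coord_support (pair_scale s M) \<subseteq> ?T" by (auto simp: coord_support_def)
    thus ?thesis
      by (subst (1 2) \<phi>[OF T]) (auto simp: monom_deriv_scale sum_distrib_left mult.left_commute)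
  qed
  have local: "\<exists>E. finite E \<and> (\<forall>M. coord_support M \<subseteq> T - E \<longrightarrow> \<phi> M = 0)" if "coord_admissible T" for T
  proof -
    let ?T = "coord_support L \<union> T"
    have T: "coord_admissible ?T" by (intro coord_admissible_union coord_admissible_support that)
    have "\<phi> M = 0" if M: "coord_support M \<subseteq> T - (\<Union>\<mu>\<in>?S ?T. set_mset \<mu>)" for M
    proof -
      have "monom_deriv L M \<mu> = 0" if "\<mu> \<in> ?S ?T" for \<mu>
        by (rule monom_deriv_eq_0) (use M that in \<open>force simp: coord_support_def\<close>)
      moreover have "coord_support M \<subseteq> ?T" using M by blast
      ultimately show ?thesis by (subst \<phi>[OF T]) auto
    qed
    thus ?thesis using fin[OF T] by (intro exI[of _ "\<Union>\<mu>\<in>?S ?T. set_mset \<mu>"]) auto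
  qed
  have rep: "\<exists>G. \<forall>M. \<phi> (if b then (0, M) else (M, 0)) = res (M * G)" for b
  proof -
    let ?j = "\<lambda>M. if b then (0, M) else (M, 0) :: 'k psd_pair"
    have j: "?j (M + M') = ?j M + ?j M'" "?j (scale_psd2 s M) = pair_scale s (?j M)" for M M' s
      by (simp_all add: pair_scale_def scale_zero_right)
    have supp: "coord_support (?j M) = Pair b ` {e. psd_coeff M e \<noteq> 0}" for M
    proof (rule set_eqI)
      fix q :: coord
      obtain b' e where q: "q = (b', e)" by (cases q)
      show "q \<in> coord_support (?j M) \<longleftrightarrow> q \<in> Pair b ` {e. psd_coeff M e \<noteq> 0}"
        unfolding coord_support_def coord_val_def q
        by (cases b; cases b'; simp add: image_iff)
    qed
    have lf: "locally_finite (\<lambda>M. \<phi> (?j M))" unfolding locally_finite_def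
    proof (intro allI impI)
      fix S assume S: "admissible S"
      have "admissible {e. (b', e) \<in> Pair b ` S}" for b'
        by (cases b; cases b') (simp_all add: image_iff S adm.Q_empty)
      hence "coord_admissible (Pair b ` S)"
        unfolding coord_admissible_def by blast
      from local[OF this] obtain E where E': "finite E \<and> (\<forall>M. coord_support M \<subseteq> Pair b ` S - E \<longrightarrow> \<phi> M = 0)"
        by (rule exE)
      note E = E'[THEN conjunct1] E'[THEN conjunct2, rule_format]
      have "\<phi> (?j M) = 0" if "{e. psd_coeff M e \<noteq> 0} \<subseteq> S - snd ` E" for M
      proof (rule E(2), rule subsetI)
        fix q assume "q \<in> coord_support (?j M)"
        hence "q \<in> Pair b ` {e. psd_coeff M e \<noteq> 0}" by (simp only: supp)
        then obtain e where "q = (b, e)" "e \<in> {e. psd_coeff M e \<noteq> 0}" by (rule imageE)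
        hence "q = (b, e)" "e \<in> S - snd ` E" using that by (simp, blast)
        thus "q \<in> Pair b ` S - E" by (force simp: image_iff)
      qed
      thus "\<exists>E. finite E \<and> (\<forall>M. {e. psd_coeff M e \<noteq> 0} \<subseteq> S - E \<longrightarrow> \<phi> (?j M) = 0)"
        using E(1) by (intro exI[of _ "snd ` E"]) simp
    qed
    have "additive (\<lambda>M. \<phi> (?j M))"
      by (rule additive.intro) (simp only: j add)
    moreover have "\<phi> (?j (scale_psd2 s M)) = s * \<phi> (?j M)" for s M by (simp only: j scale)
    ultimately obtain G where "\<And>M. \<phi> (?j M) = res (M * G)"
      using lf by (rule linear_functional_representable) blast
    thus ?thesis by (intro exI allI)
  qed
  obtain G1 where G1: "\<And>M. \<phi> (M, 0) = res (M * G1)" using rep[of False] by auto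
  obtain G2 where G2: "\<And>M. \<phi> (0, M) = res (M * G2)" using rep[of True] by auto
  have "\<phi> M = pairing M (G1, G2)" for M
    using add[of "(fst M, 0)" "(0, snd M)"] by (simp add: pairing_def G1 G2)
  thus ?thesis using hd unfolding is_gradient_def by metis
qed

section \<open>Coefficients of products as polynomial functions\<close>

lemma psd_coeff_one: "psd_coeff 1 e = (if e = 0 then 1 else 0)"
  by (auto simp: psd_coeff_def one_psd2.rep_eq one_psd1.rep_eq zero_psd1.rep_eq zero_prod_def split: prod.splits)

lemma psd_coeff_prod_list_nonzero:
  assumes "psd_coeff (C * prod_list As) e \<noteq> 0"
  shows "\<exists>y es. psd_coeff C y \<noteq> 0 \<and> list_all2 (\<lambda>A x. psd_coeff A x \<noteq> 0) As es \<and>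
    e - (y + sum_list es) \<in> derivative_shifts"
  using assms
proof (induction As arbitrary: C)
  case Nil
  thus ?case by (intro exI[of _ e] exI[of _ "[]"]) (auto simp: derivative_shifts_zero)
next
  case (Cons A As)
  have "psd_coeff (C * A * prod_list As) e \<noteq> 0" using Cons.prems by (simp add: mult.assoc)
  from Cons.IH[OF this] obtain z es where z: "psd_coeff (C * A) z \<noteq> 0"
    "list_all2 (\<lambda>A x. psd_coeff A x \<noteq> 0) As es" "e - (z + sum_list es) \<in> derivative_shifts"
    by blast
  obtain y x where yx: "psd_coeff C y \<noteq> 0" "psd_coeff A x \<noteq> 0" "z - (y + x) \<in> derivative_shifts"
    using psd_coeff_mult_nonzero[OF z(1)] by blast
  have "e - (y + sum_list (x # es)) = (e - (z + sum_list es)) + (z - (y + x))"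
    by (simp add: algebra_simps)
  hence "e - (y + sum_list (x # es)) \<in> derivative_shifts"
    using derivative_shifts_add[OF z(3) yx(3)] by (simp only:)
  moreover have "list_all2 (\<lambda>A x. psd_coeff A x \<noteq> 0) (A # As) (x # es)" using yx z by simp
  ultimately show ?case using yx(1) by blast
qed

text \<open>
  Ways to write \<open>e\<close> as a sum of \<open>m\<close> exponents from \<open>T\<close> and one from \<open>Y\<close>. With \<open>T\<close> containing the supports
  of the factors and \<open>Y\<close> the derivative shifts, only these can contribute to the coefficient at \<open>e\<close> of a product.
\<close>

definition factorizations :: "exponent set \<Rightarrow> exponent set \<Rightarrow> nat \<Rightarrow> exponent \<Rightarrow> exponent list set" where
  "factorizations Y T m e = {es. length es = m \<and> set es \<subseteq> T \<and> e - sum_list es \<in> Y}"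

text \<open>
  Absorbing the first exponent into \<open>Y\<close> keeps \<open>Y\<close> admissible and shortens the list; the first exponent is then
  recovered from finitely many choices.
\<close>

lemma finite_factorizations:
  assumes "admissible Y" "admissible T"
  shows "finite (factorizations Y T m e)"
  using assms(1)
proof (induction m arbitrary: Y)
  case 0
  show ?case by (rule finite_subset[of _ "{[]}"]) (auto simp: factorizations_def)
next
  case (Suc m)
  let ?Y = "{y + x |y x. y \<in> Y \<and> x \<in> T}"
  let ?P = "\<lambda>es. {(x, y). x \<in> T \<and> y \<in> Y \<and> x + y = e - sum_list es}"
  have "factorizations Y T (Suc m) e \<subseteq> (\<Union>es\<in>factorizations ?Y T m e. (\<lambda>(x, y). x # es) ` ?P es)"
  proof
    fix xs assume "xs \<in> factorizations Y T (Suc m) e"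
    then obtain x es where xs: "xs = x # es" "length es = m" "x \<in> T" "set es \<subseteq> T"
      "e - (x + sum_list es) \<in> Y"
      by (auto simp: factorizations_def length_Suc_conv)
    let ?y = "e - (x + sum_list es)"
    have "e - sum_list es = ?y + x" by (simp add: algebra_simps)
    hence "e - sum_list es \<in> ?Y" using xs by blast
    hence 1: "es \<in> factorizations ?Y T m e" using xs by (simp add: factorizations_def)
    have "(x, ?y) \<in> ?P es" using xs by (simp add: algebra_simps)
    hence "xs \<in> (\<lambda>(x, y). x # es) ` ?P es" unfolding xs(1) by (rule rev_image_eqI) simp
    with 1 show "xs \<in> (\<Union>es\<in>factorizations ?Y T m e. (\<lambda>(x, y). x # es) ` ?P es)" by (rule UN_I)
  qed
  moreover have "finite \<dots>"
    by (intro finite_UN_I finite_imageI adm.finite_sums Suc.IH adm.sums Suc.prems assms(2))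
  ultimately show ?case by (rule finite_subset)
qed

text \<open>
  The factors are expanded into monomials one at a time from the left, the monomials already chosen being collected in
  \<open>C\<close>. The set \<open>Y\<close>, which is required to contain the support of \<open>C\<close> together with its derivative shifts,
  follows \<open>C\<close>: when \<open>C\<close> is multiplied by the monomial at \<open>x\<close>, it is translated by \<open>x\<close>.
\<close>

lemma psd_coeff_prod_list_expand:
  fixes C :: "'k::field psd2"
  assumes T: "admissible T" "\<And>A. A \<in> set As \<Longrightarrow> {x. psd_coeff A x \<noteq> 0} \<subseteq> T"
    and Y: "admissible Y" "\<And>y d. psd_coeff C y \<noteq> 0 \<Longrightarrow> d \<in> derivative_shifts \<Longrightarrow> y + d \<in> Y"
  shows "psd_coeff (C * prod_list As) e =
    (\<Sum>es\<in>factorizations Y T (length As) e.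
       prod_list (map2 psd_coeff As es) * psd_coeff (C * prod_list (map psd_monomial es)) e)"
  using T(2) Y
proof (induction As arbitrary: C Y)
  case Nil
  have "factorizations Y T 0 e = (if e \<in> Y then {[]} else {})"
    by (auto simp: factorizations_def)
  moreover have "psd_coeff C e = 0" if "e \<notin> Y"
    using Nil.prems(3)[of e 0] that derivative_shifts_zero by auto
  ultimately show ?case by simp
next
  case (Cons A As)
  let ?m = "length As" and ?F = "factorizations Y T (Suc (length As)) e"
  let ?\<phi> = "\<lambda>M. psd_coeff (C * M * prod_list As) e"
  \<comment> \<open>The singleton is kept as a second summand so that this is literally a sum of admissible sets.\<close>
  let ?Y = "\<lambda>x. {y + x' |y x'. y \<in> Y \<and> x' \<in> {x}}"
  \<comment> \<open>The exponents of \<open>A\<close> that can contribute; the rest of \<open>A\<close> gives zero by the support of products.\<close>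
  define E where "E = hd ` ?F"
  have F: "x # es \<in> ?F \<longleftrightarrow> x \<in> T \<and> es \<in> factorizations (?Y x) T ?m e" for x es
  proof -
    have "e - sum_list es \<in> ?Y x \<longleftrightarrow> e - (x + sum_list es) \<in> Y"
    proof
      assume "e - sum_list es \<in> ?Y x"
      then obtain y where "y \<in> Y" "e - sum_list es = y + x" by blast
      moreover from this have "e - (x + sum_list es) = y" by (simp add: algebra_simps)
      ultimately show "e - (x + sum_list es) \<in> Y" by simp
    next
      assume "e - (x + sum_list es) \<in> Y"
      moreover have "e - sum_list es = (e - (x + sum_list es)) + x" by (simp add: algebra_simps)
      ultimately show "e - sum_list es \<in> ?Y x" by blast
    qed
    thus ?thesis by (auto simp: factorizations_def)
  qed
  have finF: "finite ?F" by (intro finite_factorizations T(1) Cons.prems(2))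
  hence finE: "finite E" by (simp add: E_def)
  have finG: "finite (factorizations (?Y x) T ?m e)" for x
    by (intro finite_factorizations adm.sums adm.singleton T(1) Cons.prems(2))
  have "?\<phi> A = (\<Sum>x\<in>E. psd_coeff A x * ?\<phi> (psd_monomial x))"
  proof (rule linear_functional_expand[where \<phi> = ?\<phi>, OF _ _ finE])
    show "additive ?\<phi>" by (rule additive.intro) (simp add: distrib_left distrib_right)
    show "?\<phi> (scale_psd2 c M) = c * ?\<phi> M" for c and M :: "'k psd2" by (simp add: scale_mult_left scale_mult_right)
    fix M :: "'k psd2" assume M: "{x. psd_coeff M x \<noteq> 0} \<subseteq> {x. psd_coeff A x \<noteq> 0} - E"
    show "?\<phi> M = 0"
    proof (rule ccontr)
      assume "?\<phi> M \<noteq> 0"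
      hence "psd_coeff (C * prod_list (M # As)) e \<noteq> 0" by (simp add: mult.assoc)
      from psd_coeff_prod_list_nonzero[OF this] obtain y xs where y: "psd_coeff C y \<noteq> 0"
        and xs: "list_all2 (\<lambda>A x. psd_coeff A x \<noteq> 0) (M # As) xs"
        and d: "e - (y + sum_list xs) \<in> derivative_shifts" by blast
      from xs obtain x es where xs_eq: "xs = x # es" and x: "psd_coeff M x \<noteq> 0"
        and es: "list_all2 (\<lambda>A x. psd_coeff A x \<noteq> 0) As es"
        by (cases xs) simp_all
      note * = y x es d[unfolded xs_eq]
      have "set es \<subseteq> T"
      proof
        fix z assume "z \<in> set es"
        then obtain i where i: "i < length es" "z = es ! i" by (auto simp: in_set_conv_nth)
        hence "psd_coeff (As ! i) z \<noteq> 0" "As ! i \<in> set As"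
          using es by (auto simp: list_all2_conv_all_nth)
        thus "z \<in> T" using Cons.prems(1)[of "As ! i"] by auto
      qed
      moreover have "x \<in> T" using M *(2) Cons.prems(1)[of A] by auto
      moreover have "e - sum_list (x # es) = y + (e - (y + sum_list (x # es)))"
        by (simp add: algebra_simps)
      hence "e - sum_list (x # es) \<in> Y" using Cons.prems(3)[OF *(1,4)] by simp
      ultimately have "x # es \<in> ?F"
        using list_all2_lengthD[OF *(3)] by (simp add: factorizations_def)
      hence "x \<in> E" unfolding E_def by force
      thus False using M *(2) by blast
    qed
  qed
  also have "\<dots> = (\<Sum>x\<in>E. psd_coeff A x * (\<Sum>es\<in>factorizations (?Y x) T ?m e.
       prod_list (map2 psd_coeff As es) * psd_coeff (C * psd_monomial x * prod_list (map psd_monomial es)) e))"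
  proof (rule sum.cong[OF refl], rule arg_cong[where f = "(*) _"], rule Cons.IH)
    fix x y d assume "psd_coeff (C * psd_monomial x) y \<noteq> 0" and d: "d \<in> derivative_shifts"
    then obtain u where u: "psd_coeff C u \<noteq> 0" "y - (u + x) \<in> derivative_shifts"
      using psd_coeff_mult_nonzero[of C "psd_monomial x" y] by (auto split: if_splits)
    have "u + (y - (u + x) + d) \<in> Y" by (intro Cons.prems(3) u derivative_shifts_add d)
    moreover have "y + d = (u + (y - (u + x) + d)) + x" by (simp add: algebra_simps)
    ultimately show "y + d \<in> ?Y x" by blast
  next
    show "admissible (?Y x)" for x by (intro adm.sums adm.singleton Cons.prems(2))
    show "{x. psd_coeff B x \<noteq> 0} \<subseteq> T" if "B \<in> set As" for B
      using Cons.prems(1)[of B] that by simp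
  qed
  also have "\<dots> = (\<Sum>(x, es)\<in>(SIGMA x:E. factorizations (?Y x) T ?m e).
      prod_list (map2 psd_coeff (A # As) (x # es)) * psd_coeff (C * prod_list (map psd_monomial (x # es))) e)"
    using finE finG by (subst sum.Sigma[symmetric]) (auto simp: sum_distrib_left mult.assoc)
  also have "\<dots> = (\<Sum>es\<in>?F. prod_list (map2 psd_coeff (A # As) es) * psd_coeff (C * prod_list (map psd_monomial es)) e)"
  proof (rule sum.reindex_bij_witness[where j = "\<lambda>(x, es). x # es" and i = "\<lambda>xs. (hd xs, tl xs)"])
    fix xs assume xs: "xs \<in> ?F"
    then obtain x es where "xs = x # es" by (cases xs) (auto simp: factorizations_def)
    thus "(case (hd xs, tl xs) of (x, es) \<Rightarrow> x # es) = xs"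
      "(hd xs, tl xs) \<in> (SIGMA x:E. factorizations (?Y x) T ?m e)"
      using xs F[of x es] by (auto simp: E_def intro: rev_image_eqI)
  next
    fix p assume p: "p \<in> (SIGMA x:E. factorizations (?Y x) T ?m e)"
    then obtain x es where "p = (x, es)" "x \<in> E" "es \<in> factorizations (?Y x) T ?m e" by blast
    moreover from this have "x \<in> T"
      unfolding E_def by (auto simp: factorizations_def length_Suc_conv)
    ultimately show "(case p of (x, es) \<Rightarrow> x # es) \<in> ?F" using F[of x es] by simp
  qed auto
  finally show ?case by (simp add: mult.assoc)
qed

lemma polynomial_functions_add:
  fixes F G :: "'k::field psd_pair \<Rightarrow> 'k"
  assumes "F \<in> polynomial_functions" "G \<in> polynomial_functions"
  shows "(\<lambda>L. F L + G L) \<in> polynomial_functions"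
proof -
  obtain c D where c: "\<And>\<mu>. c \<mu> \<noteq> 0 \<Longrightarrow> size \<mu> \<le> D" "\<And>L. finite {\<mu>. c \<mu> * monom_val L \<mu> \<noteq> 0}"
    "\<And>L. F L = (\<Sum>\<mu> | c \<mu> * monom_val L \<mu> \<noteq> 0. c \<mu> * monom_val L \<mu>)"
    using assms(1) unfolding polynomial_functions_def by blast
  obtain c' D' where c': "\<And>\<mu>. c' \<mu> \<noteq> 0 \<Longrightarrow> size \<mu> \<le> D'" "\<And>L. finite {\<mu>. c' \<mu> * monom_val L \<mu> \<noteq> 0}"
    "\<And>L. G L = (\<Sum>\<mu> | c' \<mu> * monom_val L \<mu> \<noteq> 0. c' \<mu> * monom_val L \<mu>)"
    using assms(2) unfolding polynomial_functions_def by blast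
  let ?c = "\<lambda>\<mu>. c \<mu> + c' \<mu>"
  have sub: "{\<mu>. ?c \<mu> * monom_val L \<mu> \<noteq> 0} \<subseteq> {\<mu>. c \<mu> * monom_val L \<mu> \<noteq> 0} \<union> {\<mu>. c' \<mu> * monom_val L \<mu> \<noteq> 0}" (is "_ \<subseteq> ?U L") for L
    by (auto simp: distrib_right)
  have fin: "finite (?U L)" for L using c(2) c'(2) by simp
  have "F L + G L = (\<Sum>\<mu> | ?c \<mu> * monom_val L \<mu> \<noteq> 0. ?c \<mu> * monom_val L \<mu>)" for L
  proof -
    have "F L = (\<Sum>\<mu>\<in>?U L. c \<mu> * monom_val L \<mu>)" "G L = (\<Sum>\<mu>\<in>?U L. c' \<mu> * monom_val L \<mu>)"
      unfolding c(3) c'(3) by (rule sum.mono_neutral_left[OF fin]; auto)+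
    moreover have "(\<Sum>\<mu> | ?c \<mu> * monom_val L \<mu> \<noteq> 0. ?c \<mu> * monom_val L \<mu>) = (\<Sum>\<mu>\<in>?U L. ?c \<mu> * monom_val L \<mu>)"
      by (rule sum.mono_neutral_left[OF fin sub]) auto
    ultimately show ?thesis by (simp add: sum.distrib distrib_right)
  qed
  moreover have "size \<mu> \<le> max D D'" if "?c \<mu> \<noteq> 0" for \<mu>
    using c(1)[of \<mu>] c'(1)[of \<mu>] that by (cases "c \<mu> = 0") auto
  ultimately show ?thesis
    unfolding polynomial_functions_def using finite_subset[OF sub fin]
    by (intro CollectI exI[of _ ?c] conjI exI[of _ "max D D'"]) auto
qed

lemma polynomial_functions_scale:
  fixes F :: "'k::field psd_pair \<Rightarrow> 'k"
  assumes "F \<in> polynomial_functions"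
  shows "(\<lambda>L. a * F L) \<in> polynomial_functions"
proof -
  obtain c D where c: "\<And>\<mu>. c \<mu> \<noteq> 0 \<Longrightarrow> size \<mu> \<le> D" "\<And>L. finite {\<mu>. c \<mu> * monom_val L \<mu> \<noteq> 0}"
    "\<And>L. F L = (\<Sum>\<mu> | c \<mu> * monom_val L \<mu> \<noteq> 0. c \<mu> * monom_val L \<mu>)"
    using assms unfolding polynomial_functions_def by blast
  have sub: "{\<mu>. a * c \<mu> * monom_val L \<mu> \<noteq> 0} \<subseteq> {\<mu>. c \<mu> * monom_val L \<mu> \<noteq> 0}" for L
    by auto
  have "a * F L = (\<Sum>\<mu> | a * c \<mu> * monom_val L \<mu> \<noteq> 0. a * c \<mu> * monom_val L \<mu>)" for L
    unfolding c(3) sum_distrib_left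
    by (rule sum.mono_neutral_cong_right[OF c(2) sub]) (auto simp: mult.assoc)
  thus ?thesis
    unfolding polynomial_functions_def using finite_subset[OF sub c(2)] c(1)
    by (intro CollectI exI[of _ "\<lambda>\<mu>. a * c \<mu>"] conjI exI[of _ D]) auto
qed

lemma polynomial_functions_zero: "(\<lambda>L. 0) \<in> polynomial_functions"
  unfolding polynomial_functions_def by (intro CollectI exI[of _ "\<lambda>_. 0"]) auto

lemma polynomial_functions_sum:
  assumes "\<And>i. i \<in> I \<Longrightarrow> F i \<in> polynomial_functions"
  shows "(\<lambda>L. \<Sum>i\<in>I. F i L) \<in> polynomial_functions"
  using assms
  by (induction I rule: infinite_finite_induct) (auto simp: polynomial_functions_zero polynomial_functions_add)

definition word_factor :: "'k::field psd_pair \<Rightarrow> bool \<Rightarrow> 'k psd2" where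
  "word_factor L b = (if b then snd L else fst L)"

lemma monom_val_zip:
  "length es = length w \<Longrightarrow>
    monom_val L (mset (zip w es)) = prod_list (map2 psd_coeff (map (word_factor L) w) es)"
  by (induction es w rule: list_induct2) (auto simp: coord_val_def word_factor_def)

text \<open>
  The expansion into lists of exponents is turned into one indexed by multisets of coordinates by collecting the lists
  with the same multiset. The coefficient \<open>c \<mu>\<close> is a sum over all lists with multiset \<open>\<mu>\<close>, independently of
  \<open>L\<close>; at a given \<open>L\<close> the lists that are no factorizations have coefficient zero or a vanishing monomial.
\<close>

lemma word_coeff_polynomial:
  "(\<lambda>L. psd_coeff (prod_list (map (word_factor L) w)) e) \<in> polynomial_functions"
proof -
  let ?m = "length w"
  let ?g = "\<lambda>es. psd_coeff (prod_list (map psd_monomial es)) e :: 'a"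
  let ?N = "\<lambda>\<mu>. {es. length es = ?m \<and> mset (zip w es) = \<mu>}"
  let ?T = "\<lambda>L :: 'a psd_pair. {x. psd_coeff (fst L) x \<noteq> 0} \<union> {x. psd_coeff (snd L) x \<noteq> 0}"
  let ?S = "\<lambda>L. factorizations derivative_shifts (?T L) ?m e"
  define c where "c \<mu> = (\<Sum>es\<in>?N \<mu>. ?g es)" for \<mu>
  have finN: "finite (?N \<mu>)" for \<mu>
  proof (rule finite_subset)
    show "?N \<mu> \<subseteq> {es. set es \<subseteq> snd ` set_mset \<mu> \<and> length es = ?m}"
    proof clarify
      fix es x assume "length es = ?m" "x \<in> set es"
      thus "x \<in> snd ` set_mset (mset (zip w es))"
        by (metis map_snd_zip set_map set_mset_mset)
    qed
    show "finite \<dots>" by (rule finite_lists_length_eq) simp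
  qed
  have finS: "finite (?S L)" for L
    by (intro finite_factorizations admissible_derivative_shifts adm.union admissible_support)
  have S: "es \<in> ?S L" if len: "length es = ?m" and g: "?g es \<noteq> 0" and m: "monom_val L (mset (zip w es)) \<noteq> 0" for es L
  proof -
    have "psd_coeff (1 * prod_list (map psd_monomial es)) e \<noteq> (0 :: 'a)" using g by simp
    from psd_coeff_prod_list_nonzero[OF this] obtain y es' where *: "psd_coeff (1 :: 'a psd2) y \<noteq> 0"
      "list_all2 (\<lambda>A x. psd_coeff A x \<noteq> 0) (map psd_monomial es :: 'a psd2 list) es'"
      "e - (y + sum_list es') \<in> derivative_shifts" by blast
    have "y = 0" using *(1) by (simp add: psd_coeff_one split: if_splits)
    moreover have "es' = es"
      using *(2) by (auto simp: list_all2_conv_all_nth intro!: nth_equalityI split: if_splits)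
    ultimately have "e - sum_list es \<in> derivative_shifts" using *(3) by simp
    moreover have "set es \<subseteq> ?T L"
    proof
      fix x assume "x \<in> set es"
      then obtain b where "(b, x) \<in> set (zip w es)"
        using in_set_impl_in_set_zip2[of w es x] len by metis
      hence "coord_val L (b, x) \<noteq> 0"
        using m unfolding monom_val_nonzero_iff coord_support_def by auto
      thus "x \<in> ?T L" by (auto simp: coord_val_def split: if_splits)
    qed
    ultimately show ?thesis using len by (simp add: factorizations_def)
  qed
  have sub: "{\<mu>. c \<mu> * monom_val L \<mu> \<noteq> 0} \<subseteq> (\<lambda>es. mset (zip w es)) ` ?S L" for L
  proof clarify
    fix \<mu> assume *: "c \<mu> * monom_val L \<mu> \<noteq> 0"
    hence "c \<mu> \<noteq> 0" by auto
    then obtain es where "es \<in> ?N \<mu>" "?g es \<noteq> 0"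
      unfolding c_def by (rule sum.not_neutral_contains_not_neutral)
    thus "\<mu> \<in> (\<lambda>es. mset (zip w es)) ` ?S L" using S[of es L] * by auto
  qed
  have "psd_coeff (prod_list (map (word_factor L) w)) e =
      (\<Sum>\<mu> | c \<mu> * monom_val L \<mu> \<noteq> 0. c \<mu> * monom_val L \<mu>)" for L
  proof -
    have "psd_coeff (1 * prod_list (map (word_factor L) w)) e =
      (\<Sum>es\<in>factorizations derivative_shifts (?T L) (length (map (word_factor L) w)) e.
         prod_list (map2 psd_coeff (map (word_factor L) w) es) * psd_coeff (1 * prod_list (map psd_monomial es)) e)"
      by (rule psd_coeff_prod_list_expand)
        (auto simp: word_factor_def psd_coeff_one admissible_derivative_shifts
          intro!: adm.union admissible_support split: if_splits)
    also have "\<dots> = (\<Sum>es\<in>?S L. monom_val L (mset (zip w es)) * ?g es)"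
      by (rule sum.cong) (auto simp: monom_val_zip factorizations_def)
    also have "\<dots> = (\<Sum>\<mu>\<in>(\<lambda>es. mset (zip w es)) ` ?S L. \<Sum>es | es \<in> ?S L \<and> mset (zip w es) = \<mu>.
        monom_val L (mset (zip w es)) * ?g es)"
      by (rule sum.image_gen[OF finS])
    also have "\<dots> = (\<Sum>\<mu>\<in>(\<lambda>es. mset (zip w es)) ` ?S L. c \<mu> * monom_val L \<mu>)"
    proof (rule sum.cong[OF refl])
      fix \<mu>
      have "(\<Sum>es | es \<in> ?S L \<and> mset (zip w es) = \<mu>. monom_val L (mset (zip w es)) * ?g es) =
        (\<Sum>es\<in>?N \<mu>. monom_val L \<mu> * ?g es)"
      proof (rule sum.mono_neutral_cong_left)
        show "\<forall>es\<in>?N \<mu> - {es. es \<in> ?S L \<and> mset (zip w es) = \<mu>}. monom_val L \<mu> * ?g es = 0"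
          using S by auto
      qed (auto simp: finN factorizations_def)
      thus "(\<Sum>es | es \<in> ?S L \<and> mset (zip w es) = \<mu>. monom_val L (mset (zip w es)) * ?g es) = c \<mu> * monom_val L \<mu>"
        by (simp add: c_def sum_distrib_left mult.commute)
    qed
    also have "\<dots> = (\<Sum>\<mu> | c \<mu> * monom_val L \<mu> \<noteq> 0. c \<mu> * monom_val L \<mu>)"
      by (rule sum.mono_neutral_right) (use finS sub in auto)
    finally show ?thesis by simp
  qed
  moreover have "size \<mu> \<le> ?m" if "c \<mu> \<noteq> 0" for \<mu>
  proof -
    obtain es where "es \<in> ?N \<mu>"
      using \<open>c \<mu> \<noteq> 0\<close> unfolding c_def by (rule sum.not_neutral_contains_not_neutral)
    thus ?thesis by auto
  qed
  moreover have "finite {\<mu>. c \<mu> * monom_val L \<mu> \<noteq> 0}" for L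
    by (rule finite_subset[OF sub]) (simp add: finS)
  ultimately show ?thesis unfolding polynomial_functions_def by blast
qed

lemma hamiltonian_polynomial: "hamiltonian m \<in> polynomial_functions"
proof -
  have eq: "hamiltonian_ab a b = (\<lambda>L :: 'a psd_pair.
      psd_coeff (prod_list (map (word_factor L) (replicate a False @ replicate b True))) (-1, -1, -1, -1))" for a b
    by (rule ext) (simp add: hamiltonian_ab_def res_def word_factor_def)
  have *: "(hamiltonian_ab a b :: 'a psd_pair \<Rightarrow> 'a) \<in> polynomial_functions" for a b
    unfolding eq by (rule word_coeff_polynomial)
  show ?thesis
    unfolding hamiltonian_def[abs_def] case_prod_unfold
    by (intro polynomial_functions_scale polynomial_functions_sum *)
qed

section \<open>The gradients of the Hamiltonians\<close>

text \<open>
  Polynomials in \<open>\<epsilon>\<close> with coefficients in \<open>P\<close>, generated by the Horner scheme; \<open>\<epsilon>\<close> ranges over the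
  scalars, so these are honest functions, as \<^const>\<open>has_dir_deriv\<close> asks for.
\<close>

inductive poly_curve :: "('k::field \<Rightarrow> 'k psd2) \<Rightarrow> bool" where
  const: "poly_curve (\<lambda>\<epsilon>. A)"
| horner: "poly_curve u \<Longrightarrow> poly_curve (\<lambda>\<epsilon>. A + scale_psd2 \<epsilon> (u \<epsilon>))"

lemma poly_curve_times_var: "poly_curve u \<Longrightarrow> poly_curve (\<lambda>\<epsilon>. scale_psd2 \<epsilon> (u \<epsilon>))"
  using poly_curve.horner[of u 0] by simp

lemma poly_curve_const_add: "poly_curve u \<Longrightarrow> poly_curve (\<lambda>\<epsilon>. A + u \<epsilon>)"
proof (induction rule: poly_curve.induct)
  case (horner u B)
  thus ?case using poly_curve.horner[of u "A + B"] by (simp add: add.assoc)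
qed (rule poly_curve.const)

lemma poly_curve_add: "poly_curve u \<Longrightarrow> poly_curve v \<Longrightarrow> poly_curve (\<lambda>\<epsilon>. u \<epsilon> + v \<epsilon>)"
proof (induction arbitrary: v rule: poly_curve.induct)
  case (const A)
  thus ?case by (rule poly_curve_const_add)
next
  case (horner u A)
  from horner.prems show ?case
  proof cases
    case (const B)
    thus ?thesis
      using poly_curve.horner[OF horner.hyps, of "B + A"] by (simp add: algebra_simps)
  next
    case (horner w B)
    have "poly_curve (\<lambda>\<epsilon>. (A + B) + scale_psd2 \<epsilon> (u \<epsilon> + w \<epsilon>))"
      by (intro poly_curve.horner horner.IH \<open>poly_curve w\<close>)
    thus ?thesis by (simp add: \<open>v = _\<close> scale_add algebra_simps)
  qed
qed

lemma poly_curve_const_mult: "poly_curve u \<Longrightarrow> poly_curve (\<lambda>\<epsilon>. A * u \<epsilon>)"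
proof (induction rule: poly_curve.induct)
  case (horner u B)
  thus ?case using poly_curve.horner[of "\<lambda>\<epsilon>. A * u \<epsilon>" "A * B"]
    by (simp add: distrib_left scale_mult_right)
qed (rule poly_curve.const)

lemma poly_curve_mult: "poly_curve u \<Longrightarrow> poly_curve v \<Longrightarrow> poly_curve (\<lambda>\<epsilon>. u \<epsilon> * v \<epsilon>)"
proof (induction rule: poly_curve.induct)
  case (const A)
  thus ?case by (rule poly_curve_const_mult)
next
  case (horner u A)
  have "poly_curve (\<lambda>\<epsilon>. A * v \<epsilon> + scale_psd2 \<epsilon> (u \<epsilon> * v \<epsilon>))"
    by (intro poly_curve_add poly_curve_const_mult poly_curve_times_var horner)
  thus ?case by (simp add: distrib_right scale_mult_left)
qed

lemma poly_curve_res: "poly_curve u \<Longrightarrow> \<exists>p. \<forall>\<epsilon>. res (u \<epsilon>) = poly p \<epsilon>"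
proof (induction rule: poly_curve.induct)
  case (const A)
  show ?case by (rule exI[of _ "[:res A:]"]) simp
next
  case (horner u A)
  then obtain p where "\<forall>\<epsilon>. res (u \<epsilon>) = poly p \<epsilon>" by blast
  thus ?case by (intro exI[of _ "pCons (res A) p"]) simp
qed

text \<open>
  \<open>u \<epsilon> = A + \<epsilon>B + O(\<epsilon>\<^sup>2)\<close> with a polynomial remainder. That \<open>u\<close> is polynomial is part of the
  notion, because the remainder of an arbitrary function of \<open>\<epsilon> \<in> k\<close> would not determine \<open>B\<close>.
\<close>

definition has_tangent :: "('k::field \<Rightarrow> 'k psd2) \<Rightarrow> 'k psd2 \<Rightarrow> 'k psd2 \<Rightarrow> bool" where
  "has_tangent u A B \<longleftrightarrow>
    (\<exists>r. poly_curve r \<and> (\<forall>\<epsilon>. u \<epsilon> = A + scale_psd2 \<epsilon> (B + scale_psd2 \<epsilon> (r \<epsilon>))))"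

lemma has_tangent_line: "has_tangent (\<lambda>\<epsilon>. A + scale_psd2 \<epsilon> M) A M"
  unfolding has_tangent_def
  by (rule exI[of _ "\<lambda>_. 0"]) (simp add: scale_zero_right poly_curve.const)

lemma has_tangent_mult:
  assumes "has_tangent u A B" "has_tangent u' A' B'"
  shows "has_tangent (\<lambda>\<epsilon>. u \<epsilon> * u' \<epsilon>) (A * A') (A * B' + B * A')"
proof -
  obtain r where r: "poly_curve r" "\<And>\<epsilon>. u \<epsilon> = A + scale_psd2 \<epsilon> (B + scale_psd2 \<epsilon> (r \<epsilon>))"
    using assms(1) unfolding has_tangent_def by blast
  obtain r' where r': "poly_curve r'" "\<And>\<epsilon>. u' \<epsilon> = A' + scale_psd2 \<epsilon> (B' + scale_psd2 \<epsilon> (r' \<epsilon>))"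
    using assms(2) unfolding has_tangent_def by blast
  define s where "s \<epsilon> = B + scale_psd2 \<epsilon> (r \<epsilon>)" for \<epsilon>
  define s' where "s' \<epsilon> = B' + scale_psd2 \<epsilon> (r' \<epsilon>)" for \<epsilon>
  define t where "t \<epsilon> = A * r' \<epsilon> + r \<epsilon> * A' + s \<epsilon> * s' \<epsilon>" for \<epsilon>
  have ss: "poly_curve s" "poly_curve s'"
    unfolding s_def[abs_def] s'_def[abs_def] using r r' by (auto intro: poly_curve.horner)
  have "poly_curve t" unfolding t_def[abs_def]
    by (intro poly_curve_add poly_curve_mult poly_curve.const ss r(1) r'(1))
  moreover have "u \<epsilon> * u' \<epsilon> = A * A' + scale_psd2 \<epsilon> (A * B' + B * A' + scale_psd2 \<epsilon> (t \<epsilon>))" for \<epsilon>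
  proof -
    have "u \<epsilon> * u' \<epsilon> = (A + scale_psd2 \<epsilon> (s \<epsilon>)) * (A' + scale_psd2 \<epsilon> (s' \<epsilon>))"
      by (simp add: r(2) r'(2) s_def s'_def)
    also have "\<dots> = A * A' + scale_psd2 \<epsilon> (A * s' \<epsilon> + s \<epsilon> * A' + scale_psd2 \<epsilon> (s \<epsilon> * s' \<epsilon>))"
      by (simp add: distrib_left distrib_right scale_mult_left scale_mult_right scale_add add.assoc add.left_commute)
    also have "A * s' \<epsilon> + s \<epsilon> * A' + scale_psd2 \<epsilon> (s \<epsilon> * s' \<epsilon>) = A * B' + B * A' + scale_psd2 \<epsilon> (t \<epsilon>)"
      by (simp add: s_def s'_def t_def distrib_left distrib_right scale_mult_left scale_mult_right scale_add add.assoc add.left_commute)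
    finally show ?thesis .
  qed
  ultimately show ?thesis unfolding has_tangent_def by blast
qed

lemma has_tangent_power:
  assumes "has_tangent u A B"
  shows "has_tangent (\<lambda>\<epsilon>. u \<epsilon> ^ n) (A ^ n) (\<Sum>i<n. A ^ i * B * A ^ (n - 1 - i))"
proof (induction n)
  case 0
  show ?case using has_tangent_line[of 1 0] by (simp add: scale_zero_right)
next
  case (Suc n)
  have "A * (A ^ i * B * A ^ (n - 1 - i)) = A ^ Suc i * B * A ^ (Suc n - 1 - Suc i)" for i
    by (simp add: mult.assoc)
  hence "A * (\<Sum>i<n. A ^ i * B * A ^ (n - 1 - i)) + B * A ^ n = (\<Sum>i<Suc n. A ^ i * B * A ^ (Suc n - 1 - i))"
    by (subst sum.lessThan_Suc_shift) (simp add: sum_distrib_left add.commute)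
  thus ?case using has_tangent_mult[OF assms Suc.IH] by simp
qed

lemma has_tangent_res:
  assumes "has_tangent u A B"
  shows "\<exists>p. (\<forall>\<epsilon>. res (u \<epsilon>) = poly p \<epsilon>) \<and> res B = poly (pderiv p) 0"
proof -
  obtain r where r: "poly_curve r" "\<And>\<epsilon>. u \<epsilon> = A + scale_psd2 \<epsilon> (B + scale_psd2 \<epsilon> (r \<epsilon>))"
    using assms unfolding has_tangent_def by blast
  obtain q where "\<forall>\<epsilon>. res (r \<epsilon>) = poly q \<epsilon>" using poly_curve_res[OF r(1)] by blast
  thus ?thesis
    by (intro exI[of _ "pCons (res A) (pCons (res B) q)"]) (simp add: r(2) pderiv_pCons)
qed

lemma pairing_add_right: "pairing M (G + G') = pairing M G + pairing M G'"
  and pairing_scale_right: "pairing M (pair_scale c G) = c * pairing M G"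
  by (simp_all add: pairing_def pair_scale_def distrib_left scale_mult_right algebra_simps)

lemma is_gradient_add:
  assumes "is_gradient F L G" "is_gradient F' L G'"
  shows "is_gradient (\<lambda>L. F L + F' L) L (G + G')"
  unfolding is_gradient_def
proof
  fix M
  obtain p p' where "\<And>\<epsilon>. F (L + pair_scale \<epsilon> M) = poly p \<epsilon>" "pairing M G = poly (pderiv p) 0"
    "\<And>\<epsilon>. F' (L + pair_scale \<epsilon> M) = poly p' \<epsilon>" "pairing M G' = poly (pderiv p') 0"
    using assms unfolding is_gradient_def has_dir_deriv_def by metis
  thus "has_dir_deriv (\<lambda>L. F L + F' L) L M (pairing M (G + G'))"
    unfolding has_dir_deriv_def by (intro exI[of _ "p + p'"]) (simp add: pderiv_add pairing_add_right)
qed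

lemma is_gradient_scale:
  assumes "is_gradient F L G"
  shows "is_gradient (\<lambda>L. c * F L) L (pair_scale c G)"
  unfolding is_gradient_def
proof
  fix M
  obtain p where "\<And>\<epsilon>. F (L + pair_scale \<epsilon> M) = poly p \<epsilon>" "pairing M G = poly (pderiv p) 0"
    using assms unfolding is_gradient_def has_dir_deriv_def by metis
  thus "has_dir_deriv (\<lambda>L. c * F L) L M (pairing M (pair_scale c G))"
    unfolding has_dir_deriv_def by (intro exI[of _ "smult c p"]) (simp add: pderiv_smult pairing_scale_right)
qed

lemma is_gradient_zero: "is_gradient (\<lambda>L. 0) L 0"
  unfolding is_gradient_def has_dir_deriv_def by (intro allI exI[of _ 0]) (simp add: pairing_def)

lemma is_gradient_sum:
  assumes "\<And>i. i \<in> I \<Longrightarrow> is_gradient (F i) L (G i)"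
  shows "is_gradient (\<lambda>L. \<Sum>i\<in>I. F i L) L (\<Sum>i\<in>I. G i)"
  using assms
  by (induction I rule: infinite_finite_induct) (auto simp: is_gradient_zero is_gradient_add)

text \<open>
  Cyclic rotation collects the \<open>n\<close> terms of the derivative of \<open>A\<^sup>n\<close> on one side of \<open>M\<close>, where they coincide.
\<close>

lemma res_power_sum:
  assumes c: "A * C = C * A"
  shows "res ((\<Sum>i<n. A ^ i * M * A ^ (n - 1 - i)) * C) = res (M * (of_nat n * A ^ (n - 1) * C))"
proof -
  have "res (A ^ i * M * A ^ (n - 1 - i) * C) = res (M * (A ^ (n - 1) * C))" if i: "i < n" for i
  proof -
    have "res (A ^ i * M * A ^ (n - 1 - i) * C) = res (M * A ^ (n - 1 - i) * C * A ^ i)"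
      using res_trace[of "A ^ i"] by (simp add: mult.assoc)
    also have "C * A ^ i = A ^ i * C" using power_commuting_commutes[OF c] by simp
    hence "M * A ^ (n - 1 - i) * C * A ^ i = M * (A ^ (n - 1 - i) * A ^ i * C)" by (simp add: mult.assoc)
    also have "A ^ (n - 1 - i) * A ^ i = A ^ (n - 1)" using i by (simp flip: power_add)
    finally show ?thesis .
  qed
  hence "res ((\<Sum>i<n. A ^ i * M * A ^ (n - 1 - i)) * C) = of_nat n * res (M * (A ^ (n - 1) * C))"
    by (simp add: sum_distrib_right res_sum)
  also have "\<dots> = res (M * (of_nat n * A ^ (n - 1) * C))"
    by (simp only: mult.assoc scale_of_nat[symmetric] scale_mult_left scale_mult_right res_scale)
  finally show ?thesis .
qed

lemma hamiltonian_ab_gradient: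
  assumes "fst L * snd L = snd L * fst L"
  shows "is_gradient (hamiltonian_ab a b) L
    (of_nat a * fst L ^ (a - 1) * snd L ^ b, of_nat b * fst L ^ a * snd L ^ (b - 1))"
  unfolding is_gradient_def
proof
  fix M
  let ?A = "fst L" and ?B = "snd L"
  let ?S = "\<lambda>A M n. \<Sum>i<n. A ^ i * M * A ^ (n - 1 - i)"
  have comm: "?A * ?B ^ b = ?B ^ b * ?A" "?B * ?A ^ a = ?A ^ a * ?B" "?A ^ a * ?B ^ (b - 1) = ?B ^ (b - 1) * ?A ^ a"
    using assms by (metis power_commuting_commutes)+
  have "has_tangent (\<lambda>\<epsilon>. (?A + scale_psd2 \<epsilon> (fst M)) ^ a * (?B + scale_psd2 \<epsilon> (snd M)) ^ b) (?A ^ a * ?B ^ b)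
      (?A ^ a * ?S ?B (snd M) b + ?S ?A (fst M) a * ?B ^ b)"
    by (intro has_tangent_mult has_tangent_power has_tangent_line)
  from has_tangent_res[OF this] obtain p where
    p: "\<And>\<epsilon>. hamiltonian_ab a b (L + pair_scale \<epsilon> M) = poly p \<epsilon>"
    and D: "res (?A ^ a * ?S ?B (snd M) b + ?S ?A (fst M) a * ?B ^ b) = poly (pderiv p) 0"
    by (auto simp: hamiltonian_ab_def pair_scale_def)
  have "res (?A ^ a * ?S ?B (snd M) b) = res (snd M * (of_nat b * ?B ^ (b - 1) * ?A ^ a))"
    using res_power_sum[OF comm(2), where n = b and M = "snd M"] res_trace[of "?A ^ a"] by metis
  moreover have "res (?S ?A (fst M) a * ?B ^ b) = res (fst M * (of_nat a * ?A ^ (a - 1) * ?B ^ b))"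
    by (rule res_power_sum[OF comm(1)])
  ultimately have "pairing M (of_nat a * ?A ^ (a - 1) * ?B ^ b, of_nat b * ?A ^ a * ?B ^ (b - 1)) = poly (pderiv p) 0"
    using D by (simp add: pairing_def mult.assoc comm(3)[unfolded One_nat_def] add.commute)
  thus "has_dir_deriv (hamiltonian_ab a b) L M
      (pairing M (of_nat a * ?A ^ (a - 1) * ?B ^ b, of_nat b * ?A ^ a * ?B ^ (b - 1)))"
    unfolding has_dir_deriv_def using p by blast
qed

text \<open>
  The binomial theorem in a noncommutative ring, for two elements that commute.
\<close>

lemma binomial_commuting:
  fixes A B :: "'a::ring_1"
  assumes "A * B = B * A"
  shows "(A + B) ^ n = (\<Sum>i\<le>n. of_nat (n choose i) * A ^ i * B ^ (n - i))"
proof (induction n)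
  case (Suc n)
  let ?t = "\<lambda>c i j. of_nat c * A ^ i * B ^ j"
  have cA: "A * ?t c i j = ?t c (Suc i) j" for c i j
  proof -
    have "A * ?t c i j = (A * of_nat c) * A ^ i * B ^ j" by (simp only: mult.assoc)
    thus ?thesis by (simp only: mult_of_nat_commute[symmetric] power_Suc mult.assoc)
  qed
  have cB: "B * ?t c i j = ?t c i (Suc j)" for c i j
  proof -
    have "B * ?t c i j = (B * of_nat c) * A ^ i * B ^ j" by (simp only: mult.assoc)
    also have "\<dots> = of_nat c * (B * A ^ i) * B ^ j"
      by (simp only: mult_of_nat_commute[symmetric] mult.assoc)
    also have "B * A ^ i = A ^ i * B" using power_commuting_commutes[OF assms] by simp
    finally show ?thesis by (simp only: power_Suc mult.assoc)
  qed
  have "(A + B) ^ Suc n = (\<Sum>i\<le>n. ?t (n choose i) (Suc i) (n - i)) + (\<Sum>i\<le>n. ?t (n choose i) i (Suc (n - i)))"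
    by (simp only: power_Suc[of "A + B"] Suc distrib_right sum_distrib_left cA cB sum.distrib)
  also have "(\<Sum>i\<le>n. ?t (n choose i) i (Suc (n - i))) = (\<Sum>i\<le>Suc n. ?t (n choose i) i (Suc n - i))"
    by (simp add: binomial_eq_0 Suc_diff_le)
  also have "\<dots> = B ^ Suc n + (\<Sum>i\<le>n. ?t (n choose Suc i) (Suc i) (n - i))"
    by (subst sum.atMost_Suc_shift) simp
  also have "(\<Sum>i\<le>n. ?t (n choose i) (Suc i) (n - i)) + \<dots> = B ^ Suc n + (\<Sum>i\<le>n. ?t (Suc n choose Suc i) (Suc i) (n - i))"
    by (simp add: sum.distrib distrib_right add.left_commute)
  also have "\<dots> = (\<Sum>i\<le>Suc n. ?t (Suc n choose i) i (Suc n - i))"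
    by (subst sum.atMost_Suc_shift) simp
  finally show ?case .
qed simp

text \<open>
  By \<open>(m choose a) a = m ((m-1) choose (a-1))\<close> and \<open>(m choose a) (m - a) = m ((m-1) choose a)\<close>, both components
  of the weighted sum of gradients are \<open>m\<close> times the binomial expansion of \<open>(L\<^sub>1 + L\<^sub>2)\<^bsup>m-1\<^esup>\<close>.
\<close>

lemma hamiltonian_gradient:
  fixes L :: "'k::field_char_0 psd_pair"
  assumes L: "L \<in> commuting_pairs" and m: "m \<ge> 1"
  shows "is_gradient (hamiltonian m) L ((fst L + snd L) ^ (m - 1), (fst L + snd L) ^ (m - 1))"
proof -
  obtain n where n: "m = Suc n" using m by (cases m) auto
  let ?A = "fst L" and ?B = "snd L"
  have comm: "?A * ?B = ?B * ?A" using L by (simp add: commuting_pairs_def commutator_def)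
  let ?G = "\<lambda>a b. (of_nat a * ?A ^ (a - 1) * ?B ^ b, of_nat b * ?A ^ a * ?B ^ (b - 1))"
  let ?T = "\<Sum>a\<le>m. pair_scale (of_nat (m choose a)) (?G a (m - a))"
  have H: "hamiltonian m = (\<lambda>L :: 'k psd_pair. (1 / of_nat m) * (\<Sum>a\<le>m. of_nat (m choose a) * hamiltonian_ab a (m - a) L))"
    unfolding hamiltonian_def
    by (intro ext arg_cong[where f = "(*) _"] sum.reindex_bij_witness[where i = "\<lambda>a. (a, m - a)" and j = fst]) auto
  have "is_gradient (hamiltonian m) L (pair_scale (1 / of_nat m) ?T)"
    unfolding H by (intro is_gradient_scale is_gradient_sum hamiltonian_ab_gradient comm)
  moreover have "fst ?T = of_nat m * (?A + ?B) ^ n"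
  proof -
    have "fst ?T = (\<Sum>a\<le>m. of_nat ((m choose a) * a) * ?A ^ (a - 1) * ?B ^ (m - a))"
      by (simp add: fst_sum pair_scale_def scale_of_nat mult.assoc)
    also have "\<dots> = (\<Sum>i\<le>n. of_nat (m * (n choose i)) * ?A ^ i * ?B ^ (n - i))"
      unfolding n by (subst sum.atMost_Suc_shift)
        (simp add: Suc_times_binomial mult.commute[of _ "Suc _"] del: of_nat_mult of_nat_Suc binomial_Suc_Suc mult_Suc mult_Suc_right)
    also have "\<dots> = of_nat m * (?A + ?B) ^ n"
      by (simp add: binomial_commuting[OF comm] sum_distrib_left mult.assoc)
    finally show ?thesis .
  qed
  moreover have "snd ?T = of_nat m * (?A + ?B) ^ n"
  proof -
    have "snd ?T = (\<Sum>a\<le>m. of_nat ((m choose a) * (m - a)) * ?A ^ a * ?B ^ (m - a - 1))"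
      by (simp add: snd_sum pair_scale_def scale_of_nat mult.assoc)
    also have "\<dots> = (\<Sum>i\<le>n. of_nat ((m choose i) * (m - i)) * ?A ^ i * ?B ^ (m - i - 1))"
      unfolding n by simp
    also have "\<dots> = (\<Sum>i\<le>n. of_nat (m * (n choose i)) * ?A ^ i * ?B ^ (n - i))"
      using binomial_absorb_comp[of m] n
      by (intro sum.cong refl) (simp add: mult.commute del: of_nat_mult of_nat_Suc binomial_Suc_Suc mult_Suc mult_Suc_right)
    also have "\<dots> = of_nat m * (?A + ?B) ^ n"
      by (simp add: binomial_commuting[OF comm] sum_distrib_left mult.assoc)
    finally show ?thesis .
  qed
  moreover have "scale_psd2 (1 / of_nat m) (of_nat m * Q) = Q" for Q :: "'k psd2"
    using m by (simp only: scale_of_nat[symmetric] scale_scale) (simp add: scale_one)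
  ultimately show ?thesis by (simp add: pair_scale_def n)
qed

section \<open>The flow\<close>

lemma plus_part_minus_part: "plus_part Q + minus_part Q = Q"
  by transfer auto

text \<open>
  One component of \<open>\<langle>L, [X, Q]\<^sub>R\<rangle>\<close>, where \<open>Y\<close> stands for \<open>R X\<close>. Moving the bracket onto \<open>A\<close>, the
  first summand contains \<open>[Q, A] = 0\<close>, and in the second \<open>[Q\<^sub>+ - Q\<^sub>-, A] = 2 [Q\<^sub>+, A] - [Q, A]\<close>.
\<close>

lemma res_R_bracket:
  fixes A Q X Y :: "'k::field_char_0 psd2"
  assumes "A * Q = Q * A"
  shows "res (A * (scale_psd2 (1 / 2) (commutator Y Q) +
      scale_psd2 (1 / 2) (commutator X (plus_part Q - minus_part Q)))) =
    res (commutator (plus_part Q) A * X)"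
proof -
  have QA: "commutator Q A = 0" using assms by (simp add: commutator_def)
  have 1: "res (A * commutator Y Q) = 0"
    by (simp add: res_commutator[of A Y] QA)
  have "plus_part Q - minus_part Q = plus_part Q + plus_part Q - Q"
    using plus_part_minus_part[of Q] by (simp add: algebra_simps)
  hence "commutator (plus_part Q - minus_part Q) A = commutator (plus_part Q) A + commutator (plus_part Q) A - commutator Q A"
    by (simp only:) (simp add: commutator_def algebra_simps)
  hence "res (A * commutator X (plus_part Q - minus_part Q)) = 2 * res (commutator (plus_part Q) A * X)"
    by (simp add: res_commutator[of A X] QA distrib_left res_trace[of X])
  thus ?thesis using 1 by (simp add: distrib_left scale_mult_right)
qed

lemma poisson_R_hamiltonian:
  fixes L :: "'k::field_char_0 psd_pair"
  assumes L: "L \<in> commuting_pairs" and m: "m \<ge> 1"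
  shows "poisson_R F (hamiltonian m) L = pairing (lax_field m L) (gradient F L)"
proof -
  define Q where "Q = (fst L + snd L) ^ (m - 1)"
  have comm: "fst L * snd L = snd L * fst L" using L by (simp add: commuting_pairs_def commutator_def)
  have Q: "fst L * Q = Q * fst L" "snd L * Q = Q * snd L"
    unfolding Q_def
    by (rule power_commuting_commutes[symmetric], simp add: comm distrib_left distrib_right)+
  show ?thesis
    unfolding poisson_R_def gradient_eqI[OF hamiltonian_gradient[OF L m]] lax_field_def Q_def[symmetric]
    by (simp add: pairing_def R_bracket_def pair_scale_def pair_bracket_def R_op_def
        res_R_bracket[OF Q(1)] res_R_bracket[OF Q(2)])
qed

lemma lax_field_tangent:
  assumes "L \<in> commuting_pairs"
  shows "tangent_to_commuting L (lax_field m L)"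
proof -
  obtain A B where L: "L = (A, B)" by (cases L)
  have comm: "A * B = B * A" using assms by (simp add: L commuting_pairs_def commutator_def)
  define P where "P = plus_part ((A + B) ^ (m - 1))"
  let ?X = "P * A - A * P" and ?Y = "P * B - B * P"
  have jacobi: "A * ?Y + ?X * B - (B * ?X + ?Y * A) = 0"
  proof -
    have "A * ?Y + ?X * B - (B * ?X + ?Y * A) = P * (A * B) - (A * B) * P - (P * (B * A) - (B * A) * P)"
      by (simp add: algebra_simps)
    thus ?thesis by (simp add: comm)
  qed
  have X: "lax_field m L = (?X, ?Y)" by (simp add: lax_field_def L P_def commutator_def)
  show ?thesis
    unfolding tangent_to_commuting_def X
  proof (intro allI impI)
    fix n :: nat assume "n < 2"
    hence "n = 0 \<or> n = 1" by auto
    thus "fps_nth (commutator (fps_const (fst L) + fps_X * fps_const (fst (?X, ?Y)))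
        (fps_const (snd L) + fps_X * fps_const (snd (?X, ?Y)))) n = 0"
      using jacobi comm by (auto simp: commutator_def L fps_mult_nth)
  qed
qed

lemma lax_field_hamiltonian_pairing:
  fixes L :: "'k::field_char_0 psd_pair"
  assumes L: "L \<in> commuting_pairs" and m': "m' \<ge> 1"
  shows "pairing (lax_field m L) (gradient (hamiltonian m') L) = 0"
proof -
  define Q where "Q = (fst L + snd L) ^ (m' - 1)"
  have comm: "fst L * snd L = snd L * fst L" using L by (simp add: commuting_pairs_def commutator_def)
  have "fst L * Q = Q * fst L" "snd L * Q = Q * snd L"
    unfolding Q_def
    by (rule power_commuting_commutes[symmetric], simp add: comm distrib_left distrib_right)+
  hence Q: "commutator (fst L) Q = 0" "commutator (snd L) Q = 0"
    by (simp_all add: commutator_def)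
  have "res (commutator P A * Q) = res (P * commutator A Q)" for P A
    using res_trace[of Q "commutator P A"] res_commutator[of Q P A] by simp
  thus ?thesis
    unfolding gradient_eqI[OF hamiltonian_gradient[OF L m']] Q_def[symmetric] lax_field_def
    by (simp add: pairing_def Q)
qed

theorem proposition9:
  fixes m :: nat
  assumes "m \<ge> 1"
  shows "(hamiltonian m :: 'k::field_char_0 psd_pair \<Rightarrow> 'k) \<in> polynomial_functions \<and>
    (\<forall>L \<in> (commuting_pairs :: 'k psd_pair set).
       tangent_to_commuting L (lax_field m L) \<and>
       system_has_form (hamiltonian m) L (lax_field m L)) \<and>
    (\<forall>m'\<ge>1. \<forall>L \<in> (commuting_pairs :: 'k psd_pair set).
       has_dir_deriv (hamiltonian m') L (lax_field m L) 0 \<and>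
       poisson_R (hamiltonian m) (hamiltonian m') L = 0)"
proof (intro conjI ballI allI impI)
  show "hamiltonian m \<in> polynomial_functions" by (rule hamiltonian_polynomial)
next
  fix L :: "'k psd_pair" assume L: "L \<in> commuting_pairs"
  show "tangent_to_commuting L (lax_field m L)" by (rule lax_field_tangent[OF L])
  show "system_has_form (hamiltonian m) L (lax_field m L)"
    unfolding system_has_form_def poisson_R_hamiltonian[OF L assms]
  proof
    fix F :: "'k psd_pair \<Rightarrow> 'k" assume "F \<in> polynomial_functions"
    then obtain G where G: "is_gradient F L G" using polynomial_function_has_gradient by blast
    thus "has_dir_deriv F L (lax_field m L) (pairing (lax_field m L) (gradient F L))"
      unfolding gradient_eqI[OF G] is_gradient_def by blast
  qed
next
  fix m' :: nat and L :: "'k psd_pair" assume m': "m' \<ge> 1" and L: "L \<in> commuting_pairs"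
  show "has_dir_deriv (hamiltonian m') L (lax_field m L) 0"
    using hamiltonian_gradient[OF L m'] lax_field_hamiltonian_pairing[OF L m', of m]
    unfolding gradient_eqI[OF hamiltonian_gradient[OF L m']] is_gradient_def by metis
  show "poisson_R (hamiltonian m) (hamiltonian m') L = 0"
    using poisson_R_hamiltonian[OF L m'] lax_field_hamiltonian_pairing[OF L assms] by simp
qed

end
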